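(* Let $\mathcal{NN}$ be a function space CNN (as defined in the context) with $p=2$, a Lipschitz continuous activation function $\sigma:\mathbb{R}\to\mathbb{R}$, and $L\ge 2$ layers (i.e. at least two convolutional layers). Then for every input $\mu\in\mathcal{M}(\overline{\Omega_0})$, every $w\in\mathcal{W}^2(\Sigma)$ and every $b\in\mathbb{R}^L$ we have $\mathcal{NN}(\mu,w,b)\in C(\overline{\Omega})$. If in addition $\mu\in \mathrm{BV}(\Omega_0)$ (identified with the measure $\mu\,\mathrm{d}x$), then $\mathcal{NN}(\mu,w,b)\in C^1(\overline{\Omega})$.
   Context: A rectangular domain is a nonempty open set $(a,b)\times(c,d)\subset\mathbb{R}^2$. For rectangular $\Omega,\Sigma$ with $0\in\Sigma$ set $\Omega-\Sigma=\{x-y: x\in\Omega,y\in\Sigma\}$. $\mathcal{M}(\overline{\theta})$ is the space of finite signed Radon measures on $\overline\theta$ (dual of $C(\overline\theta)$), with total variation norm. $\mathrm{BV}(\theta)=\{u\in L^1(\theta): \mathrm{D}u\in\mathcal{M}(\theta)\}$, $\mathrm{D}u$ the distributional derivative. Valid convolution: for $w\in L^p(\Sigma)$ and $u\in L^1(\Omega-\Sigma)$, $(u*w)(x)=\int_\Sigma w(y)u(x-y)\,\mathrm{d}y$ for $x\in\Omega$; for $\mu\in\mathcal{M}(\overline{\Omega-\Sigma})$, $(\mu*w)(x)=\int \tilde w(x-z)\,\mathrm{d}\mu(z)$, $x\in\Omega$, where $\tilde w$ is the zero extension of $w$; in both cases $u*w\in L^p(\Omega)$. Extension by reflection: for $\theta=(a,b)\times(c,d)$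 and a function $u$ on $\overline\theta$, let $\bar u$ be its extension to $\mathbb{R}^2$ by repeated even reflection across the sides of the rectangle (elementary step: $\bar u(x_1,x_2)=u(x_1,|x_2-c|+c)$ extends across the side $x_2=c$; analogously across the other sides, iterated). For $\mu\in\mathcal{M}(\overline\theta)$, $\bar\mu$ is defined analogously: it agrees with $\mu$ on $\overline\theta$ and on each reflected copy of the rectangle it is the image of $\mu$ under the corresponding reflection. For a rectangular $\Omega\supseteq\theta$, $\mathfrak{R}_{\theta,\Omega}u:=\bar u|_{\Omega}$, $\mathfrak{R}_{\theta,\Omega}\mu:=\bar\mu|_{\overline\Omega}$. Function space CNN: let $L\in\mathbb{N}$, $\sigma:\mathbb{R}\to\mathbb{R}$, $p\in(1,\infty]$, rectangular domains $\Omega_0,\dots,\Omega_L=\Omega$ and $\Sigma_0,\dots,\Sigma_{L-1}$ with $0\in\Sigma_l$; set $\Omega_l'=\Omega_{l+1}-\Sigma_l$ and assume $\Omega_l\subseteq\Omega_l'$. Let $\mathcal{W}^p(\Sigma)=L^p(\Sigma_0)\times\dots\times L^p(\Sigma_{L-1})$. For $\mu\in\mathcal{M}(\overline{\Omega_0})$, $w=(w^l)_l\in\mathcal{W}^p(\Sigma)$, $b=(b^l)_l\in\mathbb{R}^L$ define $\mu^0=\mu$, $\mu^{l+1}=\sigma\big((\mathfrak{R}_{\Omega_l,\Omega_l'}\mu^l)*w^l+b^l\big)$ for $l=0,\dots,L-2$ ($\sigma$ applied pointwise), and $\mathcal{NN}(\mu,w,b)=(\mathfrak{R}_{\Omega_{L-1},\Omega_{L-1}'}\mu^{L-1})*w^{L-1}+b^{L-1}\in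 L^p(\Omega)$. *)

theory Defs
  imports "HOL-Analysis.Analysis"
begin

type_synonym pt = "real \<times> real"

definition rect :: "pt set \<Rightarrow> bool" where
  "rect S \<longleftrightarrow> (\<exists>a b c d. a < b \<and> c < d \<and> S = {a<..<b} \<times> {c<..<d})"

definition mdiff :: "pt set \<Rightarrow> pt set \<Rightarrow> pt set" where
  "mdiff A B = {x - y | x y. x \<in> A \<and> y \<in> B}"

text \<open>Repeated even reflection of the real line onto [a,b] (the folding map):
  identity on [a,b], even with respect to a and b, 2(b-a)-periodic.\<close>
definition fold_int :: "real \<Rightarrow> real \<Rightarrow> real \<Rightarrow> real" where
  "fold_int a b t =
     (let l = b - a; s = (t - a) - 2 * l * of_int \<lfloor>(t - a) / (2 * l)\<rfloor> in a + (l - \<bar>s - l\<bar>))"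

definition foldmap :: "pt set \<Rightarrow> pt \<Rightarrow> pt" where
  "foldmap \<theta> x = (fold_int (Inf (fst ` \<theta>)) (Sup (fst ` \<theta>)) (fst x),
                    fold_int (Inf (snd ` \<theta>)) (Sup (snd ` \<theta>)) (snd x))"

definition refl_fun :: "pt set \<Rightarrow> (pt \<Rightarrow> real) \<Rightarrow> pt \<Rightarrow> real" where
  "refl_fun \<theta> u = (\<lambda>x. u (foldmap \<theta> x))"

text \<open>Reflection extension of a (nonnegative, finite) measure m on closure theta,
  restricted to closure Omega: the mass of m at y is copied to every point x of
  closure Omega with foldmap theta x = y (once per point), i.e. on every reflected
  copy of the rectangle the extension is the image of m under the reflection.\<close>
definition refl_meas :: "pt set \<Rightarrow> pt set \<Rightarrow> pt measure \<Rightarrow> pt measure" where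
  "refl_meas \<theta> \<Omega> m = measure_of UNIV (sets borel)
     (\<lambda>A. \<integral>\<^sup>+ y. of_nat (card {x \<in> A \<inter> closure \<Omega>. foldmap \<theta> x = y}) \<partial>m)"

text \<open>Finite (nonnegative) Borel measure concentrated on S. A finite signed Radon
  measure on S is represented as a difference m1 - m2 of two such measures.\<close>
definition fin_meas_on :: "pt set \<Rightarrow> pt measure \<Rightarrow> bool" where
  "fin_meas_on S m \<longleftrightarrow> sets m = sets borel \<and> finite_measure m \<and> emeasure m (UNIV - S) = 0"

definition conv_fun :: "pt set \<Rightarrow> (pt \<Rightarrow> real) \<Rightarrow> (pt \<Rightarrow> real) \<Rightarrow> pt \<Rightarrow> real" where
  "conv_fun \<Sigma> w v x = (\<integral>y\<in>\<Sigma>. w y * v (x - y) \<partial>lborel)"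

definition conv_meas :: "pt set \<Rightarrow> (pt \<Rightarrow> real) \<Rightarrow> pt measure \<Rightarrow> pt \<Rightarrow> real" where
  "conv_meas \<Sigma> w \<nu> x = (\<integral>z. indicator \<Sigma> (x - z) * w (x - z) \<partial>\<nu>)"

text \<open>Hidden layers mu^l (l \<ge> 1) of the CNN; the input measure is m1 - m2.
  Om, Sg: the domains Omega_l, Sigma_l; Omega_l' = mdiff (Om (l+1)) (Sg l).\<close>
fun cnn_layer :: "(real \<Rightarrow> real) \<Rightarrow> (nat \<Rightarrow> pt set) \<Rightarrow> (nat \<Rightarrow> pt set) \<Rightarrow>
    pt measure \<Rightarrow> pt measure \<Rightarrow> (nat \<Rightarrow> pt \<Rightarrow> real) \<Rightarrow> (nat \<Rightarrow> real) \<Rightarrow> nat \<Rightarrow> pt \<Rightarrow> real" where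
  "cnn_layer \<sigma> Om Sg m1 m2 w b 0 = (\<lambda>x. 0)"
| "cnn_layer \<sigma> Om Sg m1 m2 w b (Suc 0) = (\<lambda>x. \<sigma>
      (conv_meas (Sg 0) (w 0) (refl_meas (Om 0) (mdiff (Om 1) (Sg 0)) m1) x
     - conv_meas (Sg 0) (w 0) (refl_meas (Om 0) (mdiff (Om 1) (Sg 0)) m2) x + b 0))"
| "cnn_layer \<sigma> Om Sg m1 m2 w b (Suc (Suc l)) = (\<lambda>x. \<sigma>
      (conv_fun (Sg (Suc l)) (w (Suc l))
         (refl_fun (Om (Suc l)) (cnn_layer \<sigma> Om Sg m1 m2 w b (Suc l))) x + b (Suc l)))"

definition cnn :: "nat \<Rightarrow> (real \<Rightarrow> real) \<Rightarrow> (nat \<Rightarrow> pt set) \<Rightarrow> (nat \<Rightarrow> pt set) \<Rightarrow>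
    pt measure \<Rightarrow> pt measure \<Rightarrow> (nat \<Rightarrow> pt \<Rightarrow> real) \<Rightarrow> (nat \<Rightarrow> real) \<Rightarrow> pt \<Rightarrow> real" where
  "cnn L \<sigma> Om Sg m1 m2 w b =
    (if L = 1 then (\<lambda>x.
        conv_meas (Sg 0) (w 0) (refl_meas (Om 0) (mdiff (Om 1) (Sg 0)) m1) x
      - conv_meas (Sg 0) (w 0) (refl_meas (Om 0) (mdiff (Om 1) (Sg 0)) m2) x + b 0)
     else (\<lambda>x. conv_fun (Sg (L - 1)) (w (L - 1))
         (refl_fun (Om (L - 1)) (cnn_layer \<sigma> Om Sg m1 m2 w b (L - 1))) x + b (L - 1)))"

coinductive smooth2 :: "(pt \<Rightarrow> real) \<Rightarrow> bool" where
  "(\<forall>x. (f has_derivative (\<lambda>h. f1 x * fst h + f2 x * snd h)) (at x))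
    \<Longrightarrow> smooth2 f1 \<Longrightarrow> smooth2 f2 \<Longrightarrow> smooth2 f"

definition test_fun :: "pt set \<Rightarrow> (pt \<Rightarrow> real) \<Rightarrow> (pt \<Rightarrow> real) \<Rightarrow> (pt \<Rightarrow> real) \<Rightarrow> bool" where
  "test_fun \<theta> \<phi> \<phi>1 \<phi>2 \<longleftrightarrow> smooth2 \<phi>
     \<and> (\<forall>x. (\<phi> has_derivative (\<lambda>h. \<phi>1 x * fst h + \<phi>2 x * snd h)) (at x))
     \<and> compact (closure {x. \<phi> x \<noteq> 0}) \<and> closure {x. \<phi> x \<noteq> 0} \<subseteq> \<theta>"

text \<open>BV(theta): u in L^1(theta) whose distributional gradient is a finite signed Radon
  measure on theta (each component represented as a difference of finite measures).\<close>
definition BV :: "pt set \<Rightarrow> (pt \<Rightarrow> real) \<Rightarrow> bool" where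
  "BV \<theta> u \<longleftrightarrow> set_integrable lborel \<theta> u \<and>
     (\<exists>p1 n1 p2 n2. fin_meas_on \<theta> p1 \<and> fin_meas_on \<theta> n1 \<and> fin_meas_on \<theta> p2 \<and> fin_meas_on \<theta> n2 \<and>
       (\<forall>\<phi> \<phi>1 \<phi>2. test_fun \<theta> \<phi> \<phi>1 \<phi>2 \<longrightarrow>
          (\<integral>x\<in>\<theta>. u x * \<phi>1 x \<partial>lborel) = - ((\<integral>x. \<phi> x \<partial>p1) - (\<integral>x. \<phi> x \<partial>n1)) \<and>
          (\<integral>x\<in>\<theta>. u x * \<phi>2 x \<partial>lborel) = - ((\<integral>x. \<phi> x \<partial>p2) - (\<integral>x. \<phi> x \<partial>n2))))"

end

theory Submission
  imports Defs
begin

text \<open>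
  Every layer is a convolution with a kernel \<open>w \<in> L\<^sup>2\<close> of bounded support, so the regularity of its
  input is measured by difference quotients: a function has \<open>H\<^sup>1\<close> (BV) regularity if the
  \<open>L\<^sup>2\<close> (\<open>L\<^sup>1\<close>) norm of \<open>f (\<cdot> + h) - f\<close> is \<open>O(|h|)\<close>. This property survives Lipschitz activations,
  and it survives reflections because two values of \<open>f\<close> can be compared through an average over nearby
  points of the rectangle. Translations are continuous in \<open>L\<^sup>2\<close>, hence \<open>w * f\<close> is continuous for
  \<open>f \<in> L\<^sup>2\<close>. If \<open>f\<close> has \<open>H\<^sup>1\<close> regularity, then the difference quotients of \<open>w * f\<close> are convolutions of
  \<open>w\<close> with an \<open>L\<^sup>2\<close>-bounded family and so are equicontinuous; equicontinuous difference quotients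
  converge locally uniformly, and \<open>w * f\<close> is \<open>C\<^sup>1\<close>. A measure is mapped by the first layer into
  \<open>L\<^sup>2\<close> by Jensen's inequality, and a BV density into \<open>H\<^sup>1\<close> by Young's inequality.
\<close>

subsection \<open>Translations in \<open>L\<^sup>1\<close> and \<open>L\<^sup>2\<close>\<close>

text \<open>Zero extension of the kernels turns every valid convolution into a convolution on the
  whole plane, so the regularity estimates carry no boundary conditions. Counting exponents explains
  why two convolutions are needed: a measure against an L2 kernel gives L2, and L2 against L2 gives
  a continuous function. With a BV input the one derivative travels through the hidden layers as a
  difference quotient and becomes classical in the last layer. Two obstacles shape the rest. BV is
  given through smooth test functions, so a concrete bump function is built and mollification leads
  from test functions to difference quotients. And the input is an arbitrary pair \<open>m1\<close>,
  \<open>m2\<close> of measures of which only the difference has a density, while reflection acts on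
  each of them by counting preimages; the density enters by balancing sums of nonnegative measures,
  with no Jordan decomposition. In the first layer identities hold only almost everywhere, because
  an L2 kernel need not be integrable against a measure at every point.\<close>

lemma nn_integral_lborel_shift:
  fixes f :: "'a::euclidean_space \<Rightarrow> ennreal"
  assumes [measurable]: "f \<in> borel_measurable borel"
  shows "(\<integral>\<^sup>+x. f (x + c) \<partial>lborel) = (\<integral>\<^sup>+x. f x \<partial>lborel)"
  by (subst (2) lborel_distr_plus[of c, symmetric])
     (simp add: nn_integral_distr add.commute)

lemma nn_integral_lborel_reflect:
  fixes f :: "'a::euclidean_space \<Rightarrow> ennreal"
  assumes [measurable]: "f \<in> borel_measurable borel"
  shows "(\<integral>\<^sup>+x. f (c - x) \<partial>lborel) = (\<integral>\<^sup>+x. f x \<partial>lborel)"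
  by (subst (2) lborel_affine[of "-1" c])
     (simp_all add: nn_integral_density nn_integral_distr)

lemma integrable_lborel_shift:
  fixes f :: "'a::euclidean_space \<Rightarrow> real"
  assumes "integrable lborel f"
  shows "integrable lborel (\<lambda>x. f (x + c))"
proof -
  have [measurable]: "f \<in> borel_measurable borel" using borel_measurable_integrable[OF assms] by simp
  show ?thesis
    using assms nn_integral_lborel_shift[of "\<lambda>x. ennreal (norm (f x))" c]
    by (simp add: integrable_iff_bounded)
qed

lemma integral_lborel_shift:
  fixes f :: "'a::euclidean_space \<Rightarrow> real"
  assumes [measurable]: "f \<in> borel_measurable borel"
  shows "(\<integral>x. f (x + c) \<partial>lborel) = (\<integral>x. f x \<partial>lborel)"
  by (subst (2) lborel_distr_plus[of c, symmetric])
     (simp add: integral_distr add.commute)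

lemma integral_lborel_reflect:
  fixes f :: "'a::euclidean_space \<Rightarrow> real"
  assumes [measurable]: "f \<in> borel_measurable borel"
  shows "(\<integral>x. f (c - x) \<partial>lborel) = (\<integral>x. f x \<partial>lborel)"
proof -
  have "distr lborel borel ((-) c) = (lborel :: 'a measure)"
    by (subst (2) lborel_affine[of "-1" c]) (simp_all add: density_1)
  then have "(\<integral>x. f x \<partial>lborel) = (\<integral>x. f x \<partial>distr lborel borel ((-) c))" by simp
  then show ?thesis by (simp add: integral_distr)
qed

lemma AE_lborel_shift:
  fixes P :: "'a::euclidean_space \<Rightarrow> bool"
  assumes "AE x in lborel. P x"
  shows "AE x in lborel. P (x + c)"
proof -
  obtain N where N: "{x. \<not> P x} \<subseteq> N" "N \<in> null_sets lborel"
    using assms by (auto elim!: AE_E simp: null_sets_def)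
  have [measurable]: "N \<in> sets borel" using N by auto
  have "(\<integral>\<^sup>+x. indicator N (x + c) \<partial>lborel) = emeasure lborel N"
    using nn_integral_lborel_shift[of "indicator N" c] by simp
  then have "AE x in lborel. x + c \<notin> N"
    using N nn_integral_0_iff_AE[of "\<lambda>x. indicator N (x + c)" lborel]
    by (auto simp: null_sets_def indicator_eq_0_iff)
  then show ?thesis using N(1) by (auto elim!: eventually_mono)
qed

lemma Cauchy_Schwarz_nn_integral_real:
  fixes f g :: "'a \<Rightarrow> real"
  assumes [measurable]: "f \<in> borel_measurable M" "g \<in> borel_measurable M"
  shows "(\<integral>\<^sup>+x. ennreal \<bar>f x * g x\<bar> \<partial>M)\<^sup>2 \<le> (\<integral>\<^sup>+x. ennreal ((f x)\<^sup>2) \<partial>M) * (\<integral>\<^sup>+x. ennreal ((g x)\<^sup>2) \<partial>M)"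
    (is "?L \<le> ?F * ?G")
proof -
  \<comment> \<open>In \<open>ennreal\<close>, 0 times infinity is 0, so a vanishing factor has to
    be settled before an infinite one makes the right-hand side \<open>top\<close>.\<close>
  consider "?F = 0" | "?G = 0" | "?F \<noteq> 0" "?G \<noteq> 0" "?F = \<infinity> \<or> ?G = \<infinity>" | "?F < \<infinity>" "?G < \<infinity>"
    by (metis infinity_ennreal_def less_top)
  then show ?thesis
  proof cases
    case 1
    then have "AE x in M. f x = 0" by (subst (asm) nn_integral_0_iff_AE) (auto simp: ennreal_eq_0_iff)
    then have "(\<integral>\<^sup>+x. ennreal \<bar>f x * g x\<bar> \<partial>M) = 0"
      by (subst nn_integral_0_iff_AE) auto
    then show ?thesis by simp
  next
    case 2
    then have "AE x in M. g x = 0" by (subst (asm) nn_integral_0_iff_AE) (auto simp: ennreal_eq_0_iff)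
    then have "(\<integral>\<^sup>+x. ennreal \<bar>f x * g x\<bar> \<partial>M) = 0"
      by (subst nn_integral_0_iff_AE) auto
    then show ?thesis by simp
  next
    case 3
    then have "?F * ?G = top" by (auto simp: ennreal_mult_eq_top_iff)
    then show ?thesis by (simp only: top_greatest)
  next
    case 4
    have F: "integrable M (\<lambda>x. (f x)\<^sup>2)" and G: "integrable M (\<lambda>x. (g x)\<^sup>2)"
      using 4 by (auto simp: integrable_iff_bounded)
    have FG: "integrable M (\<lambda>x. \<bar>f x * g x\<bar>)"
    proof (rule Bochner_Integration.integrable_bound)
      show "integrable M (\<lambda>x. (f x)\<^sup>2 + (g x)\<^sup>2)" using F G by simp
      have "\<bar>f x * g x\<bar> \<le> (f x)\<^sup>2 + (g x)\<^sup>2" for x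
      proof -
        have "2 * \<bar>f x\<bar> * \<bar>g x\<bar> \<le> (f x)\<^sup>2 + (g x)\<^sup>2"
          using sum_squares_bound[of "\<bar>f x\<bar>" "\<bar>g x\<bar>"] by simp
        moreover have "\<bar>f x\<bar> * \<bar>g x\<bar> \<ge> 0" by simp
        ultimately show ?thesis unfolding abs_mult by linarith
      qed
      then show "AE x in M. norm \<bar>f x * g x\<bar> \<le> norm ((f x)\<^sup>2 + (g x)\<^sup>2)" by auto
    qed simp
    define a b c where "a = (\<integral>x. (f x)\<^sup>2 \<partial>M)" and "b = (\<integral>x. \<bar>f x * g x\<bar> \<partial>M)" and "c = (\<integral>x. (g x)\<^sup>2 \<partial>M)"
    have quad: "a * s\<^sup>2 - 2 * b * s * t + c * t\<^sup>2 \<ge> 0" for s t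
    proof -
      have "0 \<le> (\<integral>x. (s * \<bar>f x\<bar> - t * \<bar>g x\<bar>)\<^sup>2 \<partial>M)" by simp
      also have "\<dots> = (\<integral>x. s\<^sup>2 * (f x)\<^sup>2 - 2 * s * t * \<bar>f x * g x\<bar> + t\<^sup>2 * (g x)\<^sup>2 \<partial>M)"
        by (intro Bochner_Integration.integral_cong) (auto simp: power2_diff power_mult_distrib abs_mult algebra_simps)
      also have "\<dots> = s\<^sup>2 * a - 2 * s * t * b + t\<^sup>2 * c"
        using F G FG by (simp add: a_def b_def c_def)
      finally show ?thesis by (simp add: algebra_simps)
    qed
    have nn: "a \<ge> 0" "b \<ge> 0" "c \<ge> 0" by (auto simp: a_def b_def c_def)
    have "b\<^sup>2 \<le> a * c"
    proof (cases "a = 0")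
      case True
      \<comment> \<open>With \<open>a = 0\<close> the form takes the value -(c + 2) b^2 here; any
        first argument above c / 2 would force \<open>b = 0\<close> when b occurs as the second
        one.\<close>
      with quad[of "c + 1" b] have "2 * b * (c + 1) * b \<le> c * b\<^sup>2" by simp
      then have "b\<^sup>2 * (c + 2) \<le> 0" by (simp add: power2_eq_square algebra_simps)
      with nn have "b\<^sup>2 = 0" by (smt (verit) mult_pos_pos zero_le_power2)
      with True show ?thesis by simp
    next
      case False
      with nn have "a > 0" by simp
      \<comment> \<open>The form at (b, a) equals a (a c - b^2).\<close>
      have "0 \<le> a * b\<^sup>2 - 2 * b * b * a + c * a\<^sup>2" by (rule quad)
      then have "a * b\<^sup>2 \<le> a * (a * c)" by (simp add: power2_eq_square algebra_simps)
      with \<open>a > 0\<close> show ?thesis by simp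
    qed
    moreover have "?F = ennreal a" "?G = ennreal c" "(\<integral>\<^sup>+x. ennreal \<bar>f x * g x\<bar> \<partial>M) = ennreal b"
      using F G FG by (simp_all add: a_def b_def c_def nn_integral_eq_integral)
    ultimately show ?thesis using nn by (simp add: ennreal_power ennreal_mult[symmetric] ennreal_leI)
  qed
qed

section \<open>Continuity of translations\<close>

text \<open>At a point of \<open>U\<close> openness keeps \<open>x + X n\<close> in \<open>U\<close>
  eventually; elsewhere the first factor is zero, although the shifted indicator alone may fail to
  converge on the boundary. The product is moreover dominated by \<open>indicator U\<close>.\<close>

lemma indicator_open_translation:
  assumes "open U" "X \<longlonglongrightarrow> (0::'a::real_normed_vector)"
  shows "(\<lambda>n. indicator U x * indicator U (x + X n)) \<longlonglongrightarrow> (indicator U x :: real)"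
proof (cases "x \<in> U")
  case True
  have "(\<lambda>n. x + X n) \<longlonglongrightarrow> x" using tendsto_add[OF tendsto_const assms(2)] by simp
  then have "\<forall>\<^sub>F n in sequentially. x + X n \<in> U" using assms(1) True by (rule topological_tendstoD)
  then have "\<forall>\<^sub>F n in sequentially. indicator U x * indicator U (x + X n) = (indicator U x :: real)"
    by eventually_elim (simp add: True)
  then show ?thesis by (rule tendsto_eventually)
qed simp

lemma L1_dist_triangle_translation:
  fixes f g :: "'a::euclidean_space \<Rightarrow> real"
  assumes f: "integrable lborel f" and g: "integrable lborel g"
  shows "(\<integral>x. \<bar>f (x + z) - f x\<bar> \<partial>lborel)
    \<le> 2 * (\<integral>x. \<bar>f x - g x\<bar> \<partial>lborel) + (\<integral>x. \<bar>g (x + z) - g x\<bar> \<partial>lborel)"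
proof -
  note [simp] = f g integrable_lborel_shift[OF f] integrable_lborel_shift[OF g]
  have [measurable]: "f \<in> borel_measurable borel" "g \<in> borel_measurable borel"
    using borel_measurable_integrable[OF f] borel_measurable_integrable[OF g] by auto
  have "(\<integral>x. \<bar>f (x + z) - f x\<bar> \<partial>lborel)
     \<le> (\<integral>x. \<bar>f (x + z) - g (x + z)\<bar> + \<bar>f x - g x\<bar> + \<bar>g (x + z) - g x\<bar> \<partial>lborel)"
    by (intro integral_mono) auto
  also have "\<dots> = (\<integral>x. \<bar>f (x + z) - g (x + z)\<bar> \<partial>lborel) + (\<integral>x. \<bar>f x - g x\<bar> \<partial>lborel)
      + (\<integral>x. \<bar>g (x + z) - g x\<bar> \<partial>lborel)" by simp
  also have "(\<integral>x. \<bar>f (x + z) - g (x + z)\<bar> \<partial>lborel) = (\<integral>x. \<bar>f x - g x\<bar> \<partial>lborel)"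
    by (rule integral_lborel_shift[where f="\<lambda>x. \<bar>f x - g x\<bar>"]) measurable
  finally show ?thesis by simp
qed

text \<open>Stability under L1 approximation: the error enters twice by
  \<open>L1_dist_triangle_translation\<close>, hence e / 4. Both the passage from open to measurable
  sets and the limit step of the induction below go through this lemma.\<close>

lemma L1_translation_tendsto_by_approx:
  fixes f :: "'a::euclidean_space \<Rightarrow> real"
  assumes f: "integrable lborel f"
    and approx: "\<And>e. e > 0 \<Longrightarrow> \<exists>g. integrable lborel g \<and> (\<integral>x. \<bar>f x - g x\<bar> \<partial>lborel) \<le> e \<and>
       (\<lambda>n. \<integral>x. \<bar>g (x + X n) - g x\<bar> \<partial>lborel) \<longlonglongrightarrow> 0"
  shows "(\<lambda>n. \<integral>x. \<bar>f (x + X n) - f x\<bar> \<partial>lborel) \<longlonglongrightarrow> 0"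
proof (rule LIMSEQ_I)
  fix e :: real assume "e > 0"
  obtain g where g: "integrable lborel g" "(\<integral>x. \<bar>f x - g x\<bar> \<partial>lborel) \<le> e / 4"
      "(\<lambda>n. \<integral>x. \<bar>g (x + X n) - g x\<bar> \<partial>lborel) \<longlonglongrightarrow> 0"
    using approx[of "e / 4"] \<open>e > 0\<close> by auto
  obtain N where N: "\<And>n. n \<ge> N \<Longrightarrow> norm ((\<integral>x. \<bar>g (x + X n) - g x\<bar> \<partial>lborel) - 0) < e / 2"
    using LIMSEQ_D[OF g(3), of "e / 2"] \<open>e > 0\<close> by auto
  have "norm ((\<integral>x. \<bar>f (x + X n) - f x\<bar> \<partial>lborel) - 0) < e" if "n \<ge> N" for n
    using L1_dist_triangle_translation[OF f g(1), of "X n"] g(2) N[OF that] by simp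
  then show "\<exists>no. \<forall>n\<ge>no. norm ((\<integral>x. \<bar>f (x + X n) - f x\<bar> \<partial>lborel) - 0) < e" by blast
qed

text \<open>For values s, t in {0, 1} one has |s - t| = s + t - 2 s t, and translation preserves the
  measure of \<open>U\<close>. Only the overlap of \<open>U\<close> with its translate depends on
  the shift, and dominated convergence handles the overlap.\<close>

lemma L1_translation_tendsto_open:
  fixes U :: "'a::euclidean_space set"
  assumes U: "open U" "emeasure lborel U < \<infinity>" and X: "X \<longlonglongrightarrow> 0"
  shows "(\<lambda>n. \<integral>x. \<bar>indicator U (x + X n) - indicator U x :: real\<bar> \<partial>lborel) \<longlonglongrightarrow> 0"
proof -
  have [measurable]: "U \<in> sets borel" using U by auto
  let ?u = "indicator U :: 'a \<Rightarrow> real"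
  have iU: "integrable lborel ?u" using U by (simp add: integrable_indicator_iff)
  have ix: "integrable lborel (\<lambda>x. ?u x * ?u (x + c))" for c
    by (rule Bochner_Integration.integrable_bound[OF iU]) (auto simp: indicator_def)
  have eq: "(\<integral>x. \<bar>?u (x + c) - ?u x\<bar> \<partial>lborel) = 2 * (\<integral>x. ?u x \<partial>lborel) - 2 * (\<integral>x. ?u x * ?u (x + c) \<partial>lborel)" for c
  proof -
    have "(\<integral>x. \<bar>?u (x + c) - ?u x\<bar> \<partial>lborel) = (\<integral>x. ?u (x + c) + ?u x - 2 * (?u x * ?u (x + c)) \<partial>lborel)"
      by (intro Bochner_Integration.integral_cong) (auto simp: indicator_def)
    also have "\<dots> = (\<integral>x. ?u (x + c) \<partial>lborel) + (\<integral>x. ?u x \<partial>lborel) - 2 * (\<integral>x. ?u x * ?u (x + c) \<partial>lborel)"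
      using iU ix integrable_lborel_shift[OF iU] by simp
    finally show ?thesis by (simp add: integral_lborel_shift)
  qed
  have "(\<lambda>n. \<integral>x. ?u x * ?u (x + X n) \<partial>lborel) \<longlonglongrightarrow> (\<integral>x. ?u x \<partial>lborel)"
  proof (rule integral_dominated_convergence)
    show "integrable lborel ?u" by (rule iU)
    show "AE x in lborel. (\<lambda>n. ?u x * ?u (x + X n)) \<longlonglongrightarrow> ?u x"
      using indicator_open_translation[OF U(1) X] by simp
  qed (auto simp: indicator_def)
  then have "(\<lambda>n. 2 * (\<integral>x. ?u x \<partial>lborel) - 2 * (\<integral>x. ?u x * ?u (x + X n) \<partial>lborel)) \<longlonglongrightarrow>
      2 * (\<integral>x. ?u x \<partial>lborel) - 2 * (\<integral>x. ?u x \<partial>lborel)"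
    by (intro tendsto_intros)
  then show ?thesis by (simp add: eq)
qed

text \<open>Outer regularity reduces indicators of measurable sets to those of open sets, so the
  argument runs through sets and simple functions instead of continuous functions of compact
  support.\<close>

lemma L1_translation_tendsto:
  fixes f :: "'a::euclidean_space \<Rightarrow> real"
  assumes "integrable lborel f" and X: "X \<longlonglongrightarrow> 0"
  shows "(\<lambda>n. \<integral>x. \<bar>f (x + X n) - f x\<bar> \<partial>lborel) \<longlonglongrightarrow> 0"
  using assms(1)
proof (induction rule: integrable_induct)
  case (base A c)
  then have [measurable]: "A \<in> sets borel" by simp
  have iA: "integrable lborel (indicator A :: 'a \<Rightarrow> real)" using base by (simp add: integrable_indicator_iff)
  have "(\<lambda>n. \<integral>x. \<bar>indicator A (x + X n) - indicator A x :: real\<bar> \<partial>lborel) \<longlonglongrightarrow> 0"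
  proof (rule L1_translation_tendsto_by_approx[OF iA])
    fix e :: real assume "e > 0"
    obtain U where U: "open U" "A \<subseteq> U" "emeasure lborel (U - A) < e"
      using outer_regular_lborel[of A e] \<open>e > 0\<close> by auto
    have [measurable]: "U \<in> sets borel" using U by auto
    have "emeasure lborel U \<le> emeasure lborel (U - A) + emeasure lborel A"
      using U(2) by (subst plus_emeasure) (auto simp: Un_absorb2)
    also have "\<dots> < \<infinity>" using U(3) base(2) by (auto simp: less_top[symmetric] ennreal_add_eq_top)
    finally have fU: "emeasure lborel U < \<infinity>" .
    have "(\<integral>x. \<bar>indicator A x - indicator U x :: real\<bar> \<partial>lborel) = (\<integral>x. indicator (U - A) x \<partial>lborel)"
      using U(2) by (intro Bochner_Integration.integral_cong) (auto simp: indicator_def)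
    also have "\<dots> = measure lborel (U - A)" by simp
    also have "\<dots> \<le> e" using U(3) \<open>e > 0\<close>
      by (simp add: measure_def enn2real_leI)
    finally show "\<exists>g. integrable lborel g \<and> (\<integral>x. \<bar>indicator A x - g x\<bar> \<partial>lborel) \<le> e \<and>
       (\<lambda>n. \<integral>x. \<bar>g (x + X n) - g x\<bar> \<partial>lborel) \<longlonglongrightarrow> 0"
      using L1_translation_tendsto_open[OF U(1) fU X] fU
      by (intro exI[of _ "indicator U"]) (auto simp: integrable_indicator_iff)
  qed
  then have "(\<lambda>n. \<bar>c\<bar> * (\<integral>x. \<bar>indicator A (x + X n) - indicator A x :: real\<bar> \<partial>lborel)) \<longlonglongrightarrow> \<bar>c\<bar> * 0"
    by (intro tendsto_intros)
  then show ?case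
    by (simp add: left_diff_distrib[symmetric] abs_mult mult.commute[of _ c] right_diff_distrib[symmetric] del: mult_right_cancel)
next
  case (add f g)
  note i[simp] = add(1,2) integrable_lborel_shift[OF add(1)] integrable_lborel_shift[OF add(2)]
  show ?case
  proof (rule tendsto_sandwich[OF _ _ tendsto_const])
    show "(\<lambda>n. (\<integral>x. \<bar>f (x + X n) - f x\<bar> \<partial>lborel) + (\<integral>x. \<bar>g (x + X n) - g x\<bar> \<partial>lborel)) \<longlonglongrightarrow> 0"
      using tendsto_add[OF add(3,4)] by simp
    show "\<forall>\<^sub>F n in sequentially. (\<integral>x. \<bar>f (x + X n) + g (x + X n) - (f x + g x)\<bar> \<partial>lborel) \<le>
      (\<integral>x. \<bar>f (x + X n) - f x\<bar> \<partial>lborel) + (\<integral>x. \<bar>g (x + X n) - g x\<bar> \<partial>lborel)"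
    proof (intro always_eventually allI)
      fix n
      have "(\<integral>x. \<bar>f (x + X n) + g (x + X n) - (f x + g x)\<bar> \<partial>lborel)
        \<le> (\<integral>x. \<bar>f (x + X n) - f x\<bar> + \<bar>g (x + X n) - g x\<bar> \<partial>lborel)"
        by (intro integral_mono) auto
      then show "(\<integral>x. \<bar>f (x + X n) + g (x + X n) - (f x + g x)\<bar> \<partial>lborel) \<le>
        (\<integral>x. \<bar>f (x + X n) - f x\<bar> \<partial>lborel) + (\<integral>x. \<bar>g (x + X n) - g x\<bar> \<partial>lborel)"
        by simp
    qed
  qed simp
next
  case (lim f s)
  show ?case
  proof (rule L1_translation_tendsto_by_approx[OF lim(4)])
    fix e :: real assume "e > 0"
    have m: "f \<in> borel_measurable lborel" "\<And>i. s i \<in> borel_measurable lborel"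
      using lim(1,4) borel_measurable_integrable by blast+
    have "(\<lambda>i. \<integral>x. \<bar>f x - s i x\<bar> \<partial>lborel) \<longlonglongrightarrow> (\<integral>x. 0 \<partial>(lborel::'a measure))"
    proof (rule integral_dominated_convergence)
      \<comment> \<open>\<open>integrable_induct\<close> supplies |s i| \<le> 2 |f|; adding |f|
        gives the 3.\<close>
      show "integrable lborel (\<lambda>x. 3 * \<bar>f x\<bar>)" using lim(4) by simp
      show "AE x in lborel. (\<lambda>i. \<bar>f x - s i x\<bar>) \<longlonglongrightarrow> 0"
      proof (intro always_eventually allI)
        fix x
        have "(\<lambda>i. \<bar>f x - s i x\<bar>) \<longlonglongrightarrow> \<bar>f x - f x\<bar>"
          using lim(2)[of x] by (intro tendsto_intros) auto
        then show "(\<lambda>i. \<bar>f x - s i x\<bar>) \<longlonglongrightarrow> 0" by simp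
      qed
      have "\<bar>f x - s i x\<bar> \<le> 3 * \<bar>f x\<bar>" for i x using lim(3)[of x i] by simp
      then show "AE x in lborel. norm \<bar>f x - s i x\<bar> \<le> 3 * \<bar>f x\<bar>" for i by simp
    qed (use m in measurable)
    then obtain i where "(\<integral>x. \<bar>f x - s i x\<bar> \<partial>lborel) < e"
      using \<open>e > 0\<close> by (fastforce dest!: order_tendstoD(2)[where a=e] simp: eventually_sequentially)
    then show "\<exists>g. integrable lborel g \<and> (\<integral>x. \<bar>f x - g x\<bar> \<partial>lborel) \<le> e \<and>
       (\<lambda>n. \<integral>x. \<bar>g (x + X n) - g x\<bar> \<partial>lborel) \<longlonglongrightarrow> 0"
      using lim(1,5) by (intro exI[of _ "s i"]) auto
  qed
qed

text \<open>Sequences tending to 0 determine the neighbourhood filter of 0, which turns the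
  sequential statement into one with a radius \<open>d\<close>.\<close>

lemma L1_translation_continuous:
  fixes f :: "'a::euclidean_space \<Rightarrow> real"
  assumes f: "integrable lborel f" and "e > 0"
  shows "\<exists>d>0. \<forall>z. norm z < d \<longrightarrow> (\<integral>\<^sup>+x. ennreal \<bar>f (x + z) - f x\<bar> \<partial>lborel) \<le> ennreal e"
proof -
  let ?g = "\<lambda>z. \<integral>x. \<bar>f (x + z) - f x\<bar> \<partial>lborel"
  have "\<forall>\<^sub>F z in nhds 0. ?g z < e"
  proof (rule sequentially_imp_eventually_nhds_within[where s=UNIV, simplified])
    show "\<forall>X. X \<longlonglongrightarrow> 0 \<longrightarrow> (\<forall>\<^sub>F n in sequentially. ?g (X n) < e)"
      using order_tendstoD(2)[OF L1_translation_tendsto[OF f] \<open>e > 0\<close>] by simp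
  qed
  then obtain d where "d > 0" and d: "\<And>z. norm z < d \<Longrightarrow> ?g z < e"
    by (auto simp: eventually_nhds_metric dist_norm)
  moreover have "(\<integral>\<^sup>+x. ennreal \<bar>f (x + z) - f x\<bar> \<partial>lborel) = ennreal (?g z)" for z
    using f integrable_lborel_shift[OF f] by (intro nn_integral_eq_integral) auto
  ultimately show ?thesis using less_imp_le[OF d] by (auto intro!: exI[of _ d] ennreal_leI)
qed

text \<open>The map a \<mapsto> a |a| makes an L2 function integrable without losing its sign, so
  this inequality derives translation continuity in L2 from that in L1. The factor 2 is attained at
  b = - a.\<close>

lemma square_diff_le_signed_square:
  fixes a b :: real
  shows "(a - b)\<^sup>2 \<le> 2 * \<bar>a * \<bar>a\<bar> - b * \<bar>b\<bar>\<bar>"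
proof -
  have *: "(a - b)\<^sup>2 \<le> 2 * \<bar>a * \<bar>a\<bar> - b * \<bar>b\<bar>\<bar>" if "a \<ge> b" for a b :: real
  proof -
    consider "b \<ge> 0" | "a \<le> 0" | "a > 0" "b < 0" by linarith
    then show ?thesis
    proof cases
      case 1
      have "(a - b) * (a - b) \<le> (a - b) * (a + b)" using 1 that by (intro mult_left_mono) auto
      moreover have "(a - b) * (a + b) \<ge> 0" using 1 that by simp
      ultimately show ?thesis using 1 that by (simp add: power2_eq_square algebra_simps)
    next
      case 2
      have "(a - b) * (a - b) \<le> (a - b) * (- a - b)" using 2 that by (intro mult_left_mono) auto
      moreover have "(a - b) * (- a - b) \<ge> 0" using 2 that by (intro mult_nonneg_nonneg) auto
      ultimately show ?thesis using 2 that by (simp add: power2_eq_square algebra_simps)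
    next
      case 3
      have "(a - b)\<^sup>2 \<le> 2 * (a * a + b * b)" using zero_le_power2[of "a + b"] by (simp add: power2_eq_square algebra_simps)
      moreover have "\<bar>a * \<bar>a\<bar> - b * \<bar>b\<bar>\<bar> = a * a + b * b" using 3 by simp
      ultimately show ?thesis by simp
    qed
  qed
  show ?thesis using *[of a b] *[of b a] by (cases "a \<ge> b") (auto simp: power2_commute abs_minus_commute)
qed

lemma L2_translation_continuous:
  fixes w :: "'a::euclidean_space \<Rightarrow> real"
  assumes [measurable]: "w \<in> borel_measurable borel" and w: "(\<integral>\<^sup>+x. ennreal ((w x)\<^sup>2) \<partial>lborel) < \<infinity>" and "e > 0"
  shows "\<exists>d>0. \<forall>z. norm z < d \<longrightarrow> (\<integral>\<^sup>+x. ennreal ((w (x + z) - w x)\<^sup>2) \<partial>lborel) \<le> ennreal e"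
proof -
  let ?v = "\<lambda>x. w x * \<bar>w x\<bar>"
  have "integrable lborel ?v"
    using w by (subst integrable_iff_bounded) (simp add: abs_mult power2_eq_square)
  from L1_translation_continuous[OF this, of "e / 2"] \<open>e > 0\<close>
  obtain d where "d > 0" and d: "\<And>z. norm z < d \<Longrightarrow> (\<integral>\<^sup>+x. ennreal \<bar>?v (x + z) - ?v x\<bar> \<partial>lborel) \<le> ennreal (e / 2)"
    by auto
  have "(\<integral>\<^sup>+x. ennreal ((w (x + z) - w x)\<^sup>2) \<partial>lborel) \<le> ennreal e" if "norm z < d" for z
  proof -
    have "(\<integral>\<^sup>+x. ennreal ((w (x + z) - w x)\<^sup>2) \<partial>lborel) \<le> (\<integral>\<^sup>+x. ennreal 2 * ennreal \<bar>?v (x + z) - ?v x\<bar> \<partial>lborel)"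
      by (intro nn_integral_mono) (auto simp: ennreal_mult[symmetric] intro!: ennreal_leI square_diff_le_signed_square simp del: ennreal_numeral)
    also have "\<dots> = ennreal 2 * (\<integral>\<^sup>+x. ennreal \<bar>?v (x + z) - ?v x\<bar> \<partial>lborel)" by (rule nn_integral_cmult) measurable
    also have "\<dots> \<le> ennreal 2 * ennreal (e / 2)" by (intro mult_left_mono d that) auto
    also have "\<dots> = ennreal e" using \<open>e > 0\<close> by (simp add: ennreal_mult[symmetric] del: ennreal_numeral)
    finally show ?thesis .
  qed
  with \<open>d > 0\<close> show ?thesis by blast
qed

subsection \<open>Convolution and difference quotients\<close>

lemma integral_Cauchy_Schwarz_bound:
  fixes f g :: "'a \<Rightarrow> real"
  assumes [measurable]: "f \<in> borel_measurable M" "g \<in> borel_measurable M"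
    and F: "(\<integral>\<^sup>+x. ennreal ((f x)\<^sup>2) \<partial>M) \<le> ennreal a" and G: "(\<integral>\<^sup>+x. ennreal ((g x)\<^sup>2) \<partial>M) \<le> ennreal b"
    and nn: "a \<ge> 0" "b \<ge> 0"
  shows "integrable M (\<lambda>x. f x * g x)" "\<bar>\<integral>x. f x * g x \<partial>M\<bar> \<le> sqrt a * sqrt b"
proof -
  let ?I = "\<integral>\<^sup>+x. ennreal \<bar>f x * g x\<bar> \<partial>M"
  have "?I\<^sup>2 \<le> ennreal a * ennreal b"
    by (rule order_trans[OF Cauchy_Schwarz_nn_integral_real mult_mono[OF F G]]) auto
  then have I2: "?I\<^sup>2 \<le> ennreal (a * b)" using nn by (simp add: ennreal_mult)
  have fin: "?I < \<infinity>"
  proof (rule ccontr)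
    assume "\<not> ?I < \<infinity>"
    then have "?I = top" by (simp add: less_top[symmetric])
    with I2 show False by (simp add: power2_eq_square top_unique)
  qed
  then show int: "integrable M (\<lambda>x. f x * g x)" by (simp add: integrable_iff_bounded)
  have eq: "?I = ennreal (\<integral>x. \<bar>f x * g x\<bar> \<partial>M)"
    using int by (intro nn_integral_eq_integral) auto
  have "(\<integral>x. \<bar>f x * g x\<bar> \<partial>M)\<^sup>2 \<le> a * b"
    using I2 nn unfolding eq by (simp add: ennreal_power)
  then have "(\<integral>x. \<bar>f x * g x\<bar> \<partial>M) \<le> sqrt (a * b)" by (rule real_le_rsqrt)
  then show "\<bar>\<integral>x. f x * g x \<partial>M\<bar> \<le> sqrt a * sqrt b"
    by (simp add: real_sqrt_mult) (rule order_trans[OF integral_abs_bound])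
qed

lemma borel_ball [measurable, simp]: "ball (x::'a::metric_space) r \<in> sets borel"
  by simp

definition L2loc :: "('a::euclidean_space \<Rightarrow> real) \<Rightarrow> bool" where
  "L2loc f \<longleftrightarrow> f \<in> borel_measurable borel \<and>
     (\<forall>R. (\<integral>\<^sup>+x. ennreal ((f x)\<^sup>2) * indicator (ball 0 R) x \<partial>lborel) < \<infinity>)"

text \<open>Since the kernel is zero from radius \<open>r\<close> on, a convolution at
  \<open>x\<close> sees its other factor only in the ball of radius |x| + r around 0; local square
  integrability of that factor is then enough.\<close>

definition L2_kernel :: "real \<Rightarrow> ('a::euclidean_space \<Rightarrow> real) \<Rightarrow> bool" where
  "L2_kernel r w \<longleftrightarrow> w \<in> borel_measurable borel \<and> (\<integral>\<^sup>+x. ennreal ((w x)\<^sup>2) \<partial>lborel) < \<infinity> \<and>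
     (\<forall>y. norm y \<ge> r \<longrightarrow> w y = 0)"

definition conv :: "('a::euclidean_space \<Rightarrow> real) \<Rightarrow> ('a \<Rightarrow> real) \<Rightarrow> 'a \<Rightarrow> real" where
  "conv w f x = (\<integral>y. w y * f (x - y) \<partial>lborel)"

text \<open>For \<open>p = 2\<close> this is the difference quotient characterisation of \<open>H\<^sup>1\<close>, for \<open>p = 1\<close> that of
  \<open>BV\<close>. Unlike the definitions by weak derivatives it is obviously stable under composition with
  Lipschitz functions.\<close>

definition diffq_loc :: "nat \<Rightarrow> ('a::euclidean_space \<Rightarrow> real) \<Rightarrow> bool" where
  "diffq_loc p f \<longleftrightarrow> (\<forall>R. \<exists>C d. C \<ge> 0 \<and> d > 0 \<and> (\<forall>h. norm h < d \<longrightarrow>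
     (\<integral>\<^sup>+x. ennreal (\<bar>f (x + h) - f x\<bar> ^ p) * indicator (ball 0 R) x \<partial>lborel) \<le> ennreal (C * norm h ^ p)))"

lemma conv_altdef:
  assumes [measurable]: "w \<in> borel_measurable borel" "f \<in> borel_measurable borel"
  shows "conv w f x = (\<integral>y. w (x - y) * f y \<partial>lborel)"
  using integral_lborel_reflect[of "\<lambda>y. w (x - y) * f y" x] by (simp add: conv_def)

lemma conv_bound:
  assumes [measurable]: "w \<in> borel_measurable borel" "f \<in> borel_measurable borel"
    and supp: "\<And>y. norm y \<ge> r \<Longrightarrow> w y = 0"
    and wb: "(\<integral>\<^sup>+x. ennreal ((w x)\<^sup>2) \<partial>lborel) \<le> ennreal a"
    and fb: "(\<integral>\<^sup>+x. ennreal ((f x)\<^sup>2) * indicator (ball 0 R) x \<partial>lborel) \<le> ennreal b"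
    and x: "norm x + r \<le> R" and nn: "a \<ge> 0" "b \<ge> 0"
  shows "integrable lborel (\<lambda>y. w (x - y) * f y)" "\<bar>conv w f x\<bar> \<le> sqrt a * sqrt b"
proof -
  let ?f = "\<lambda>y. indicator (ball 0 R) y * f y"
  \<comment> \<open>Cutting \<open>f\<close> off is harmless: beyond radius \<open>R\<close> the
    reverse triangle inequality forces |x - y| \<ge> r.\<close>
  have eq: "w (x - y) * f y = w (x - y) * ?f y" for y
  proof (cases "norm y < R")
    case False
    then have "norm (x - y) \<ge> r" using x norm_triangle_ineq2[of y x] by (simp add: norm_minus_commute)
    then show ?thesis by (simp add: supp)
  qed simp
  have "(\<integral>\<^sup>+y. ennreal ((w (x - y))\<^sup>2) \<partial>lborel) \<le> ennreal a"
    using wb nn_integral_lborel_reflect[of "\<lambda>y. ennreal ((w y)\<^sup>2)" x] by simp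
  moreover have "(\<integral>\<^sup>+y. ennreal ((?f y)\<^sup>2) \<partial>lborel) \<le> ennreal b"
  proof -
    have "(\<integral>\<^sup>+y. ennreal ((?f y)\<^sup>2) \<partial>lborel) = (\<integral>\<^sup>+x. ennreal ((f x)\<^sup>2) * indicator (ball 0 R) x \<partial>lborel)"
      by (intro nn_integral_cong) (simp add: indicator_def)
    then show ?thesis using fb by simp
  qed
  note bounds = this calculation
  have "integrable lborel (\<lambda>y. w (x - y) * ?f y)"
    by (rule integral_Cauchy_Schwarz_bound(1)[OF _ _ bounds(2,1) nn]; measurable)
  moreover have "\<bar>\<integral>y. w (x - y) * ?f y \<partial>lborel\<bar> \<le> sqrt a * sqrt b"
    by (rule integral_Cauchy_Schwarz_bound(2)[OF _ _ bounds(2,1) nn]; measurable)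
  ultimately show "integrable lborel (\<lambda>y. w (x - y) * f y)" "\<bar>conv w f x\<bar> \<le> sqrt a * sqrt b"
    unfolding conv_altdef[OF assms(1,2)] eq by auto
qed

lemma L2_kernelD:
  assumes "L2_kernel r w"
  shows "w \<in> borel_measurable borel" "norm y \<ge> r \<Longrightarrow> w y = 0"
    "\<exists>a\<ge>0. (\<integral>\<^sup>+x. ennreal ((w x)\<^sup>2) \<partial>lborel) \<le> ennreal a"
  using assms unfolding L2_kernel_def
  by (auto intro!: exI[of _ "enn2real (\<integral>\<^sup>+x. ennreal ((w x)\<^sup>2) \<partial>lborel)"] simp: less_top)

lemma L2locD:
  assumes "L2loc f"
  shows "f \<in> borel_measurable borel"
    "\<exists>b\<ge>0. (\<integral>\<^sup>+x. ennreal ((f x)\<^sup>2) * indicator (ball 0 R) x \<partial>lborel) \<le> ennreal b"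
  using assms unfolding L2loc_def
  by (auto intro!: exI[of _ "enn2real (\<integral>\<^sup>+x. ennreal ((f x)\<^sup>2) * indicator (ball 0 R) x \<partial>lborel)"] simp: less_top)

lemma conv_integrable:
  assumes "L2_kernel r w" "L2loc f"
  shows "integrable lborel (\<lambda>y. w (x - y) * f y)"
proof -
  obtain a where a: "a \<ge> 0" "(\<integral>\<^sup>+x. ennreal ((w x)\<^sup>2) \<partial>lborel) \<le> ennreal a"
    using L2_kernelD(3)[OF assms(1)] by blast
  obtain b where b: "b \<ge> 0" "(\<integral>\<^sup>+y. ennreal ((f y)\<^sup>2) * indicator (ball 0 (norm x + r)) y \<partial>lborel) \<le> ennreal b"
    using L2locD(2)[OF assms(2)] by blast
  show ?thesis
    by (rule conv_bound(1)[OF L2_kernelD(1)[OF assms(1)] L2locD(1)[OF assms(2)] L2_kernelD(2)[OF assms(1)] a(2) b(2) order_refl a(1) b(1)])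
qed

text \<open>The \<open>+ 1\<close> spares a case distinction when the L2 bound behind
  \<open>s\<close> is zero.\<close>

lemma divide_add_one_mult_le:
  fixes e s :: real
  assumes "e \<ge> 0" "s \<ge> 0"
  shows "e / (s + 1) * s \<le> e"
  using assms by (simp add: divide_le_eq algebra_simps)

text \<open>The increment of \<open>conv w f\<close> is the convolution of \<open>f\<close> with the
  increment of the kernel, whose L2 norm is small. The order of the quantifiers is the point:
  \<open>d\<close> is chosen before \<open>f\<close>, so one \<open>d\<close> serves a whole bounded
  family. The extra 1 in the radius absorbs the shift of the support by |z| < 1.\<close>

lemma conv_diff_bound:
  assumes w: "L2_kernel r w" and "e > 0"
  shows "\<exists>d>0. \<forall>f x z b. L2loc f \<longrightarrow> norm x < R \<longrightarrow> norm z < d \<longrightarrow> b \<ge> 0 \<longrightarrow>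
     (\<integral>\<^sup>+x. ennreal ((f x)\<^sup>2) * indicator (ball 0 (R + r + 1)) x \<partial>lborel) \<le> ennreal b \<longrightarrow>
     \<bar>conv w f (x + z) - conv w f x\<bar> \<le> e * sqrt b"
proof -
  have [measurable]: "w \<in> borel_measurable borel" by (rule L2_kernelD[OF w])
  obtain d where "d > 0" and d: "\<And>z. norm z < d \<Longrightarrow> (\<integral>\<^sup>+x. ennreal ((w (x + z) - w x)\<^sup>2) \<partial>lborel) \<le> ennreal (e\<^sup>2)"
    using L2_translation_continuous[of w "e\<^sup>2"] w \<open>e > 0\<close> unfolding L2_kernel_def by auto
  have "\<bar>conv w f (x + z) - conv w f x\<bar> \<le> e * sqrt b"
    if f: "L2loc f" and x: "norm x < R" and z: "norm z < min d 1" and "b \<ge> 0"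
      and b: "(\<integral>\<^sup>+x. ennreal ((f x)\<^sup>2) * indicator (ball 0 (R + r + 1)) x \<partial>lborel) \<le> ennreal b" for f x z b
  proof -
    have [measurable]: "f \<in> borel_measurable borel" by (rule L2locD[OF f])
    let ?w = "\<lambda>y. w (y + z) - w y"
    have "conv w f (x + z) - conv w f x = (\<integral>y. w (x + z - y) * f y - w (x - y) * f y \<partial>lborel)"
      using conv_integrable[OF w f] by (simp add: conv_altdef)
    also have "\<dots> = (\<integral>y. ?w (x - y) * f y \<partial>lborel)" by (simp add: algebra_simps)
    also have "\<dots> = conv ?w f x" by (rule conv_altdef[symmetric]) measurable
    finally have eq: "conv w f (x + z) - conv w f x = conv ?w f x" .
    have "?w y = 0" if "norm y \<ge> r + 1" for y
    proof -
      have "norm (y + z) \<ge> r" using that z norm_diff_ineq[of y z] by simp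
      then show ?thesis using that L2_kernelD(2)[OF w] by simp
    qed
    then have "\<bar>conv ?w f x\<bar> \<le> sqrt (e\<^sup>2) * sqrt b"
      using d z b x \<open>b \<ge> 0\<close> by (intro conv_bound(2)[where R="R + r + 1" and r="r + 1"]) auto
    with eq \<open>e > 0\<close> show ?thesis by simp
  qed
  then show ?thesis using \<open>d > 0\<close> by (intro exI[of _ "min d 1"]) auto
qed

lemma continuous_conv:
  assumes w: "L2_kernel r w" and f: "L2loc f"
  shows "continuous_on UNIV (conv w f)"
proof -
  have "\<exists>d>0. \<forall>y. dist y x < d \<longrightarrow> dist (conv w f y) (conv w f x) \<le> e" if "e > 0" for x e
  proof -
    obtain b where b: "b \<ge> 0" "(\<integral>\<^sup>+y. ennreal ((f y)\<^sup>2) * indicator (ball 0 (norm x + 1 + r + 1)) y \<partial>lborel) \<le> ennreal b"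
      using L2locD[OF f] by blast
    have e: "e / (sqrt b + 1) > 0" using b(1) \<open>e > 0\<close> by (intro divide_pos_pos add_nonneg_pos) auto
    obtain d where "d > 0" and d: "\<And>z. norm z < d \<Longrightarrow> \<bar>conv w f (x + z) - conv w f x\<bar> \<le> e / (sqrt b + 1) * sqrt b"
      using conv_diff_bound[OF w e, of "norm x + 1"] f b less_add_one[of "norm x"] by blast
    have "e / (sqrt b + 1) * sqrt b \<le> e"
      using b(1) \<open>e > 0\<close> by (intro divide_add_one_mult_le) auto
    then have "dist (conv w f y) (conv w f x) \<le> e" if "dist y x < d" for y
      using d[of "y - x"] that by (simp add: dist_norm)
    with \<open>d > 0\<close> show ?thesis by blast
  qed
  then have "\<exists>d>0. \<forall>y. dist y x < d \<longrightarrow> dist (conv w f y) (conv w f x) < e" if "e > 0" for x e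
    using that by (meson dense order_le_less_trans)
  then show ?thesis by (simp add: continuous_on_iff)
qed

section \<open>Difference quotients of a convolution\<close>

lemma L2loc_diff_shift:
  assumes f: "L2loc f"
  shows "L2loc (\<lambda>x. f (x + h) - f x)"
  unfolding L2loc_def
proof (intro conjI allI)
  have [measurable]: "f \<in> borel_measurable borel" by (rule L2locD[OF f])
  show "(\<lambda>x. f (x + h) - f x) \<in> borel_measurable borel" by measurable
  fix R
  have "(\<integral>\<^sup>+x. ennreal ((f (x + h) - f x)\<^sup>2) * indicator (ball 0 R) x \<partial>lborel)
    \<le> (\<integral>\<^sup>+x. 2 * (ennreal ((f (x + h))\<^sup>2) * indicator (ball 0 (R + norm h)) (x + h)) + 2 * (ennreal ((f x)\<^sup>2) * indicator (ball 0 R) x) \<partial>lborel)"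
  proof (intro nn_integral_mono)
    fix x
    have "(f (x + h) - f x)\<^sup>2 \<le> 2 * (f (x + h))\<^sup>2 + 2 * (f x)\<^sup>2"
      using zero_le_power2[of "f (x + h) + f x"] by (simp add: power2_eq_square algebra_simps)
    then have "ennreal ((f (x + h) - f x)\<^sup>2) \<le> ennreal (2 * (f (x + h))\<^sup>2 + 2 * (f x)\<^sup>2)"
      by (rule ennreal_leI)
    also have "\<dots> = 2 * ennreal ((f (x + h))\<^sup>2) + 2 * ennreal ((f x)\<^sup>2)"
      by (simp add: ennreal_mult)
    finally have "ennreal ((f (x + h) - f x)\<^sup>2) \<le> 2 * ennreal ((f (x + h))\<^sup>2) + 2 * ennreal ((f x)\<^sup>2)" .
    moreover have "indicator (ball 0 R) x \<le> (indicator (ball 0 (R + norm h)) (x + h) :: ennreal)"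
      using norm_triangle_ineq[of x h] by (auto simp: indicator_def)
    ultimately show "ennreal ((f (x + h) - f x)\<^sup>2) * indicator (ball 0 R) x
      \<le> 2 * (ennreal ((f (x + h))\<^sup>2) * indicator (ball 0 (R + norm h)) (x + h)) + 2 * (ennreal ((f x)\<^sup>2) * indicator (ball 0 R) x)"
      by (auto simp: indicator_def split: if_splits)
  qed
  also have "\<dots> = 2 * (\<integral>\<^sup>+x. ennreal ((f (x + h))\<^sup>2) * indicator (ball 0 (R + norm h)) (x + h) \<partial>lborel)
      + 2 * (\<integral>\<^sup>+x. ennreal ((f x)\<^sup>2) * indicator (ball 0 R) x \<partial>lborel)"
    by (subst nn_integral_add) (auto simp: nn_integral_cmult)
  also have "(\<integral>\<^sup>+x. ennreal ((f (x + h))\<^sup>2) * indicator (ball 0 (R + norm h)) (x + h) \<partial>lborel)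
      = (\<integral>\<^sup>+x. ennreal ((f x)\<^sup>2) * indicator (ball 0 (R + norm h)) x \<partial>lborel)"
    by (rule nn_integral_lborel_shift[where f="\<lambda>x. ennreal ((f x)\<^sup>2) * indicator (ball 0 (R + norm h)) x"]) measurable
  also have "2 * \<dots> + 2 * (\<integral>\<^sup>+x. ennreal ((f x)\<^sup>2) * indicator (ball 0 R) x \<partial>lborel) < \<infinity>"
    using f unfolding L2loc_def by (auto simp: less_top[symmetric] ennreal_mult_eq_top_iff)
  finally show "(\<integral>\<^sup>+x. ennreal ((f (x + h) - f x)\<^sup>2) * indicator (ball 0 R) x \<partial>lborel) < \<infinity>" .
qed

text \<open>The substitution y + h moves the translation onto \<open>f\<close>; this is what turns
  differences of a convolution into convolutions of differences.\<close>

lemma conv_diff_shift: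
  assumes w: "L2_kernel r w" and f: "L2loc f"
  shows "conv w f (x + h) - conv w f x = conv w (\<lambda>x. f (x + h) - f x) x"
proof -
  have assms_meas[measurable]: "w \<in> borel_measurable borel" "f \<in> borel_measurable borel"
    using L2_kernelD[OF w] L2locD[OF f] by auto
  have "conv w f (x + h) = (\<integral>y. w (x + h - (y + h)) * f (y + h) \<partial>lborel)"
    unfolding conv_altdef[OF assms_meas]
    by (rule integral_lborel_shift[where f="\<lambda>y. w (x + h - y) * f y", symmetric]) measurable
  then have eq: "conv w f (x + h) = (\<integral>y. w (x - y) * f (y + h) \<partial>lborel)" by simp
  have "integrable lborel (\<lambda>y. w (x - y) * (f (y + h) - f y) + w (x - y) * f y)"
    using conv_integrable[OF w f] conv_integrable[OF w L2loc_diff_shift[OF f]] by simp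
  then have "integrable lborel (\<lambda>y. w (x - y) * f (y + h))" by (simp add: algebra_simps)
  then show ?thesis
    using conv_integrable[OF w f, of x] by (simp add: eq conv_altdef right_diff_distrib)
qed

text \<open>Cauchy-Schwarz with one bounded factor and one of order |h|. Hidden layers rely on this:
  after a convolution the function is even locally Lipschitz, hence of H1 type on bounded
  sets.\<close>

lemma conv_Lipschitz_locally:
  assumes w: "L2_kernel r w" and f: "L2loc f" "diffq_loc 2 f"
  shows "\<exists>C d. C \<ge> 0 \<and> d > 0 \<and> (\<forall>x h. norm x < R \<longrightarrow> norm h < d \<longrightarrow> \<bar>conv w f (x + h) - conv w f x\<bar> \<le> C * norm h)"
proof -
  obtain a where a: "a \<ge> 0" "(\<integral>\<^sup>+x. ennreal ((w x)\<^sup>2) \<partial>lborel) \<le> ennreal a" using L2_kernelD[OF w] by blast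
  obtain C d where C: "C \<ge> 0" "d > 0" "\<And>h. norm h < d \<Longrightarrow>
     (\<integral>\<^sup>+x. ennreal (\<bar>f (x + h) - f x\<bar>\<^sup>2) * indicator (ball 0 (R + r)) x \<partial>lborel) \<le> ennreal (C * norm h ^ 2)"
    using f(2) unfolding diffq_loc_def by blast
  have "\<bar>conv w f (x + h) - conv w f x\<bar> \<le> sqrt a * sqrt C * norm h" if "norm x < R" "norm h < d" for x h
  proof -
    have "\<bar>conv w (\<lambda>x. f (x + h) - f x) x\<bar> \<le> sqrt a * sqrt (C * norm h ^ 2)"
      by (rule conv_bound(2)[where R="R + r" and r=r])
        (use a C that L2_kernelD[OF w] L2locD[OF L2loc_diff_shift[OF f(1)]] in auto)
    then show ?thesis by (simp add: conv_diff_shift[OF w f(1)] real_sqrt_mult mult.assoc)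
  qed
  then show ?thesis using a C by (intro exI[of _ "sqrt a * sqrt C"] exI[of _ d]) auto
qed

text \<open>The difference quotients of the convolution are convolutions with the \<open>L\<^sup>2\<close>-bounded
  difference quotients of \<open>f\<close>, so they inherit the \<open>L\<^sup>2\<close>-modulus of continuity of the kernel,
  uniformly in the step \<open>h\<close>.\<close>

lemma conv_diffq_equicontinuous:
  assumes w: "L2_kernel r w" and f: "L2loc f" "diffq_loc 2 f" and "e > 0"
  shows "\<exists>d>0. \<forall>x z h. norm x < R \<longrightarrow> norm z < d \<longrightarrow> norm h < d \<longrightarrow>
    \<bar>(conv w f (x + z + h) - conv w f (x + z)) - (conv w f (x + h) - conv w f x)\<bar> \<le> e * norm h"
proof -
  obtain C d where C: "C \<ge> 0" "d > 0" "\<And>h. norm h < d \<Longrightarrow>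
     (\<integral>\<^sup>+x. ennreal (\<bar>f (x + h) - f x\<bar>\<^sup>2) * indicator (ball 0 (R + r + 1)) x \<partial>lborel) \<le> ennreal (C * norm h ^ 2)"
    using f(2) unfolding diffq_loc_def by blast
  have e: "e / (sqrt C + 1) > 0" using C(1) \<open>e > 0\<close> by (intro divide_pos_pos add_nonneg_pos) auto
  obtain d' where "d' > 0" and d': "\<And>f x z b. L2loc f \<Longrightarrow> norm x < R \<Longrightarrow> norm z < d' \<Longrightarrow> b \<ge> 0 \<Longrightarrow>
     (\<integral>\<^sup>+x. ennreal ((f x)\<^sup>2) * indicator (ball 0 (R + r + 1)) x \<partial>lborel) \<le> ennreal b \<Longrightarrow>
     \<bar>conv w f (x + z) - conv w f x\<bar> \<le> e / (sqrt C + 1) * sqrt b"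
    using conv_diff_bound[OF w e, of R] by blast
  have "e / (sqrt C + 1) * sqrt C \<le> e"
    using C(1) \<open>e > 0\<close> by (intro divide_add_one_mult_le) auto
  have "\<bar>(conv w f (x + z + h) - conv w f (x + z)) - (conv w f (x + h) - conv w f x)\<bar> \<le> e * norm h"
    if "norm x < R" "norm z < d'" "norm h < d" for x z h
  proof -
    have "\<bar>conv w (\<lambda>x. f (x + h) - f x) (x + z) - conv w (\<lambda>x. f (x + h) - f x) x\<bar> \<le> e / (sqrt C + 1) * sqrt (C * norm h ^ 2)"
      using C(3)[OF that(3)] C(1) by (intro d' that L2loc_diff_shift f) auto
    also have "\<dots> = (e / (sqrt C + 1) * sqrt C) * norm h" by (simp add: real_sqrt_mult)
    also have "\<dots> \<le> e * norm h" by (rule mult_right_mono) (fact, simp)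
    finally show ?thesis by (simp add: conv_diff_shift[OF w f(1)])
  qed
  then show ?thesis using \<open>d > 0\<close> \<open>d' > 0\<close> by (intro exI[of _ "min d d'"]) auto
qed

subsection \<open>Equicontinuous difference quotients\<close>

text \<open>If H(x) is the integral of \<open>g\<close> over [0, x], both sides equal H(s + t) -
  H(s) - H(t), which is symmetric in s and t.\<close>

lemma diffq_average_symmetric:
  fixes g :: "real \<Rightarrow> real"
  assumes g: "continuous_on UNIV g" and "s > 0" "t > 0"
  shows "integral {0..t} (\<lambda>r. g (r + s) - g r) = integral {0..s} (\<lambda>r. g (r + t) - g r)"
proof -
  have int: "g integrable_on {a..b}" for a b
    by (rule integrable_continuous_real) (rule continuous_on_subset[OF g], simp)
  have shift: "integral {0..t} (\<lambda>r. g (r + s)) = integral {s..t + s} g" for s t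
    using integral_shift_real_ivl[of s s "t + s" g] by simp
  have ishift: "(\<lambda>r. g (r + s)) integrable_on {0..t}" for s t
    by (intro integrable_continuous_real continuous_on_compose2[OF g] continuous_intros) auto
  have "integral {0..s} g + integral {s..t + s} g = integral {0..t} g + integral {t..s + t} g"
    using Henstock_Kurzweil_Integration.integral_combine[OF _ _ int, of 0 s "t + s"]
      Henstock_Kurzweil_Integration.integral_combine[OF _ _ int, of 0 t "s + t"] assms by (simp add: add.commute)
  then show ?thesis
    using shift ishift int by (simp add: Henstock_Kurzweil_Integration.integral_diff)
qed

lemma diffq_average_bound:
  fixes g :: "real \<Rightarrow> real"
  assumes g: "continuous_on UNIV g" and "t > 0"
    and bound: "\<And>r. 0 \<le> r \<Longrightarrow> r \<le> t \<Longrightarrow> \<bar>(g (r + s) - g r) - (g s - g 0)\<bar> \<le> B"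
  shows "\<bar>integral {0..t} (\<lambda>r. g (r + s) - g r) - t * (g s - g 0)\<bar> \<le> B * t"
proof -
  have cont: "continuous_on {0..t} (\<lambda>r. g (r + s) - g r)"
    by (intro continuous_intros continuous_on_compose2[OF g]) auto
  have "integral {0..t} (\<lambda>r. g (r + s) - g r) - t * (g s - g 0)
      = integral {0..t} (\<lambda>r. (g (r + s) - g r) - (g s - g 0))"
    using \<open>t > 0\<close> by (subst Henstock_Kurzweil_Integration.integral_diff) (auto intro: integrable_continuous_real[OF cont])
  moreover have "norm (integral {0..t} (\<lambda>r. (g (r + s) - g r) - (g s - g 0))) \<le> B * (t - 0)"
    using \<open>t > 0\<close> bound by (intro integral_bound) (auto intro!: continuous_intros cont)
  ultimately show ?thesis by simp
qed

text \<open>The average over \<open>[0,t]\<close> of the quotients with step \<open>s\<close> equals the average over \<open>[0,s]\<close> of the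
  quotients with step \<open>t\<close>. By equicontinuity these averages are close to the quotients at \<open>0\<close>.\<close>

lemma equicontinuous_diffq_Cauchy:
  fixes g :: "real \<Rightarrow> real"
  assumes g: "continuous_on UNIV g" and st: "s > 0" "t > 0" "s < d" "t < d"
    and equi: "\<And>r u. 0 \<le> r \<Longrightarrow> r < d \<Longrightarrow> 0 < u \<Longrightarrow> u < d \<Longrightarrow> \<bar>(g (r + u) - g r) - (g u - g 0)\<bar> \<le> e * u"
  shows "\<bar>(g s - g 0) / s - (g t - g 0) / t\<bar> \<le> 2 * e"
proof -
  let ?I = "integral {0..t} (\<lambda>r. g (r + s) - g r)"
  have 1: "\<bar>?I - t * (g s - g 0)\<bar> \<le> (e * s) * t"
    using st by (intro diffq_average_bound[OF g] equi) auto
  have 2: "\<bar>?I - s * (g t - g 0)\<bar> \<le> (e * t) * s"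
    unfolding diffq_average_symmetric[OF g st(1,2)]
    using st by (intro diffq_average_bound[OF g] equi) auto
  have "\<bar>t * (g s - g 0) - s * (g t - g 0)\<bar> \<le> (2 * e) * (s * t)"
    using 1 2 by (simp add: algebra_simps)
  moreover have "(g s - g 0) / s - (g t - g 0) / t = (t * (g s - g 0) - s * (g t - g 0)) / (s * t)"
    using st by (simp add: field_simps)
  ultimately show ?thesis
    using st by (simp add: abs_divide abs_mult pos_divide_le_eq)
qed

text \<open>The limit along t = 1 / (n + 1) exists by the Cauchy estimate, and the same estimate
  compares every other small positive step with it. All bounds stay uniform on balls, because the
  total derivative is later assembled by steps from a moving base point.\<close>

lemma equicontinuous_diffq_imp_directional_derivative:
  fixes F :: "'a::real_normed_vector \<Rightarrow> real"
  assumes F: "continuous_on UNIV F" and v: "norm v = 1"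
    and equi: "\<And>R e. e > 0 \<Longrightarrow> \<exists>d>0. \<forall>x z h. norm x < R \<longrightarrow> norm z < d \<longrightarrow> norm h < d \<longrightarrow>
       \<bar>(F (x + z + h) - F (x + z)) - (F (x + h) - F x)\<bar> \<le> e * norm h"
  shows "\<exists>G. continuous_on UNIV G \<and> (\<forall>R e. e > 0 \<longrightarrow> (\<exists>d>0. \<forall>x t. norm x < R \<longrightarrow> \<bar>t\<bar> < d \<longrightarrow>
      \<bar>F (x + t *\<^sub>R v) - F x - t * G x\<bar> \<le> e * \<bar>t\<bar>))"
proof -
  define D where "D t x = (F (x + t *\<^sub>R v) - F x) / t" for t x
  have cauchy: "\<exists>d>0. \<forall>x s t. norm x < R \<longrightarrow> 0 < s \<longrightarrow> 0 < t \<longrightarrow> s < d \<longrightarrow> t < d \<longrightarrow> \<bar>D s x - D t x\<bar> \<le> e"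
    if "e > 0" for R e
  proof -
    obtain d where "d > 0" and d: "\<And>x z h. norm x < R \<Longrightarrow> norm z < d \<Longrightarrow> norm h < d \<Longrightarrow>
       \<bar>(F (x + z + h) - F (x + z)) - (F (x + h) - F x)\<bar> \<le> e / 2 * norm h"
      using equi[of "e / 2" R] \<open>e > 0\<close> by auto
    have "\<bar>D s x - D t x\<bar> \<le> e" if st: "norm x < R" "0 < s" "0 < t" "s < d" "t < d" for x s t
    proof -
      define g where "g r = F (x + r *\<^sub>R v)" for r
      have "continuous_on UNIV g"
        unfolding g_def by (intro continuous_on_compose2[OF F] continuous_intros) auto
      then have "\<bar>(g s - g 0) / s - (g t - g 0) / t\<bar> \<le> 2 * (e / 2)"
      proof (rule equicontinuous_diffq_Cauchy[OF _ st(2-5)])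
        fix r u assume "0 \<le> r" "r < d" "0 < u" "u < d"
        then show "\<bar>(g (r + u) - g r) - (g u - g 0)\<bar> \<le> e / 2 * u"
          using d[OF st(1), of "r *\<^sub>R v" "u *\<^sub>R v"] v by (simp add: g_def scaleR_add_left add.assoc)
      qed
      then show ?thesis by (simp add: g_def D_def)
    qed
    with \<open>d > 0\<close> show ?thesis by blast
  qed
  define G where "G x = lim (\<lambda>n. D (1 / Suc n) x)" for x
  have ev: "\<forall>\<^sub>F n in sequentially. 1 / Suc n < d" if "d > 0" for d :: real
    using order_tendstoD(2)[OF LIMSEQ_inverse_real_of_nat that] by (simp add: inverse_eq_divide)
  have lim: "(\<lambda>n. D (1 / Suc n) x) \<longlonglongrightarrow> G x" for x
  proof -
    have "Cauchy (\<lambda>n. D (1 / Suc n) x)"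
    proof (rule CauchyI)
      fix e :: real assume "e > 0"
      then obtain d where "d > 0" and d: "\<And>s t. 0 < s \<Longrightarrow> 0 < t \<Longrightarrow> s < d \<Longrightarrow> t < d \<Longrightarrow> \<bar>D s x - D t x\<bar> \<le> e / 2"
        using cauchy[of "e / 2" "norm x + 1"] by (metis half_gt_zero less_add_one)
      obtain N where N: "\<And>n. n \<ge> N \<Longrightarrow> 1 / Suc n < d"
        using ev[OF \<open>d > 0\<close>] unfolding eventually_sequentially by blast
      have "norm (D (1 / Suc m) x - D (1 / Suc n) x) < e" if "m \<ge> N" "n \<ge> N" for m n
        using d[OF _ _ N[OF that(1)] N[OF that(2)]] \<open>e > 0\<close> by simp
      then show "\<exists>M. \<forall>m\<ge>M. \<forall>n\<ge>M. norm (D (1 / Suc m) x - D (1 / Suc n) x) < e" by blast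
    qed
    then show ?thesis unfolding G_def by (simp add: Cauchy_convergent_iff convergent_LIMSEQ_iff)
  qed
  have D_G: "\<exists>d>0. \<forall>x t. norm x < R \<longrightarrow> 0 < t \<longrightarrow> t < d \<longrightarrow> \<bar>D t x - G x\<bar> \<le> e" if "e > 0" for R e
  proof -
    obtain d where "d > 0" and d: "\<And>x s t. norm x < R \<Longrightarrow> 0 < s \<Longrightarrow> 0 < t \<Longrightarrow> s < d \<Longrightarrow> t < d \<Longrightarrow> \<bar>D s x - D t x\<bar> \<le> e"
      using cauchy[OF \<open>e > 0\<close>] by blast
    have "\<bar>D t x - G x\<bar> \<le> e" if "norm x < R" "0 < t" "t < d" for x t
    proof (rule tendsto_upperbound)
      show "(\<lambda>n. \<bar>D t x - D (1 / Suc n) x\<bar>) \<longlonglongrightarrow> \<bar>D t x - G x\<bar>" by (intro tendsto_intros lim)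
      show "\<forall>\<^sub>F n in sequentially. \<bar>D t x - D (1 / Suc n) x\<bar> \<le> e"
        by (rule eventually_mono[OF ev[OF \<open>d > 0\<close>]]) (rule d[OF that(1,2) _ that(3)], auto)
    qed simp
    with \<open>d > 0\<close> show ?thesis by blast
  qed
  have G_equi: "\<exists>d>0. \<forall>x z. norm x < R \<longrightarrow> norm z < d \<longrightarrow> \<bar>G (x + z) - G x\<bar> \<le> e" if "e > 0" for R e
  proof -
    obtain d where "d > 0" and d: "\<And>x z h. norm x < R \<Longrightarrow> norm z < d \<Longrightarrow> norm h < d \<Longrightarrow>
       \<bar>(F (x + z + h) - F (x + z)) - (F (x + h) - F x)\<bar> \<le> e * norm h"
      using equi[OF \<open>e > 0\<close>, of R] by auto
    have "\<bar>G (x + z) - G x\<bar> \<le> e" if "norm x < R" "norm z < d" for x z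
    proof (rule tendsto_upperbound)
      show "(\<lambda>n. \<bar>D (1 / Suc n) (x + z) - D (1 / Suc n) x\<bar>) \<longlonglongrightarrow> \<bar>G (x + z) - G x\<bar>"
        by (intro tendsto_intros lim)
      have "\<bar>D t (x + z) - D t x\<bar> \<le> e" if "0 < t" "t < d" for t
      proof -
        have "D t (x + z) - D t x = ((F (x + z + t *\<^sub>R v) - F (x + z)) - (F (x + t *\<^sub>R v) - F x)) / t"
          by (simp add: D_def diff_divide_distrib)
        moreover have "\<bar>(F (x + z + t *\<^sub>R v) - F (x + z)) - (F (x + t *\<^sub>R v) - F x)\<bar> \<le> e * t"
          using d[OF \<open>norm x < R\<close> \<open>norm z < d\<close>, of "t *\<^sub>R v"] v that by simp
        ultimately show ?thesis using that by (simp add: abs_divide pos_divide_le_eq)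
      qed
      note D_equi = this
      show "\<forall>\<^sub>F n in sequentially. \<bar>D (1 / Suc n) (x + z) - D (1 / Suc n) x\<bar> \<le> e"
        by (rule eventually_mono[OF ev[OF \<open>d > 0\<close>]]) (rule D_equi, auto)
    qed simp
    with \<open>d > 0\<close> show ?thesis by blast
  qed
  have "\<exists>d>0. \<forall>y. dist y x < d \<longrightarrow> dist (G y) (G x) < e" if e: "e > 0" for x e
  proof -
    obtain d where d: "d > 0" "\<And>z. norm z < d \<Longrightarrow> \<bar>G (x + z) - G x\<bar> \<le> e / 2"
      using G_equi[of "e / 2" "norm x + 1"] half_gt_zero[OF e] less_add_one[of "norm x"] by blast
    have "dist (G y) (G x) < e" if "dist y x < d" for y
      using d(2)[of "y - x"] that e by (simp add: dist_norm)
    with d(1) show ?thesis by blast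
  qed
  then have "continuous_on UNIV G" by (simp add: continuous_on_iff)
  moreover have "\<exists>d>0. \<forall>x t. norm x < R \<longrightarrow> \<bar>t\<bar> < d \<longrightarrow> \<bar>F (x + t *\<^sub>R v) - F x - t * G x\<bar> \<le> e * \<bar>t\<bar>"
    if "e > 0" for R e
  proof -
    \<comment> \<open>The radius \<open>R + 1\<close> makes room for the base point x + t v that
      negative steps use.\<close>
    obtain d1 where "d1 > 0" and d1: "\<And>x t. norm x < R + 1 \<Longrightarrow> 0 < t \<Longrightarrow> t < d1 \<Longrightarrow> \<bar>D t x - G x\<bar> \<le> e / 2"
      using D_G[of "e / 2" "R + 1"] \<open>e > 0\<close> by (metis half_gt_zero)
    obtain d2 where "d2 > 0" and d2: "\<And>x z. norm x < R \<Longrightarrow> norm z < d2 \<Longrightarrow> \<bar>G (x + z) - G x\<bar> \<le> e / 2"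
      using G_equi[of "e / 2" R] \<open>e > 0\<close> by (metis half_gt_zero)
    let ?d = "min 1 (min d1 d2)"
    have "\<bar>F (x + t *\<^sub>R v) - F x - t * G x\<bar> \<le> e * \<bar>t\<bar>" if x: "norm x < R" and t: "\<bar>t\<bar> < ?d" for x t
    proof -
      consider "t = 0" | "t > 0" | "t < 0" by linarith
      then show ?thesis
      proof cases
        case 2
        have "\<bar>D t x - G x\<bar> \<le> e" using d1[of x t] x t 2 \<open>e > 0\<close> by simp
        moreover have "F (x + t *\<^sub>R v) - F x - t * G x = t * (D t x - G x)"
          using 2 by (simp add: D_def field_simps)
        ultimately show ?thesis using 2 by (simp add: abs_mult mult.commute)
      next
        \<comment> \<open>Seen from \<open>?y\<close>, the step back to \<open>x\<close> is
          positive. The quotient at \<open>?y\<close> is close to \<open>G ?y\<close>, and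
          equicontinuity of \<open>G\<close> returns to \<open>x\<close>; each costs e / 2.\<close>
        case 3
        let ?y = "x + t *\<^sub>R v"
        have "norm ?y < R + 1" using norm_triangle_ineq[of x "t *\<^sub>R v"] x t v by simp
        then have "\<bar>D (- t) ?y - G ?y\<bar> \<le> e / 2" using d1[of ?y "- t"] t 3 by simp
        moreover have "\<bar>G ?y - G x\<bar> \<le> e / 2" using d2[of x "t *\<^sub>R v"] x t v by simp
        ultimately have "\<bar>D (- t) ?y - G x\<bar> \<le> e" by linarith
        moreover have "F ?y - F x - t * G x = t * (D (- t) ?y - G x)"
          using 3 by (simp add: D_def field_simps)
        ultimately show ?thesis by (simp only: abs_mult mult.commute[of e] mult_left_mono abs_ge_zero)
      qed simp
    qed
    then show ?thesis using \<open>d1 > 0\<close> \<open>d2 > 0\<close> by (intro exI[of _ ?d]) auto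
  qed
  ultimately show ?thesis by blast
qed

text \<open>Go from \<open>x\<close> parallel to the first axis to \<open>?z\<close>, then parallel
  to the second. The second leg starts at \<open>?z\<close>, so its estimate must be uniform in the
  base point, and \<open>G2 ?z\<close> must be replaced by \<open>G2 x\<close>. The two legs and
  this replacement are the three errors of size e / 3.\<close>

lemma has_derivative_uniform_partials:
  fixes F :: "real \<times> real \<Rightarrow> real"
  assumes G1: "continuous_on UNIV G1" and G2: "continuous_on UNIV G2"
    and F1: "\<And>R e. e > 0 \<Longrightarrow> \<exists>d>0. \<forall>x t. norm x < R \<longrightarrow> \<bar>t\<bar> < d \<longrightarrow>
      \<bar>F (x + t *\<^sub>R (1, 0)) - F x - t * G1 x\<bar> \<le> e * \<bar>t\<bar>"
    and F2: "\<And>R e. e > 0 \<Longrightarrow> \<exists>d>0. \<forall>x t. norm x < R \<longrightarrow> \<bar>t\<bar> < d \<longrightarrow>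
      \<bar>F (x + t *\<^sub>R (0, 1)) - F x - t * G2 x\<bar> \<le> e * \<bar>t\<bar>"
  shows "(F has_derivative (\<lambda>h. G1 x * fst h + G2 x * snd h)) (at x)"
  unfolding has_derivative_at_alt
proof (intro conjI allI impI)
  show "bounded_linear (\<lambda>h. G1 x * fst h + G2 x * snd h)"
    by (intro bounded_linear_add bounded_linear_const_mult bounded_linear_fst bounded_linear_snd)
  fix e :: real assume "e > 0"
  then have e: "e / 3 > 0" by simp
  obtain d1 where "d1 > 0" and d1: "\<And>y t. norm y < norm x + 1 \<Longrightarrow> \<bar>t\<bar> < d1 \<Longrightarrow> \<bar>F (y + t *\<^sub>R (1, 0)) - F y - t * G1 y\<bar> \<le> e / 3 * \<bar>t\<bar>"
    using F1[OF e] by metis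
  obtain d2 where "d2 > 0" and d2: "\<And>y t. norm y < norm x + 1 \<Longrightarrow> \<bar>t\<bar> < d2 \<Longrightarrow> \<bar>F (y + t *\<^sub>R (0, 1)) - F y - t * G2 y\<bar> \<le> e / 3 * \<bar>t\<bar>"
    using F2[OF e] by metis
  obtain d3 where "d3 > 0" and d3: "\<And>y. dist y x < d3 \<Longrightarrow> dist (G2 y) (G2 x) < e / 3"
    using G2 e unfolding continuous_on_iff by (metis UNIV_I)
  let ?d = "min 1 (min d1 (min d2 d3))"
  show "\<exists>d>0. \<forall>y. norm (y - x) < d \<longrightarrow>
      norm (F y - F x - (G1 x * fst (y - x) + G2 x * snd (y - x))) \<le> e * norm (y - x)"
  proof (intro exI[of _ ?d] conjI allI impI)
    fix y assume y: "norm (y - x) < ?d"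
    define s t where "s = fst (y - x)" and "t = snd (y - x)"
    let ?z = "x + s *\<^sub>R (1, 0)"
    have st: "\<bar>s\<bar> \<le> norm (y - x)" "\<bar>t\<bar> \<le> norm (y - x)"
    proof -
      have "\<bar>fst p\<bar> \<le> norm p \<and> \<bar>snd p\<bar> \<le> norm p" for p :: "real \<times> real"
        by (cases p) (metis fst_conv norm_fst_le norm_snd_le real_norm_def snd_conv)
      then show "\<bar>s\<bar> \<le> norm (y - x)" "\<bar>t\<bar> \<le> norm (y - x)" unfolding s_def t_def by blast+
    qed
    have ys: "y = ?z + t *\<^sub>R (0, 1)" by (simp add: s_def t_def prod_eq_iff)
    have nz: "norm ?z < norm x + 1" using norm_triangle_ineq[of x "s *\<^sub>R (1, 0)"] st y by simp
    have A: "\<bar>F y - F ?z - t * G2 ?z\<bar> \<le> e / 3 * \<bar>t\<bar>"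
      using d2[OF nz, of t] st y ys[symmetric] by simp
    have B: "\<bar>F ?z - F x - s * G1 x\<bar> \<le> e / 3 * \<bar>s\<bar>" using d1[of x s] st y by simp
    have "\<bar>G2 ?z - G2 x\<bar> \<le> e / 3" using d3[of ?z] st y by (simp add: dist_norm)
    then have C: "\<bar>t * G2 ?z - t * G2 x\<bar> \<le> e / 3 * \<bar>t\<bar>"
      by (simp only: right_diff_distrib[symmetric] abs_mult mult.commute[of "e / 3"] mult_left_mono abs_ge_zero)
    have "\<bar>F y - F x - (G1 x * s + G2 x * t)\<bar> \<le> e / 3 * \<bar>t\<bar> + e / 3 * \<bar>s\<bar> + e / 3 * \<bar>t\<bar>"
      using A B C unfolding mult.commute[of "G1 x"] mult.commute[of "G2 x"] by linarith
    also have "\<dots> \<le> e / 3 * norm (y - x) + e / 3 * norm (y - x) + e / 3 * norm (y - x)"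
      using st \<open>e > 0\<close> by (intro add_mono mult_left_mono) auto
    finally show "norm (F y - F x - (G1 x * fst (y - x) + G2 x * snd (y - x))) \<le> e * norm (y - x)"
      by (simp add: s_def t_def)
  qed (use \<open>d1 > 0\<close> \<open>d2 > 0\<close> \<open>d3 > 0\<close> in simp)
qed

proposition conv_C1:
  fixes w f :: "real \<times> real \<Rightarrow> real"
  assumes w: "L2_kernel r w" and f: "L2loc f" "diffq_loc 2 f"
  shows "\<exists>G1 G2. continuous_on UNIV G1 \<and> continuous_on UNIV G2 \<and>
    (\<forall>x. (conv w f has_derivative (\<lambda>h. G1 x * fst h + G2 x * snd h)) (at x))"
proof -
  note dir = equicontinuous_diffq_imp_directional_derivative[OF continuous_conv[OF w f(1)] _
      conv_diffq_equicontinuous[OF w f]]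
  obtain G1 where G1: "continuous_on UNIV G1" "\<And>R e. e > 0 \<Longrightarrow> \<exists>d>0. \<forall>x t. norm x < R \<longrightarrow> \<bar>t\<bar> < d \<longrightarrow>
      \<bar>conv w f (x + t *\<^sub>R (1, 0)) - conv w f x - t * G1 x\<bar> \<le> e * \<bar>t\<bar>"
    using dir[of "(1, 0)"] by auto
  obtain G2 where G2: "continuous_on UNIV G2" "\<And>R e. e > 0 \<Longrightarrow> \<exists>d>0. \<forall>x t. norm x < R \<longrightarrow> \<bar>t\<bar> < d \<longrightarrow>
      \<bar>conv w f (x + t *\<^sub>R (0, 1)) - conv w f x - t * G2 x\<bar> \<le> e * \<bar>t\<bar>"
    using dir[of "(0, 1)"] by auto
  show ?thesis
    using G1(1) G2(1) has_derivative_uniform_partials[OF G1(1) G2(1) G1(2) G2(2)] by blast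
qed

subsection \<open>Folding\<close>

text \<open>Splitting off the full periods \<open>q\<close> leaves the phase \<open>s\<close>; on
  one period the folding is an explicit tent function and the floor has disappeared.\<close>

lemma fold_int_decomp:
  fixes a b t :: real
  assumes "a < b"
  obtains q :: int and s where "0 \<le> s" "s < 2 * (b - a)" "t = a + 2 * (b - a) * q + s"
    "fold_int a b t = a + (b - a - \<bar>s - (b - a)\<bar>)"
proof
  let ?l = "b - a" and ?q = "\<lfloor>(t - a) / (2 * (b - a))\<rfloor>"
  let ?s = "(t - a) - 2 * ?l * of_int ?q"
  have l: "2 * ?l > 0" using assms by simp
  have "of_int ?q \<le> (t - a) / (2 * ?l)" "(t - a) / (2 * ?l) < of_int ?q + 1" by linarith+
  then have "of_int ?q * (2 * ?l) \<le> t - a" "t - a < (of_int ?q + 1) * (2 * ?l)"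
    by (simp_all only: pos_le_divide_eq[OF l] pos_divide_less_eq[OF l])
  then show "0 \<le> ?s" "?s < 2 * ?l" by (simp_all add: algebra_simps)
  show "t = a + 2 * ?l * ?q + ?s" by simp
  show "fold_int a b t = a + (?l - \<bar>?s - ?l\<bar>)" by (simp add: fold_int_def Let_def)
qed

lemma fold_int_range:
  assumes "a < b"
  shows "fold_int a b t \<in> {a..b}"
proof -
  obtain q :: int and s where s: "0 \<le> s" "s < 2 * (b - a)" "t = a + 2 * (b - a) * q + s"
    "fold_int a b t = a + (b - a - \<bar>s - (b - a)\<bar>)" using fold_int_decomp[OF assms] by blast
  have "s < b - a + (b - a)" using s(2) by simp
  then have "\<bar>s - (b - a)\<bar> \<le> b - a" using s(1) by linarith
  then show ?thesis unfolding s(4) by simp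
qed

text \<open>Folding is \<open>t \<mapsto> a + dist (t, a + 2 (b - a) \<int>)\<close>, hence 1-Lipschitz.\<close>

lemma fold_int_le_dist_lattice:
  fixes j :: int
  assumes "a < b"
  shows "fold_int a b t - a \<le> \<bar>t - a - 2 * (b - a) * j\<bar>"
proof -
  obtain q :: int and s where s: "0 \<le> s" "s < 2 * (b - a)" "t = a + 2 * (b - a) * q + s"
    "fold_int a b t = a + (b - a - \<bar>s - (b - a)\<bar>)" using fold_int_decomp[OF assms] by blast
  define m where "m = 2 * (b - a) * real_of_int (q - j)"
  have eq: "t - a - 2 * (b - a) * j = m + s" using s(3) by (simp add: m_def algebra_simps)
  consider "j \<le> q" | "j \<ge> q + 1" by linarith
  then show ?thesis
  proof cases
    case 1
    then have "m \<ge> 0" using assms by (simp add: m_def)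
    then show ?thesis unfolding eq s(4) using s(1) by linarith
  next
    case 2
    have "m \<le> 2 * (b - a) * (-1)"
      unfolding m_def using assms 2 by (intro mult_left_mono) auto
    then have "m \<le> - (b - a) - (b - a)" by simp
    moreover have "s < b - a + (b - a)" using s(2) by simp
    ultimately show ?thesis unfolding eq s(4) by linarith
  qed
qed

text \<open>The nearest lattice point is the left end of the period for phases up to b - a and its
  right end afterwards.\<close>

lemma fold_int_eq_dist_lattice:
  assumes "a < b"
  obtains j :: int where "fold_int a b t - a = \<bar>t - a - 2 * (b - a) * j\<bar>"
proof -
  obtain q :: int and s where s: "0 \<le> s" "s < 2 * (b - a)" "t = a + 2 * (b - a) * q + s"
    "fold_int a b t = a + (b - a - \<bar>s - (b - a)\<bar>)" using fold_int_decomp[OF assms] by blast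
  show ?thesis
  proof (cases "s \<le> b - a")
    case True
    have eq: "t - a - 2 * (b - a) * q = s" using s(3) by simp
    show ?thesis by (rule that[of q]) (unfold eq s(4), use s(1) True in linarith)
  next
    case False
    have eq: "t - a - 2 * (b - a) * real_of_int (q + 1) = s - (b - a) - (b - a)" using s(3) by (simp add: algebra_simps)
    have "s < b - a + (b - a)" using s(2) by simp
    then show ?thesis by (intro that[of "q + 1"]) (unfold eq s(4), use False in linarith)
  qed
qed

text \<open>The lattice point nearest to \<open>s\<close> is a competitor for \<open>t\<close>, so
  the distances of the two points to the lattice differ by at most |t - s|.\<close>

lemma fold_int_Lipschitz:
  assumes "a < b"
  shows "\<bar>fold_int a b t - fold_int a b s\<bar> \<le> \<bar>t - s\<bar>"
proof -
  have *: "fold_int a b t - fold_int a b s \<le> \<bar>t - s\<bar>" for t s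
  proof -
    obtain j :: int where "fold_int a b s - a = \<bar>s - a - 2 * (b - a) * j\<bar>"
      using fold_int_eq_dist_lattice[OF assms] by blast
    with fold_int_le_dist_lattice[OF assms, of t j] show ?thesis by linarith
  qed
  show ?thesis using *[of t s] *[of s t] by linarith
qed

lemma continuous_fold_int:
  assumes "a < b"
  shows "continuous_on UNIV (fold_int a b)"
  unfolding continuous_on_iff dist_real_def
proof (intro ballI allI impI)
  fix x e :: real assume "e > 0"
  then show "\<exists>d>0. \<forall>x'\<in>UNIV. \<bar>x' - x\<bar> < d \<longrightarrow> \<bar>fold_int a b x' - fold_int a b x\<bar> < e"
    using order_le_less_trans[OF fold_int_Lipschitz[OF assms]] by (intro exI[of _ e]) blast
qed

section \<open>Cells of the folding map and its affine branches\<close>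

text \<open>Half-open, so that the cells partition the line. A cell has half the length of a period,
  and the parity of \<open>k\<close> tells whether the folding preserves or reverses orientation on
  it.\<close>

definition fold_cell :: "real \<Rightarrow> real \<Rightarrow> int \<Rightarrow> real set" where
  "fold_cell a b k = {a + k * (b - a) ..< a + (k + 1) * (b - a)}"

text \<open>The inverse of the folding on cell \<open>k\<close>, in the form c + e y with e = 1 or e
  = -1 that \<open>nn_integral_lborel_pair_flip\<close> expects.\<close>

definition unfold_int :: "real \<Rightarrow> real \<Rightarrow> int \<Rightarrow> real \<Rightarrow> real" where
  "unfold_int a b k y = (if even k then k * (b - a) + 1 * y else (2 * a + (k + 1) * (b - a)) + (-1) * y)"

lemma fold_int_on_cell:
  assumes "a < b" "t \<in> fold_cell a b k"
  shows "fold_int a b t = (if even k then t - k * (b - a) else 2 * a + (k + 1) * (b - a) - t)"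
proof -
  let ?l = "b - a"
  have "?l > 0" using assms by simp
  have t: "a + k * ?l \<le> t" "t < a + (k + 1) * ?l" using assms by (auto simp: fold_cell_def)
  show ?thesis
  proof (cases "even k")
    case True
    then obtain j where k: "k = 2 * j" by (auto elim: evenE)
    have "\<lfloor>(t - a) / (2 * ?l)\<rfloor> = j"
      using t \<open>?l > 0\<close> by (intro floor_unique) (auto simp: k field_simps)
    then show ?thesis using t True by (simp add: fold_int_def Let_def k algebra_simps)
  next
    case False
    then obtain j where k: "k = 2 * j + 1" by (auto elim: oddE)
    have "\<lfloor>(t - a) / (2 * ?l)\<rfloor> = j"
      using t \<open>?l > 0\<close> by (intro floor_unique) (auto simp: k field_simps)
    then show ?thesis using t False by (simp add: fold_int_def Let_def k algebra_simps)
  qed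
qed

lemma fold_int_eq_iff_on_cell:
  assumes "a < b" "t \<in> fold_cell a b k"
  shows "fold_int a b t = y \<longleftrightarrow> t = unfold_int a b k y"
  unfolding fold_int_on_cell[OF assms] by (auto simp: unfold_int_def)

lemma mem_fold_cell_iff:
  assumes "a < b"
  shows "t \<in> fold_cell a b k \<longleftrightarrow> k = \<lfloor>(t - a) / (b - a)\<rfloor>"
proof -
  have l: "b - a > 0" using assms by simp
  have "k = \<lfloor>(t - a) / (b - a)\<rfloor> \<longleftrightarrow> of_int k \<le> (t - a) / (b - a) \<and> (t - a) / (b - a) < of_int k + 1"
    using floor_eq_iff[of "(t - a) / (b - a)" k] by (simp only: eq_commute[of k])
  then show ?thesis
    by (simp only: pos_le_divide_eq[OF l] pos_divide_less_eq[OF l] fold_cell_def) (auto simp: algebra_simps)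
qed

lemma fold_cell_measurable [measurable]: "fold_cell a b k \<in> sets borel"
  by (simp add: fold_cell_def)

lemma unfold_int_measurable [measurable]: "unfold_int a b k \<in> borel_measurable borel"
  unfolding unfold_int_def[abs_def] by (cases "even k") simp_all

lemma nn_integral_lborel_pair:
  fixes f :: "real \<times> real \<Rightarrow> ennreal"
  assumes "f \<in> borel_measurable borel"
  shows "(\<integral>\<^sup>+x. f x \<partial>lborel) = (\<integral>\<^sup>+s. \<integral>\<^sup>+t. f (s, t) \<partial>lborel \<partial>lborel)"
proof -
  have "f \<in> borel_measurable (lborel \<Otimes>\<^sub>M lborel)"
    using assms by (simp add: lborel_prod)
  from lborel.nn_integral_fst[OF this] show ?thesis by (simp add: lborel_prod)
qed

lemma nn_integral_lborel_pair_flip: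
  fixes G :: "real \<times> real \<Rightarrow> ennreal"
  assumes [measurable]: "G \<in> borel_measurable borel" and e: "\<bar>e1\<bar> = 1" "\<bar>e2\<bar> = 1"
  shows "(\<integral>\<^sup>+y. G (c1 + e1 * fst y, c2 + e2 * snd y) \<partial>lborel) = (\<integral>\<^sup>+x. G x \<partial>lborel)"
proof -
  have m[measurable]: "G \<in> borel_measurable (borel \<Otimes>\<^sub>M borel)" by (simp add: borel_prod)
  have e0: "e1 \<noteq> 0" "e2 \<noteq> 0" using e by auto
  have "(\<integral>\<^sup>+y. G (c1 + e1 * fst y, c2 + e2 * snd y) \<partial>lborel)
     = (\<integral>\<^sup>+s. \<integral>\<^sup>+t. G (c1 + e1 * s, c2 + e2 * t) \<partial>lborel \<partial>lborel)"
    by (subst nn_integral_lborel_pair) (simp_all add: borel_prod[symmetric])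
  also have "\<dots> = (\<integral>\<^sup>+s. \<integral>\<^sup>+t. G (c1 + e1 * s, t) \<partial>lborel \<partial>lborel)"
  proof (rule nn_integral_cong)
    fix s :: real
    show "(\<integral>\<^sup>+t. G (c1 + e1 * s, c2 + e2 * t) \<partial>lborel) = (\<integral>\<^sup>+t. G (c1 + e1 * s, t) \<partial>lborel)"
      using nn_integral_real_affine[OF _ e0(2), of "\<lambda>t. G (c1 + e1 * s, t)" c2] e by simp
  qed
  also have "\<dots> = (\<integral>\<^sup>+s. \<integral>\<^sup>+t. G (s, t) \<partial>lborel \<partial>lborel)"
    using nn_integral_real_affine[OF _ e0(1), of "\<lambda>s. \<integral>\<^sup>+t. G (s, t) \<partial>lborel" c1] e by simp
  also have "\<dots> = (\<integral>\<^sup>+x. G x \<partial>lborel)"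
    by (rule nn_integral_lborel_pair[symmetric]) simp
  finally show ?thesis .
qed

text \<open>Names the corners, so that \<open>foldmap\<close>, which is stated through Inf and Sup
  of projections, becomes explicit.\<close>

locale rectangle =
  fixes a b c d :: real
  assumes ab: "a < b" and cd: "c < d"
begin

abbreviation \<theta> :: "pt set" where "\<theta> \<equiv> {a<..<b} \<times> {c<..<d}"

definition cell :: "int \<times> int \<Rightarrow> pt set" where
  "cell p = fold_cell a b (fst p) \<times> fold_cell c d (snd p)"

definition unf :: "int \<times> int \<Rightarrow> pt \<Rightarrow> pt" where
  "unf p y = (unfold_int a b (fst p) (fst y), unfold_int c d (snd p) (snd y))"

lemma foldmap_eq: "foldmap \<theta> x = (fold_int a b (fst x), fold_int c d (snd x))"
proof -
  have "fst ` \<theta> = {a<..<b}" "snd ` \<theta> = {c<..<d}" using ab cd by auto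
  then show ?thesis using ab cd by (simp add: foldmap_def)
qed

lemma closure_\<theta>: "closure \<theta> = {a..b} \<times> {c..d}"
  using ab cd by (simp add: closure_Times)

lemma foldmap_in: "foldmap \<theta> x \<in> closure \<theta>"
  using fold_int_range[OF ab] fold_int_range[OF cd] by (simp add: foldmap_eq closure_\<theta>)

lemma continuous_foldmap: "continuous_on UNIV (foldmap \<theta>)"
  unfolding foldmap_eq[abs_def]
  by (intro continuous_intros continuous_on_compose2[OF continuous_fold_int[OF ab]]
      continuous_on_compose2[OF continuous_fold_int[OF cd]]) auto

lemma foldmap_measurable [measurable]: "foldmap \<theta> \<in> borel_measurable borel"
  by (rule borel_measurable_continuous_onI[OF continuous_foldmap])

lemma cell_measurable [measurable]: "cell p \<in> sets borel"
  unfolding cell_def by (intro borel_Times) measurable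

lemma unf_measurable [measurable]: "unf p \<in> borel_measurable borel"
  unfolding unf_def borel_prod[symmetric] by measurable

lemma foldmap_eq_iff_on_cell: "x \<in> cell p \<Longrightarrow> foldmap \<theta> x = y \<longleftrightarrow> x = unf p y"
  using fold_int_eq_iff_on_cell[OF ab] fold_int_eq_iff_on_cell[OF cd]
  by (auto simp: cell_def unf_def foldmap_eq prod_eq_iff)

lemma mem_cell_iff: "x \<in> cell p \<longleftrightarrow> p = (\<lfloor>(fst x - a) / (b - a)\<rfloor>, \<lfloor>(snd x - c) / (d - c)\<rfloor>)"
  using mem_fold_cell_iff[OF ab] mem_fold_cell_iff[OF cd] by (auto simp: cell_def prod_eq_iff mem_Times_iff)

lemma finite_cells_cover:
  assumes "bounded B"
  obtains J where "finite J" "B \<subseteq> (\<Union>p\<in>J. cell p)"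
proof -
  let ?ix = "\<lambda>x::pt. (\<lfloor>(fst x - a) / (b - a)\<rfloor>, \<lfloor>(snd x - c) / (d - c)\<rfloor>)"
  obtain R where R: "\<And>x. x \<in> B \<Longrightarrow> norm x \<le> R" using assms by (auto simp: bounded_iff)
  let ?J = "{\<lfloor>(- R - a) / (b - a)\<rfloor>..\<lfloor>(R - a) / (b - a)\<rfloor>} \<times> {\<lfloor>(- R - c) / (d - c)\<rfloor>..\<lfloor>(R - c) / (d - c)\<rfloor>}"
  have "?ix x \<in> ?J" if "x \<in> B" for x
  proof -
    have "\<bar>fst x\<bar> \<le> R" "\<bar>snd x\<bar> \<le> R"
      using R[OF that] norm_fst_le[of "fst x" "snd x"] norm_snd_le[of "snd x" "fst x"] by auto
    then show ?thesis using ab cd by (auto intro!: floor_mono divide_right_mono)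
  qed
  then have "B \<subseteq> (\<Union>p\<in>?J. cell p)" using mem_cell_iff by blast
  with that[of ?J] show ?thesis by simp
qed

section \<open>Fibres of the folding map and the area formula\<close>

text \<open>The sum of \<open>f\<close> over the preimages of \<open>y\<close> under the folding, as
  far as they lie in cells from \<open>J\<close>. The indicator discards a branch whose value leaves
  its own cell, so no preimage is counted twice.\<close>

definition unfold_sum :: "(int \<times> int) set \<Rightarrow> (pt \<Rightarrow> ennreal) \<Rightarrow> pt \<Rightarrow> ennreal" where
  "unfold_sum J f y = (\<Sum>p\<in>J. indicator (cell p) (unf p y) * f (unf p y))"

lemma unfold_sum_measurable [measurable]:
  assumes [measurable]: "f \<in> borel_measurable borel"
  shows "unfold_sum J f \<in> borel_measurable borel"
  unfolding unfold_sum_def[abs_def] by measurable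

text \<open>Preimages correspond to the cells containing them, as each point lies in exactly one
  cell. The counting function in \<open>refl_meas\<close> thereby becomes a finite sum of functions
  that are measurable for Borel \<open>B\<close>.\<close>

lemma card_fibre:
  assumes J: "finite J" "B \<subseteq> (\<Union>p\<in>J. cell p)"
  shows "of_nat (card {x \<in> B. foldmap \<theta> x = y}) = unfold_sum J (indicator B) y"
proof -
  let ?P = "{p \<in> J. unf p y \<in> cell p \<and> unf p y \<in> B}"
  have "bij_betw (\<lambda>p. unf p y) ?P {x \<in> B. foldmap \<theta> x = y}"
    unfolding bij_betw_def
  proof (intro conjI inj_onI equalityI subsetI)
    fix p q assume "p \<in> ?P" "q \<in> ?P" "unf p y = unf q y"
    then show "p = q" using mem_cell_iff by auto
  next
    fix x assume "x \<in> (\<lambda>p. unf p y) ` ?P"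
    then obtain p where "x = unf p y" "unf p y \<in> cell p" "unf p y \<in> B" by blast
    then show "x \<in> {x \<in> B. foldmap \<theta> x = y}" using foldmap_eq_iff_on_cell[of x p y] by simp
  next
    fix x assume x: "x \<in> {x \<in> B. foldmap \<theta> x = y}"
    then obtain p where "p \<in> J" "x \<in> cell p" using J(2) by auto
    moreover from this x have "x = unf p y" using foldmap_eq_iff_on_cell[of x p y] by simp
    ultimately show "x \<in> (\<lambda>p. unf p y) ` ?P" using x by auto
  qed
  then have eq: "card {x \<in> B. foldmap \<theta> x = y} = card ?P" by (rule bij_betw_same_card[symmetric])
  have "of_nat (card ?P) = (\<Sum>p\<in>J. if unf p y \<in> cell p \<and> unf p y \<in> B then 1 else (0::ennreal))"
    using J(1) by (simp add: sum.If_cases Int_def)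
  also have "\<dots> = unfold_sum J (indicator B) y"
    unfolding unfold_sum_def by (intro sum.cong refl) (simp add: indicator_def)
  finally show ?thesis unfolding eq .
qed

lemma nn_integral_unf:
  assumes [measurable]: "G \<in> borel_measurable borel"
  shows "(\<integral>\<^sup>+y. G (unf p y) \<partial>lborel) = (\<integral>\<^sup>+x. G x \<partial>lborel)"
  unfolding unf_def unfold_int_def
  by (cases "even (fst p)"; cases "even (snd p)"; simp only: if_True if_False)
     (rule nn_integral_lborel_pair_flip; simp)+

text \<open>On each cell the folding is an isometry with inverse \<open>unf p\<close>, so every cell
  contributes a change of variables with Jacobian 1. By the support condition the indicators of the
  cells in \<open>J\<close> sum to 1 wherever \<open>f\<close> is nonzero.\<close>

lemma area_formula:
  assumes J: "finite J" "\<And>x. f x \<noteq> 0 \<Longrightarrow> x \<in> (\<Union>p\<in>J. cell p)"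
    and [measurable]: "f \<in> borel_measurable borel" "g \<in> borel_measurable borel"
  shows "(\<integral>\<^sup>+x. f x * g (foldmap \<theta> x) \<partial>lborel) = (\<integral>\<^sup>+y. unfold_sum J f y * g y \<partial>lborel)"
proof -
  let ?G = "\<lambda>p x. indicator (cell p) x * f x * g (foldmap \<theta> x)"
  have eq: "(\<Sum>p\<in>J. indicator (cell p) x * f x) = f x" for x
  proof (cases "f x = 0")
    case False
    let ?i = "(\<lfloor>(fst x - a) / (b - a)\<rfloor>, \<lfloor>(snd x - c) / (d - c)\<rfloor>)"
    have "?i \<in> J" using J(2)[OF False] by (simp add: mem_cell_iff)
    moreover have "(\<Sum>p\<in>J. indicator (cell p) x * f x) = (\<Sum>p\<in>J. if ?i = p then f x else 0)"
      by (intro sum.cong refl) (simp add: mem_cell_iff indicator_def eq_commute)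
    ultimately show ?thesis using J(1) by simp
  qed simp
  have "(\<integral>\<^sup>+x. f x * g (foldmap \<theta> x) \<partial>lborel) = (\<integral>\<^sup>+x. (\<Sum>p\<in>J. ?G p x) \<partial>lborel)"
  proof (rule nn_integral_cong)
    fix x
    show "f x * g (foldmap \<theta> x) = (\<Sum>p\<in>J. ?G p x)"
      by (subst eq[symmetric]) (rule sum_distrib_right)
  qed
  also have "\<dots> = (\<Sum>p\<in>J. \<integral>\<^sup>+x. ?G p x \<partial>lborel)" by (rule nn_integral_sum) measurable
  also have "\<dots> = (\<Sum>p\<in>J. \<integral>\<^sup>+y. ?G p (unf p y) \<partial>lborel)"
    by (intro sum.cong refl nn_integral_unf[symmetric]) measurable
  also have "\<dots> = (\<Sum>p\<in>J. \<integral>\<^sup>+y. indicator (cell p) (unf p y) * f (unf p y) * g y \<partial>lborel)"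
  proof (intro sum.cong refl nn_integral_cong)
    fix p y
    show "?G p (unf p y) = indicator (cell p) (unf p y) * f (unf p y) * g y"
      using foldmap_eq_iff_on_cell[of "unf p y" p y] by (cases "unf p y \<in> cell p") auto
  qed
  also have "\<dots> = (\<integral>\<^sup>+y. (\<Sum>p\<in>J. indicator (cell p) (unf p y) * f (unf p y) * g y) \<partial>lborel)"
    by (rule nn_integral_sum[symmetric]) measurable
  finally show ?thesis by (simp add: unfold_sum_def sum_distrib_right)
qed

text \<open>Bridges a mismatch: the folding takes values in the closed rectangle, while the
  available bounds concern the open one.\<close>

lemma null_boundary: "closure \<theta> - \<theta> \<in> null_sets lborel"
proof -
  have "closure \<theta> = cbox (a, c) (b, d)" by (simp add: closure_\<theta> cbox_Pair_eq)
  moreover have "\<theta> = box (a, c) (b, d)" by (auto simp: box_def Basis_prod_def)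
  ultimately show ?thesis using null_sets_cbox_Diff_box[of "(a, c)" "(b, d)"] by metis
qed

text \<open>In the ball every fibre has at most \<open>card J\<close> points. The constant depends
  on \<open>R\<close> but not on \<open>g\<close>, so bounds on the rectangle yield local bounds for
  reflected functions.\<close>

lemma nn_integral_foldmap_le:
  obtains M :: nat where "\<And>g. g \<in> borel_measurable borel \<Longrightarrow>
    (\<integral>\<^sup>+x. g (foldmap \<theta> x) * indicator (ball 0 R) x \<partial>lborel) \<le> of_nat M * (\<integral>\<^sup>+y. g y * indicator \<theta> y \<partial>lborel)"
proof -
  obtain J where J: "finite J" "ball (0::pt) R \<subseteq> (\<Union>p\<in>J. cell p)"
    using finite_cells_cover[OF bounded_ball] by blast
  show ?thesis
  proof (rule that[of "card J"])
    fix g :: "pt \<Rightarrow> ennreal" assume [measurable]: "g \<in> borel_measurable borel"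
    let ?g = "\<lambda>y. g y * indicator (closure \<theta>) y"
    have "(\<integral>\<^sup>+x. g (foldmap \<theta> x) * indicator (ball 0 R) x \<partial>lborel)
      = (\<integral>\<^sup>+x. indicator (ball 0 R) x * ?g (foldmap \<theta> x) \<partial>lborel)"
      using foldmap_in by (intro nn_integral_cong) (simp add: mult.commute)
    also have "\<dots> = (\<integral>\<^sup>+y. unfold_sum J (indicator (ball 0 R)) y * ?g y \<partial>lborel)"
      using J by (intro area_formula) (auto simp: indicator_eq_0_iff)
    also have "\<dots> \<le> (\<integral>\<^sup>+y. of_nat (card J) * ?g y \<partial>lborel)"
    proof (intro nn_integral_mono mult_right_mono)
      fix y
      have "unfold_sum J (indicator (ball 0 R)) y \<le> (\<Sum>p\<in>J. 1)"
        unfolding unfold_sum_def by (intro sum_mono) (simp add: indicator_def)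
      then show "unfold_sum J (indicator (ball 0 R)) y \<le> of_nat (card J)" by simp
    qed simp
    also have "\<dots> = of_nat (card J) * (\<integral>\<^sup>+y. ?g y \<partial>lborel)" by (rule nn_integral_cmult) measurable
    also have "(\<integral>\<^sup>+y. ?g y \<partial>lborel) = (\<integral>\<^sup>+y. g y * indicator \<theta> y \<partial>lborel)"
      using closure_subset[of \<theta>]
      by (intro nn_integral_cong_AE AE_I'[OF null_boundary]) (auto simp: indicator_def)
    finally show "(\<integral>\<^sup>+x. g (foldmap \<theta> x) * indicator (ball 0 R) x \<partial>lborel) \<le> of_nat (card J) * (\<integral>\<^sup>+y. g y * indicator \<theta> y \<partial>lborel)" .
  qed
qed

end

subsection \<open>Reflection of functions and measures\<close>

text \<open>Passing to the larger of the two summands gives the constant 2 ^ p for every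
  \<open>p\<close> without convexity of the power.\<close>

lemma power_abs_diff_le:
  fixes x y z :: real
  shows "\<bar>x - y\<bar> ^ p \<le> 2 ^ p * (\<bar>z - x\<bar> ^ p + \<bar>z - y\<bar> ^ p)"
proof -
  let ?m = "max \<bar>z - x\<bar> \<bar>z - y\<bar>"
  have "\<bar>x - y\<bar> \<le> \<bar>z - x\<bar> + \<bar>z - y\<bar>" by linarith
  also have "\<dots> \<le> 2 * ?m" by (auto simp: max_def)
  finally have "\<bar>x - y\<bar> \<le> 2 * ?m" .
  then have "\<bar>x - y\<bar> ^ p \<le> (2 * ?m) ^ p" by (intro power_mono) auto
  also have "\<dots> = 2 ^ p * ?m ^ p" by (simp add: power_mult_distrib)
  also have "\<dots> \<le> 2 ^ p * (\<bar>z - x\<bar> ^ p + \<bar>z - y\<bar> ^ p)"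
    by (intro mult_left_mono) (auto simp: max_def)
  finally show ?thesis .
qed

lemma norm_pair_le: "norm (x :: pt) \<le> \<bar>fst x\<bar> + \<bar>snd x\<bar>"
  by (cases x) (simp add: norm_Pair sqrt_sum_squares_le_sum_abs)

lemma abs_fst_snd_le_norm: "\<bar>fst (x :: pt)\<bar> \<le> norm x" "\<bar>snd x\<bar> \<le> norm x"
  using norm_fst_le[of "fst x" "snd x"] norm_snd_le[of "snd x" "fst x"] by auto

lemma emeasure_lborel_rect:
  assumes "a \<le> b" "c \<le> d"
  shows "emeasure lborel ({a<..<b} \<times> {c<..<d} :: pt set) = ennreal ((b - a) * (d - c))"
    "emeasure lborel ({a..b} \<times> {c..d} :: pt set) = ennreal ((b - a) * (d - c))"
  using assms by (simp_all add: lborel_prod[symmetric] lborel.emeasure_pair_measure_Times ennreal_mult)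

section \<open>Difference quotients and oscillation on a rectangle\<close>

text \<open>Both end points have to lie in \<open>S\<close>, so nothing is asked of \<open>f\<close>
  outside \<open>S\<close> or of jumps across its boundary.\<close>

definition diffq_on :: "nat \<Rightarrow> pt set \<Rightarrow> (pt \<Rightarrow> real) \<Rightarrow> bool" where
  "diffq_on p S f \<longleftrightarrow> (\<exists>C \<delta>. C \<ge> 0 \<and> \<delta> > 0 \<and> (\<forall>h. norm h < \<delta> \<longrightarrow>
     (\<integral>\<^sup>+x. ennreal (\<bar>f (x + h) - f x\<bar> ^ p) * indicator S (x + h) * indicator S x \<partial>lborel)
       \<le> ennreal (C * norm h ^ p)))"

text \<open>An unnormalised mean oscillation of \<open>f\<close> around \<open>y\<close>. The steps
  range over a square, whose area 4 r^2 enters the later constants.\<close>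

definition local_osc :: "nat \<Rightarrow> pt set \<Rightarrow> (pt \<Rightarrow> real) \<Rightarrow> real \<Rightarrow> pt \<Rightarrow> ennreal" where
  "local_osc p S f r y = (\<integral>\<^sup>+s. ennreal (\<bar>f (y + s) - f y\<bar> ^ p) * indicator S (y + s)
     * indicator ({- r..r} \<times> {- r..r}) s \<partial>lborel)"

lemma local_osc_measurable [measurable]:
  assumes [measurable]: "f \<in> borel_measurable borel" "S \<in> sets borel"
  shows "local_osc p S f r \<in> borel_measurable borel"
proof -
  have [measurable]: "({- r..r} \<times> {- r..r} :: pt set) \<in> sets borel" by (intro borel_Times) auto
  show ?thesis unfolding local_osc_def by measurable
qed

text \<open>By Tonelli the step may be fixed first. Its norm is at most 2 r, so
  \<open>C * (2 * r) ^ p\<close> bounds the inner integral, and the steps fill an area of 4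
  r^2.\<close>

lemma local_osc_integral_le:
  assumes [measurable]: "f \<in> borel_measurable borel" "S \<in> sets borel"
    and C: "C \<ge> 0" "\<And>h. norm h < \<delta> \<Longrightarrow>
     (\<integral>\<^sup>+x. ennreal (\<bar>f (x + h) - f x\<bar> ^ p) * indicator S (x + h) * indicator S x \<partial>lborel) \<le> ennreal (C * norm h ^ p)"
    and r: "r > 0" "2 * r < \<delta>"
  shows "(\<integral>\<^sup>+y. local_osc p S f r y * indicator S y \<partial>lborel) \<le> ennreal (4 * r\<^sup>2 * (C * (2 * r) ^ p))"
proof -
  let ?Q = "{- r..r} \<times> {- r..r} :: pt set"
  have [measurable]: "?Q \<in> sets borel" by (intro borel_Times) auto
  let ?k = "\<lambda>y s. ennreal (\<bar>f (y + s) - f y\<bar> ^ p) * indicator S (y + s) * indicator ?Q s * indicator S y"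
  have "(\<integral>\<^sup>+y. local_osc p S f r y * indicator S y \<partial>lborel) = (\<integral>\<^sup>+y. \<integral>\<^sup>+s. ?k y s \<partial>lborel \<partial>lborel)"
    unfolding local_osc_def by (intro nn_integral_cong nn_integral_multc[symmetric]) measurable
  also have "\<dots> = (\<integral>\<^sup>+s. \<integral>\<^sup>+y. ?k y s \<partial>lborel \<partial>lborel)"
    by (rule lborel_pair.Fubini') measurable
  also have "\<dots> \<le> (\<integral>\<^sup>+s. ennreal (C * (2 * r) ^ p) * indicator ?Q s \<partial>lborel)"
  proof (rule nn_integral_mono)
    fix s :: pt
    show "(\<integral>\<^sup>+y. ?k y s \<partial>lborel) \<le> ennreal (C * (2 * r) ^ p) * indicator ?Q s"
    proof (cases "s \<in> ?Q")
      case True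
      then have "\<bar>fst s\<bar> \<le> r" "\<bar>snd s\<bar> \<le> r" by (auto simp: abs_le_iff)
      then have ns: "norm s \<le> 2 * r" using norm_pair_le[of s] by linarith
      have "(\<integral>\<^sup>+y. ?k y s \<partial>lborel) = (\<integral>\<^sup>+y. ennreal (\<bar>f (y + s) - f y\<bar> ^ p) * indicator S (y + s) * indicator S y \<partial>lborel)"
        using True by simp
      also have "\<dots> \<le> ennreal (C * norm s ^ p)" using ns r by (intro C) simp
      also have "\<dots> \<le> ennreal (C * (2 * r) ^ p)"
        using ns C(1) by (intro ennreal_leI mult_left_mono power_mono) auto
      finally show ?thesis using True by simp
    qed simp
  qed
  also have "\<dots> = ennreal (C * (2 * r) ^ p) * emeasure lborel ?Q"
    by (rule nn_integral_cmult_indicator) simp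
  also have "emeasure lborel ?Q = ennreal (4 * r\<^sup>2)"
    using r by (subst emeasure_lborel_rect) (auto simp: power2_eq_square)
  finally show ?thesis using C(1) r by (simp add: ennreal_mult[symmetric] mult.commute)
qed

context rectangle
begin

text \<open>In each coordinate an interval of length \<open>r\<close> starting or ending at
  \<open>y\<close> fits into a side of length at least 2 r. The square therefore keeps its full area
  even when \<open>y\<close> is on an edge or in a corner.\<close>

lemma open_sub_rectangle:
  assumes y: "y \<in> closure \<theta>" and r: "0 < r" "2 * r \<le> b - a" "2 * r \<le> d - c"
  obtains Z where "Z \<subseteq> \<theta>" "Z \<in> sets borel" "emeasure lborel Z = ennreal (r\<^sup>2)"
    "\<And>z. z \<in> Z \<Longrightarrow> \<bar>fst z - fst y\<bar> \<le> r \<and> \<bar>snd z - snd y\<bar> \<le> r"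
proof
  define u v where "u = (if fst y + r \<le> b then fst y else fst y - r)"
    and "v = (if snd y + r \<le> d then snd y else snd y - r)"
  let ?Z = "{u<..<u + r} \<times> {v<..<v + r}"
  have y': "a \<le> fst y" "fst y \<le> b" "c \<le> snd y" "snd y \<le> d" using y by (auto simp: closure_\<theta> mem_Times_iff)
  show "?Z \<subseteq> \<theta>" using y' r by (auto simp: u_def v_def split: if_splits)
  show "?Z \<in> sets borel" by (intro borel_Times) auto
  show "emeasure lborel ?Z = ennreal (r\<^sup>2)"
    using r by (subst emeasure_lborel_rect) (auto simp: power2_eq_square)
  show "\<bar>fst z - fst y\<bar> \<le> r \<and> \<bar>snd z - snd y\<bar> \<le> r" if "z \<in> ?Z" for z
    using that r by (auto simp: u_def v_def abs_le_iff split: if_splits)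
qed

text \<open>The values at two nearby points of the closed rectangle are compared through an average over
  nearby points of the open rectangle; thus no case distinction on how the segment between \<open>x\<close> and
  \<open>x + h\<close> crosses the reflection lines is needed.\<close>

lemma local_osc_compare:
  assumes [measurable]: "f \<in> borel_measurable borel"
    and y: "y \<in> closure \<theta>" and r: "0 < r" "2 * r \<le> b - a" "2 * r \<le> d - c"
    and yy': "\<bar>fst y - fst y'\<bar> \<le> r" "\<bar>snd y - snd y'\<bar> \<le> r"
  shows "ennreal (r\<^sup>2) * ennreal (\<bar>f y - f y'\<bar> ^ p)
    \<le> ennreal (2 ^ p) * (local_osc p \<theta> f (2 * r) y + local_osc p \<theta> f (2 * r) y')"
proof -
  obtain Z where Z: "Z \<subseteq> \<theta>" "Z \<in> sets borel" "emeasure lborel Z = ennreal (r\<^sup>2)"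
    "\<And>z. z \<in> Z \<Longrightarrow> \<bar>fst z - fst y\<bar> \<le> r \<and> \<bar>snd z - snd y\<bar> \<le> r"
    using open_sub_rectangle[OF y r] by blast
  have [measurable]: "Z \<in> sets borel" "\<theta> \<in> sets borel" using Z by (auto intro!: borel_Times)
  \<comment> \<open>Points of \<open>Z\<close> are within \<open>r\<close> of \<open>y\<close> and
    hence within 2 r of \<open>y'\<close> in each coordinate; this is why both oscillations have
    radius 2 r.\<close>
  have osc: "(\<integral>\<^sup>+z. ennreal (\<bar>f z - f v\<bar> ^ p) * indicator Z z \<partial>lborel) \<le> local_osc p \<theta> f (2 * r) v"
    if v: "\<And>z. z \<in> Z \<Longrightarrow> \<bar>fst z - fst v\<bar> \<le> 2 * r \<and> \<bar>snd z - snd v\<bar> \<le> 2 * r" for v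
  proof -
    have "(\<integral>\<^sup>+z. ennreal (\<bar>f z - f v\<bar> ^ p) * indicator Z z \<partial>lborel)
      = (\<integral>\<^sup>+s. ennreal (\<bar>f (s + v) - f v\<bar> ^ p) * indicator Z (s + v) \<partial>lborel)"
      by (rule nn_integral_lborel_shift[where f="\<lambda>z. ennreal (\<bar>f z - f v\<bar> ^ p) * indicator Z z", symmetric]) measurable
    also have "\<dots> \<le> local_osc p \<theta> f (2 * r) v"
      unfolding local_osc_def
    proof (rule nn_integral_mono)
      fix s
      have "s \<in> {- (2 * r)..2 * r} \<times> {- (2 * r)..2 * r}" if "s + v \<in> Z"
        using v[OF that] by (auto simp: abs_le_iff mem_Times_iff)
      then show "ennreal (\<bar>f (s + v) - f v\<bar> ^ p) * indicator Z (s + v)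
         \<le> ennreal (\<bar>f (v + s) - f v\<bar> ^ p) * indicator \<theta> (v + s) * indicator ({- (2 * r)..2 * r} \<times> {- (2 * r)..2 * r}) s"
        using subsetD[OF Z(1), of "s + v"] by (cases "s + v \<in> Z") (simp_all add: add.commute)
    qed
    finally show ?thesis .
  qed
  have "ennreal (r\<^sup>2) * ennreal (\<bar>f y - f y'\<bar> ^ p) = (\<integral>\<^sup>+z. ennreal (\<bar>f y - f y'\<bar> ^ p) * indicator Z z \<partial>lborel)"
    by (subst nn_integral_cmult_indicator) (simp_all add: Z mult.commute)
  also have "\<dots> \<le> (\<integral>\<^sup>+z. ennreal (2 ^ p) * (ennreal (\<bar>f z - f y\<bar> ^ p) * indicator Z z + ennreal (\<bar>f z - f y'\<bar> ^ p) * indicator Z z) \<partial>lborel)"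
  proof (rule nn_integral_mono)
    fix z
    have "ennreal (\<bar>f y - f y'\<bar> ^ p) \<le> ennreal (2 ^ p * (\<bar>f z - f y\<bar> ^ p + \<bar>f z - f y'\<bar> ^ p))"
      by (intro ennreal_leI power_abs_diff_le)
    also have "\<dots> = ennreal (2 ^ p) * (ennreal (\<bar>f z - f y\<bar> ^ p) + ennreal (\<bar>f z - f y'\<bar> ^ p))"
      by (simp only: ennreal_mult' ennreal_plus zero_le_power abs_ge_zero zero_le_numeral)
    finally show "ennreal (\<bar>f y - f y'\<bar> ^ p) * indicator Z z
      \<le> ennreal (2 ^ p) * (ennreal (\<bar>f z - f y\<bar> ^ p) * indicator Z z + ennreal (\<bar>f z - f y'\<bar> ^ p) * indicator Z z)"
      by (cases "z \<in> Z") simp_all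
  qed
  also have "\<dots> = ennreal (2 ^ p) * ((\<integral>\<^sup>+z. ennreal (\<bar>f z - f y\<bar> ^ p) * indicator Z z \<partial>lborel)
      + (\<integral>\<^sup>+z. ennreal (\<bar>f z - f y'\<bar> ^ p) * indicator Z z \<partial>lborel))"
    by (subst nn_integral_cmult; (subst nn_integral_add)?; measurable)
  also have "\<dots> \<le> ennreal (2 ^ p) * (local_osc p \<theta> f (2 * r) y + local_osc p \<theta> f (2 * r) y')"
  proof (intro mult_left_mono add_mono osc)
    fix z assume "z \<in> Z"
    then have "\<bar>fst z - fst y\<bar> \<le> r \<and> \<bar>snd z - snd y\<bar> \<le> r" by (rule Z)
    then show "\<bar>fst z - fst y\<bar> \<le> 2 * r \<and> \<bar>snd z - snd y\<bar> \<le> 2 * r"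
      "\<bar>fst z - fst y'\<bar> \<le> 2 * r \<and> \<bar>snd z - snd y'\<bar> \<le> 2 * r"
      using yy' r(1) by linarith+
  qed simp
  finally show ?thesis .
qed

text \<open>Take r = |h|. Folding is 1-Lipschitz, so both folded points are within \<open>r\<close>
  in each coordinate, and \<open>local_osc_compare\<close> bounds r^2 times the integrand by two
  oscillations. Their integrals are of order r^2 r^p; dividing by r^2 leaves |h|^p.\<close>

proposition diffq_reflect:
  assumes f[measurable]: "f \<in> borel_measurable borel" and D: "diffq_on p \<theta> f" and p: "p > 0"
  shows "diffq_loc p (refl_fun \<theta> f)"
  unfolding diffq_loc_def refl_fun_def
proof
  fix R
  obtain C \<delta> where C: "C \<ge> 0" "\<delta> > 0" "\<And>h. norm h < \<delta> \<Longrightarrow>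
     (\<integral>\<^sup>+x. ennreal (\<bar>f (x + h) - f x\<bar> ^ p) * indicator \<theta> (x + h) * indicator \<theta> x \<partial>lborel) \<le> ennreal (C * norm h ^ p)"
    using D unfolding diffq_on_def by blast
  have [measurable]: "\<theta> \<in> sets borel" by (auto intro!: borel_Times)
  obtain M :: nat where M: "\<And>g. g \<in> borel_measurable borel \<Longrightarrow>
    (\<integral>\<^sup>+x. g (foldmap \<theta> x) * indicator (ball 0 (R + 1)) x \<partial>lborel) \<le> of_nat M * (\<integral>\<^sup>+y. g y * indicator \<theta> y \<partial>lborel)"
    using nn_integral_foldmap_le by blast
  \<comment> \<open>The bound 1 pays for enlarging the ball to R + 1, \<delta> / 4 makes the
    oscillation radius 2 r admissible (it needs 4 r < \<delta>), and the half sides are what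
    \<open>local_osc_compare\<close> requires.\<close>
  define d' where "d' = min 1 (min (\<delta> / 4) (min ((b - a) / 2) ((d - c) / 2)))"
  \<comment> \<open>2 ^ p comes from \<open>power_abs_diff_le\<close>, 2 M from two oscillation
    terms with the factor \<open>M\<close> each, and 16 (C 4^p) from 4 (2 r)^2 C (4 r)^p.\<close>
  define K where "K = 2 ^ p * (2 * M * (16 * (C * 4 ^ p)))"
  have "d' > 0" "K \<ge> 0" using C ab cd by (auto simp: d'_def K_def)
  have "(\<integral>\<^sup>+x. ennreal (\<bar>f (foldmap \<theta> (x + h)) - f (foldmap \<theta> x)\<bar> ^ p) * indicator (ball 0 R) x \<partial>lborel)
      \<le> ennreal (K * norm h ^ p)" (is "?I \<le> _") if h: "norm h < d'" for h
  proof (cases "h = 0")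
    \<comment> \<open>At h = 0 both sides vanish because 0 ^ p = 0 for positive p.\<close>
    case True
    then show ?thesis using p by (simp add: power_0_left)
  next
    case False
    define r where "r = norm h"
    have r: "r > 0" "r < 1" "2 * r \<le> b - a" "2 * r \<le> d - c" "2 * (2 * r) < \<delta>"
      using False h by (auto simp: r_def d'_def)
    let ?\<Phi> = "local_osc p \<theta> f (2 * r)"
    define B where "B = 4 * (2 * r)\<^sup>2 * (C * (2 * (2 * r)) ^ p)"
    have B0: "B \<ge> 0" using C(1) r(1) by (simp add: B_def)
    have "B = 4 * (2 * r)\<^sup>2 * (C * (4 * r) ^ p)" by (simp add: B_def)
    also have "\<dots> = 16 * (C * 4 ^ p) * (r\<^sup>2 * r ^ p)"
      by (simp add: power_mult_distrib)
    finally have BK: "2 ^ p * (real M * B + real M * B) = r\<^sup>2 * (K * r ^ p)"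
      by (simp add: K_def)
    have int\<Phi>: "(\<integral>\<^sup>+y. ?\<Phi> y * indicator \<theta> y \<partial>lborel) \<le> ennreal B"
      unfolding B_def by (rule local_osc_integral_le[OF _ _ C(1,3)]) (use r in auto)
    have \<Phi>0: "(\<integral>\<^sup>+x. ?\<Phi> (foldmap \<theta> x) * indicator (ball 0 (R + 1)) x \<partial>lborel) \<le> of_nat M * ennreal B"
      by (rule order_trans[OF M mult_left_mono[OF int\<Phi>]]) auto
    have "(\<integral>\<^sup>+x. ?\<Phi> (foldmap \<theta> (x + h)) * indicator (ball 0 R) x \<partial>lborel)
      \<le> (\<integral>\<^sup>+x. ?\<Phi> (foldmap \<theta> (x + h)) * indicator (ball 0 (R + 1)) (x + h) \<partial>lborel)"
    proof (intro nn_integral_mono mult_left_mono)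
      fix x show "indicator (ball 0 R) x \<le> (indicator (ball 0 (R + 1)) (x + h) :: ennreal)"
        using norm_triangle_ineq[of x h] r(2) by (simp add: indicator_def r_def)
    qed simp
    also have "\<dots> = (\<integral>\<^sup>+x. ?\<Phi> (foldmap \<theta> x) * indicator (ball 0 (R + 1)) x \<partial>lborel)"
      by (rule nn_integral_lborel_shift[where f="\<lambda>x. ?\<Phi> (foldmap \<theta> x) * indicator (ball 0 (R + 1)) x"]) measurable
    also note \<Phi>0
    finally have \<Phi>h: "(\<integral>\<^sup>+x. ?\<Phi> (foldmap \<theta> (x + h)) * indicator (ball 0 R) x \<partial>lborel) \<le> of_nat M * ennreal B" .
    have "(\<integral>\<^sup>+x. ?\<Phi> (foldmap \<theta> x) * indicator (ball 0 R) x \<partial>lborel) \<le> (\<integral>\<^sup>+x. ?\<Phi> (foldmap \<theta> x) * indicator (ball 0 (R + 1)) x \<partial>lborel)"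
      by (intro nn_integral_mono mult_left_mono) (auto simp: indicator_def)
    note \<Phi>0' = order_trans[OF this \<Phi>0]
    have "ennreal (r\<^sup>2) * ?I = (\<integral>\<^sup>+x. ennreal (r\<^sup>2) * (ennreal (\<bar>f (foldmap \<theta> (x + h)) - f (foldmap \<theta> x)\<bar> ^ p) * indicator (ball 0 R) x) \<partial>lborel)"
      by (rule nn_integral_cmult[symmetric]) measurable
    also have "\<dots> \<le> (\<integral>\<^sup>+x. ennreal (2 ^ p) * (?\<Phi> (foldmap \<theta> (x + h)) * indicator (ball 0 R) x + ?\<Phi> (foldmap \<theta> x) * indicator (ball 0 R) x) \<partial>lborel)"
    proof (rule nn_integral_mono)
      fix x
      have "\<bar>fst (foldmap \<theta> (x + h)) - fst (foldmap \<theta> x)\<bar> \<le> r" "\<bar>snd (foldmap \<theta> (x + h)) - snd (foldmap \<theta> x)\<bar> \<le> r"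
        using fold_int_Lipschitz[OF ab, of "fst (x + h)" "fst x"] fold_int_Lipschitz[OF cd, of "snd (x + h)" "snd x"]
          abs_fst_snd_le_norm[of h] by (simp_all add: foldmap_eq r_def)
      from local_osc_compare[OF f foldmap_in r(1,3,4) this, of p]
      have "ennreal (r\<^sup>2) * ennreal (\<bar>f (foldmap \<theta> (x + h)) - f (foldmap \<theta> x)\<bar> ^ p)
        \<le> ennreal (2 ^ p) * (?\<Phi> (foldmap \<theta> (x + h)) + ?\<Phi> (foldmap \<theta> x))" .
      then show "ennreal (r\<^sup>2) * (ennreal (\<bar>f (foldmap \<theta> (x + h)) - f (foldmap \<theta> x)\<bar> ^ p) * indicator (ball 0 R) x)
        \<le> ennreal (2 ^ p) * (?\<Phi> (foldmap \<theta> (x + h)) * indicator (ball 0 R) x + ?\<Phi> (foldmap \<theta> x) * indicator (ball 0 R) x)"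
        by (cases "x \<in> ball 0 R") simp_all
    qed
    also have "\<dots> = ennreal (2 ^ p) * ((\<integral>\<^sup>+x. ?\<Phi> (foldmap \<theta> (x + h)) * indicator (ball 0 R) x \<partial>lborel) + (\<integral>\<^sup>+x. ?\<Phi> (foldmap \<theta> x) * indicator (ball 0 R) x \<partial>lborel))"
      by (subst nn_integral_cmult; (subst nn_integral_add)?; measurable)
    also have "\<dots> \<le> ennreal (2 ^ p) * (of_nat M * ennreal B + of_nat M * ennreal B)"
      by (intro mult_left_mono add_mono \<Phi>h \<Phi>0') simp
    also have "\<dots> = ennreal (2 ^ p * (real M * B + real M * B))"
      by (simp only: ennreal_mult' ennreal_plus mult_nonneg_nonneg of_nat_0_le_iff zero_le_power zero_le_numeral B0 ennreal_of_nat_eq_real_of_nat)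
    also have "\<dots> = ennreal (r\<^sup>2 * (K * r ^ p))"
      unfolding BK ..
    also have "\<dots> = ennreal (r\<^sup>2) * ennreal (K * r ^ p)" by (rule ennreal_mult') simp
    finally have "ennreal (r\<^sup>2) * ?I \<le> ennreal (r\<^sup>2) * ennreal (K * r ^ p)" .
    moreover have "ennreal (r\<^sup>2) \<noteq> 0" using r(1) by (simp add: ennreal_eq_0_iff)
    ultimately show ?thesis unfolding r_def[symmetric]
      using ennreal_mult_le_mult_iff[OF _ ennreal_neq_top] by blast
  qed
  then show "\<exists>C d. C \<ge> 0 \<and> d > 0 \<and> (\<forall>h. norm h < d \<longrightarrow>
     (\<integral>\<^sup>+x. ennreal (\<bar>f (foldmap \<theta> (x + h)) - f (foldmap \<theta> x)\<bar> ^ p) * indicator (ball 0 R) x \<partial>lborel) \<le> ennreal (C * norm h ^ p))"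
    using \<open>d' > 0\<close> \<open>K \<ge> 0\<close> by blast
qed

lemma L2loc_refl_fun:
  assumes [measurable]: "f \<in> borel_measurable borel"
    and f: "(\<integral>\<^sup>+x. ennreal ((f x)\<^sup>2) * indicator \<theta> x \<partial>lborel) < \<infinity>"
  shows "L2loc (refl_fun \<theta> f)"
  unfolding L2loc_def refl_fun_def
proof (intro conjI allI)
  show "(\<lambda>x. f (foldmap \<theta> x)) \<in> borel_measurable borel" by measurable
  fix R
  obtain M :: nat where M: "\<And>g. g \<in> borel_measurable borel \<Longrightarrow>
    (\<integral>\<^sup>+x. g (foldmap \<theta> x) * indicator (ball 0 R) x \<partial>lborel) \<le> of_nat M * (\<integral>\<^sup>+y. g y * indicator \<theta> y \<partial>lborel)"
    using nn_integral_foldmap_le by blast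
  have "(\<integral>\<^sup>+x. ennreal ((f (foldmap \<theta> x))\<^sup>2) * indicator (ball 0 R) x \<partial>lborel)
      \<le> of_nat M * (\<integral>\<^sup>+y. ennreal ((f y)\<^sup>2) * indicator \<theta> y \<partial>lborel)"
    by (rule M) measurable
  also have "\<dots> < \<infinity>" using f by (simp add: ennreal_mult_less_top of_nat_less_top)
  finally show "(\<integral>\<^sup>+x. ennreal ((f (foldmap \<theta> x))\<^sup>2) * indicator (ball 0 R) x \<partial>lborel) < \<infinity>" .
qed

section \<open>Reflected measures\<close>

text \<open>The reflected measure is realised as an image of the product of \<open>m\<close> with a counting measure on
  finitely many cells, which shows that the set function defining it is countably additive.\<close>

lemma refl_meas_nn_integral:
  assumes m: "fin_meas_on S m" and J: "finite J" "closure \<Omega> \<subseteq> (\<Union>p\<in>J. cell p)"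
    and f[measurable]: "f \<in> borel_measurable borel"
  shows "sets (refl_meas \<theta> \<Omega> m) = sets borel"
    "(\<integral>\<^sup>+x. f x \<partial>refl_meas \<theta> \<Omega> m) = (\<integral>\<^sup>+y. unfold_sum J (\<lambda>x. f x * indicator (closure \<Omega>) x) y \<partial>m)"
proof -
  have sets_m[measurable_cong]: "sets m = sets borel" using m by (simp add: fin_meas_on_def)
  interpret m: finite_measure m using m by (simp add: fin_meas_on_def)
  let ?P = "count_space J \<Otimes>\<^sub>M m"
  \<comment> \<open>A pair (p, y) is kept if branch \<open>p\<close> sends \<open>y\<close> into its
    own cell and into closure \<Omega>. For fixed \<open>y\<close> the remaining \<open>p\<close>
    index exactly the preimages of \<open>y\<close> in closure \<Omega>.\<close>
  let ?k = "\<lambda>(p, y). indicator (cell p \<inter> closure \<Omega>) (unf p y) :: ennreal"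
  let ?u = "\<lambda>(p, y). unf p y"
  have [measurable]: "closure \<Omega> \<in> sets borel" by simp
  have cJ: "countable J" using J(1) by (rule countable_finite)
  have u[measurable]: "?u \<in> borel_measurable ?P"
    by (rule measurable_pair_measure_countable1[OF cJ]) (simp, measurable)
  have k[measurable]: "?k \<in> borel_measurable ?P"
    by (rule measurable_pair_measure_countable1[OF cJ]) (simp, measurable)
  define M' where "M' = distr (density ?P ?k) borel ?u"
  have sM: "sets M' = sets borel" "space M' = UNIV" by (auto simp: M'_def)
  have int: "(\<integral>\<^sup>+x. g x \<partial>M') = (\<integral>\<^sup>+y. unfold_sum J (\<lambda>x. g x * indicator (closure \<Omega>) x) y \<partial>m)"
    if g[measurable]: "g \<in> borel_measurable borel" for g
  proof -
    have gu: "(\<lambda>q. g (?u q)) \<in> borel_measurable ?P"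
      using measurable_compose[OF u g] by simp
    have "(\<integral>\<^sup>+x. g x \<partial>M') = (\<integral>\<^sup>+q. ?k q * g (?u q) \<partial>?P)"
      unfolding M'_def by (subst nn_integral_distr; (subst nn_integral_density)?) (use gu in simp_all)
    also have "\<dots> = (\<integral>\<^sup>+p. \<integral>\<^sup>+y. ?k (p, y) * g (?u (p, y)) \<partial>m \<partial>count_space J)"
      by (rule m.nn_integral_fst[symmetric]) (use gu in measurable)
    also have "\<dots> = (\<Sum>p\<in>J. \<integral>\<^sup>+y. indicator (cell p) (unf p y) * (g (unf p y) * indicator (closure \<Omega>) (unf p y)) \<partial>m)"
      using J(1) by (subst nn_integral_count_space_finite) (auto simp: indicator_inter_arith mult_ac intro!: sum.cong nn_integral_cong)
    also have "\<dots> = (\<integral>\<^sup>+y. unfold_sum J (\<lambda>x. g x * indicator (closure \<Omega>) x) y \<partial>m)"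
      unfolding unfold_sum_def by (rule nn_integral_sum[symmetric]) measurable
    finally show ?thesis .
  qed
  \<comment> \<open>\<open>measure_of\<close> only receives a set function; its agreement with the
    genuine measure \<open>M'\<close> on Borel sets is what gives \<open>refl_meas\<close> the
    intended values.\<close>
  have "refl_meas \<theta> \<Omega> m = measure_of UNIV (sets borel) (emeasure M')"
    unfolding refl_meas_def
  proof (rule measure_of_eq)
    fix A :: "pt set" assume "A \<in> sigma_sets UNIV (sets borel)"
    then have A[measurable]: "A \<in> sets borel" using sets.sigma_sets_eq[of "borel :: pt measure"] by simp
    have "emeasure M' A = (\<integral>\<^sup>+x. indicator A x \<partial>M')" using A by (simp add: sM)
    also have "\<dots> = (\<integral>\<^sup>+y. unfold_sum J (\<lambda>x. indicator A x * indicator (closure \<Omega>) x) y \<partial>m)" by (rule int) simp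
    also have "\<dots> = (\<integral>\<^sup>+y. of_nat (card {x \<in> A \<inter> closure \<Omega>. foldmap \<theta> x = y}) \<partial>m)"
    proof (rule nn_integral_cong)
      fix y
      have "(\<lambda>x. indicator A x * indicator (closure \<Omega>) x :: ennreal) = indicator (A \<inter> closure \<Omega>)"
        by (auto simp: indicator_inter_arith)
      then show "unfold_sum J (\<lambda>x. indicator A x * indicator (closure \<Omega>) x) y = of_nat (card {x \<in> A \<inter> closure \<Omega>. foldmap \<theta> x = y})"
        using card_fibre[of J "A \<inter> closure \<Omega>" y] J(1) subset_trans[OF Int_lower2 J(2)] by simp
    qed
    finally show "(\<integral>\<^sup>+y. of_nat (card {x \<in> A \<inter> closure \<Omega>. foldmap \<theta> x = y}) \<partial>m) = emeasure M' A" by simp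
  qed simp
  also have "\<dots> = M'" using measure_of_of_measure[of M'] by (simp add: sM)
  finally have eq: "refl_meas \<theta> \<Omega> m = M'" .
  show "sets (refl_meas \<theta> \<Omega> m) = sets borel" by (simp add: eq sM)
  show "(\<integral>\<^sup>+x. f x \<partial>refl_meas \<theta> \<Omega> m) = (\<integral>\<^sup>+y. unfold_sum J (\<lambda>x. f x * indicator (closure \<Omega>) x) y \<partial>m)"
    unfolding eq by (rule int) fact
qed

lemma finite_measure_refl_meas:
  assumes m: "fin_meas_on S m" and \<Omega>: "bounded \<Omega>"
  shows "finite_measure (refl_meas \<theta> \<Omega> m)" "sets (refl_meas \<theta> \<Omega> m) = sets borel"
proof -
  interpret m: finite_measure m using m by (simp add: fin_meas_on_def)
  obtain J where J: "finite J" "closure \<Omega> \<subseteq> (\<Union>p\<in>J. cell p)"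
    using finite_cells_cover[OF bounded_closure[OF \<Omega>]] by blast
  show s: "sets (refl_meas \<theta> \<Omega> m) = sets borel"
    by (rule refl_meas_nn_integral(1)[OF m J]) (rule borel_measurable_const)
  have sp: "space (refl_meas \<theta> \<Omega> m) = UNIV" using sets_eq_imp_space_eq[OF s] by simp
  have "emeasure (refl_meas \<theta> \<Omega> m) UNIV = (\<integral>\<^sup>+x. 1 \<partial>refl_meas \<theta> \<Omega> m)" by (simp add: sp)
  also have "\<dots> = (\<integral>\<^sup>+y. unfold_sum J (\<lambda>x. 1 * indicator (closure \<Omega>) x) y \<partial>m)"
    by (rule refl_meas_nn_integral(2)[OF m J]) simp
  also have "\<dots> \<le> (\<integral>\<^sup>+y. of_nat (card J) \<partial>m)"
  proof (rule nn_integral_mono)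
    fix y
    have "unfold_sum J (\<lambda>x. 1 * indicator (closure \<Omega>) x) y \<le> (\<Sum>p\<in>J. 1)"
      unfolding unfold_sum_def by (intro sum_mono) (simp add: indicator_def)
    then show "unfold_sum J (\<lambda>x. 1 * indicator (closure \<Omega>) x) y \<le> of_nat (card J)" by simp
  qed
  also have "\<dots> < \<infinity>" by (simp add: ennreal_mult_less_top of_nat_less_top m.emeasure_finite top.not_eq_extremum[symmetric] ennreal_mult_eq_top_iff)
  finally show "finite_measure (refl_meas \<theta> \<Omega> m)"
    by (intro finite_measureI) (simp add: sp)
qed

end

subsection \<open>A smooth bump function\<close>

text \<open>The functions p(t) (1 - t^2)^(-k) exp(- 1 / (1 - t^2)), extended by 0, form a family
  closed under differentiation. Polynomial and exponent are parameters so that smoothness can be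
  proved by staying in the family.\<close>

definition bump_term :: "real poly \<Rightarrow> nat \<Rightarrow> real \<Rightarrow> real" where
  "bump_term p k t = (if \<bar>t\<bar> < 1 then poly p t * inverse (1 - t\<^sup>2) ^ k * exp (- inverse (1 - t\<^sup>2)) else 0)"

lemma DERIV_zero_if_quadratic_bound:
  fixes f :: "real \<Rightarrow> real"
  assumes "\<And>x. \<bar>f x\<bar> \<le> C * (x - t)\<^sup>2"
  shows "(f has_real_derivative 0) (at t)"
proof -
  have ft: "f t = 0" using assms[of t] by simp
  have "((\<lambda>h. (f (t + h) - f t) / h) \<longlongrightarrow> 0) (at 0)"
  proof (rule Lim_null_comparison)
    have "norm ((f (t + h) - f t) / h) \<le> C * \<bar>h\<bar>" if "h \<noteq> 0" for h
      using assms[of "t + h"] that ft by (simp add: divide_le_eq abs_divide power2_eq_square mult.assoc abs_mult[symmetric])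
    then show "\<forall>\<^sub>F h in at 0. norm ((f (t + h) - f t) / h) \<le> C * \<bar>h\<bar>"
      by (auto simp: eventually_at_filter)
    show "((\<lambda>h. C * \<bar>h\<bar>) \<longlongrightarrow> 0) (at 0)"
      by (rule tendsto_eq_intros | simp)+
  qed
  then show ?thesis by (simp add: DERIV_def)
qed

text \<open>Let r = 1 / (1 - t^2). From (1 + r / n)^n \<le> exp r one gets r^n exp(- r) \<le> n^n.
  Choosing n = k + 2 leaves two powers of 1 - t^2 to spare, enough for the derivative to vanish at
  the end points.\<close>

lemma bump_term_bound:
  obtains C where "\<And>t. \<bar>bump_term p k t\<bar> \<le> C * (1 - t\<^sup>2)\<^sup>2"
proof -
  have "bounded (poly p ` {-1..1})"
    by (intro compact_imp_bounded compact_continuous_image continuous_intros) auto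
  then obtain B where "\<forall>t\<in>{-1..1}. \<bar>poly p t\<bar> \<le> B"
    by (auto simp: bounded_iff)
  then have B: "\<And>t. t \<in> {-1..1} \<Longrightarrow> \<bar>poly p t\<bar> \<le> B" by blast
  have "B \<ge> 0" using order_trans[OF abs_ge_zero B[of 0]] by simp
  define n where "n = k + 2"
  have "\<bar>bump_term p k t\<bar> \<le> B * real n ^ n * (1 - t\<^sup>2)\<^sup>2" for t
  proof (cases "\<bar>t\<bar> < 1")
    case True
    define s where "s = 1 - t\<^sup>2"
    have s: "s > 0" using True by (simp add: s_def abs_square_less_1)
    define r where "r = inverse s"
    have r: "r > 0" "s * r = 1" using s by (simp_all add: r_def)
    have n: "real n > 0" by (simp add: n_def)
    have "(r / real n) ^ n \<le> (1 + r / real n) ^ n"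
      using r n by (intro power_mono) auto
    also have "\<dots> \<le> exp r"
      using r n by (intro exp_ge_one_plus_x_over_n_power_n) auto
    finally have "r ^ n \<le> real n ^ n * exp r"
      using n by (simp add: power_divide divide_le_eq mult.commute)
    then have "r ^ n * exp (- r) \<le> real n ^ n * exp r * exp (- r)" by (intro mult_right_mono) auto
    then have le: "r ^ n * exp (- r) \<le> real n ^ n" by (simp add: mult.assoc flip: exp_add)
    have "r ^ k * exp (- r) = (s * r)\<^sup>2 * (r ^ k * exp (- r))" by (simp add: r)
    also have "\<dots> = s\<^sup>2 * (r ^ n * exp (- r))" by (simp add: n_def power_add power2_eq_square)
    also have "\<dots> \<le> s\<^sup>2 * real n ^ n" using le by (rule mult_left_mono) simp
    finally have le': "r ^ k * exp (- r) \<le> s\<^sup>2 * real n ^ n" .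
    have pB: "\<bar>poly p t\<bar> \<le> B" using True by (intro B) (simp add: abs_less_iff)
    have "\<bar>poly p t\<bar> * (r ^ k * exp (- r)) \<le> B * (s\<^sup>2 * real n ^ n)"
      using r(1) by (intro mult_mono[OF pB le' \<open>B \<ge> 0\<close>]) simp
    moreover have "\<bar>bump_term p k t\<bar> = \<bar>poly p t\<bar> * (r ^ k * exp (- r))"
      using True r(1) unfolding bump_term_def s_def[symmetric] r_def[symmetric] by (simp add: abs_mult)
    ultimately show ?thesis by (simp add: s_def mult_ac)
  next
    case False
    then show ?thesis using \<open>B \<ge> 0\<close> by (simp add: bump_term_def)
  qed
  then show ?thesis by (rule that)
qed

text \<open>For t = 1 or t = -1 one has 1 - x^2 = (t - x) (t + x), and |t + x| \<le> 2 inside the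
  interval; the bound by (1 - x^2)^2 becomes quadratic in x - t, with the factor 2^2 = 4.\<close>

lemma bump_term_DERIV_boundary:
  assumes "\<bar>t\<bar> = 1"
  shows "(bump_term p k has_real_derivative 0) (at t)"
proof -
  obtain C where C: "\<And>t. \<bar>bump_term p k t\<bar> \<le> C * (1 - t\<^sup>2)\<^sup>2" using bump_term_bound by blast
  have "C \<ge> 0" using C[of 0] by (simp add: order_trans[OF abs_ge_zero])
  have "\<bar>bump_term p k x\<bar> \<le> (4 * C) * (x - t)\<^sup>2" for x
  proof (cases "\<bar>x\<bar> < 1")
    case True
    have "1 - x\<^sup>2 = (t - x) * (t + x)" using assms by (auto simp: abs_if power2_eq_square algebra_simps split: if_splits)
    then have "(1 - x\<^sup>2)\<^sup>2 = (x - t)\<^sup>2 * (t + x)\<^sup>2" by (simp add: power_mult_distrib power2_commute)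
    also have "\<dots> \<le> (x - t)\<^sup>2 * 2\<^sup>2"
    proof (intro mult_left_mono)
      have "\<bar>t + x\<bar> \<le> \<bar>2\<bar>" using True assms by linarith
      then show "(t + x)\<^sup>2 \<le> 2\<^sup>2" by (simp only: abs_le_square_iff)
    qed simp
    finally have "C * (1 - x\<^sup>2)\<^sup>2 \<le> C * ((x - t)\<^sup>2 * 2\<^sup>2)" using \<open>C \<ge> 0\<close> by (rule mult_left_mono)
    then show ?thesis using C[of x] by simp
  next
    case False
    then show ?thesis using \<open>C \<ge> 0\<close> by (simp add: bump_term_def)
  qed
  then show ?thesis by (rule DERIV_zero_if_quadratic_bound)
qed

text \<open>The numerator of the derivative over the common denominator (1 - t^2)^(k + 2). Its three
  terms come from differentiating the polynomial, the power and the exponential;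
  \<open>[:1, 0, -1:]\<close> is 1 - t^2.\<close>

definition bump_step :: "real poly \<Rightarrow> nat \<Rightarrow> real poly" where
  "bump_step p k = pderiv p * [:1, 0, -1:]\<^sup>2 + [:0, 2 * real k:] * p * [:1, 0, -1:] - [:0, 2:] * p"

lemma bump_term_DERIV:
  "(bump_term p k has_real_derivative bump_term (bump_step p k) (k + 2) t) (at t)"
proof -
  consider "\<bar>t\<bar> < 1" | "\<bar>t\<bar> = 1" | "\<bar>t\<bar> > 1" by linarith
  then show ?thesis
  proof cases
    case 1
    define s r where "s = 1 - t\<^sup>2" and "r = inverse (1 - t\<^sup>2)"
    have s: "s \<noteq> 0" "s * r = 1" using 1 abs_square_less_1[of t] by (simp_all add: s_def r_def)
    have D0: "((\<lambda>t. 1 - t\<^sup>2) has_real_derivative - (2 * t)) (at t)"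
      by (auto intro!: derivative_eq_intros)
    have Dr: "((\<lambda>t. inverse (1 - t\<^sup>2)) has_real_derivative 2 * t * r\<^sup>2) (at t)"
      by (rule DERIV_cong[OF DERIV_inverse'[OF D0]])
        (use s(1) in \<open>simp add: s_def\<close>, simp add: r_def[symmetric], simp add: power2_eq_square)
    have Dk: "((\<lambda>t. inverse (1 - t\<^sup>2) ^ k) has_real_derivative 2 * t * real k * r ^ (k + 1)) (at t)"
      by (rule DERIV_cong[OF DERIV_power[OF Dr]])
        (cases k; simp only: r_def[symmetric]; simp add: power2_eq_square)
    have De: "((\<lambda>t. exp (- inverse (1 - t\<^sup>2))) has_real_derivative - (2 * t * r\<^sup>2 * exp (- r))) (at t)"
      by (rule DERIV_cong[OF DERIV_fun_exp[OF DERIV_minus[OF Dr]]]) (simp add: r_def[symmetric])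
    have "((\<lambda>t. poly p t * inverse (1 - t\<^sup>2) ^ k * exp (- inverse (1 - t\<^sup>2))) has_real_derivative
        (poly (pderiv p) t * r ^ k + 2 * t * real k * r ^ (k + 1) * poly p t) * exp (- r)
        + - (2 * t * r\<^sup>2 * exp (- r)) * (poly p t * r ^ k)) (at t)"
      using DERIV_mult[OF DERIV_mult[OF poly_DERIV[of p t] Dk] De] by (simp only: r_def[symmetric])
    moreover have "(poly (pderiv p) t * r ^ k + 2 * t * real k * r ^ (k + 1) * poly p t) * exp (- r)
        + - (2 * t * r\<^sup>2 * exp (- r)) * (poly p t * r ^ k) = bump_term (bump_step p k) (k + 2) t"
    proof -
      have step: "poly (bump_step p k) t = poly (pderiv p) t * s\<^sup>2 + 2 * real k * t * poly p t * s - 2 * t * poly p t"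
        by (simp add: bump_step_def s_def power2_eq_square algebra_simps)
      have "bump_term (bump_step p k) (k + 2) t = poly (bump_step p k) t * (r ^ k * r\<^sup>2) * exp (- r)"
        using 1 by (simp only: bump_term_def r_def[symmetric] power_add if_True)
      \<comment> \<open>Each power of \<open>s\<close> is paired with a power of \<open>r\<close>,
        so that s r = 1 removes it.\<close>
      also have "\<dots> = (poly (pderiv p) t * (s * r)\<^sup>2 * r ^ k + 2 * t * real k * (s * r) * (r ^ k * r) * poly p t - 2 * t * r\<^sup>2 * (poly p t * r ^ k)) * exp (- r)"
        unfolding step by algebra
      also have "\<dots> = (poly (pderiv p) t * r ^ k + 2 * t * real k * r ^ (k + 1) * poly p t) * exp (- r)
        + - (2 * t * r\<^sup>2 * exp (- r)) * (poly p t * r ^ k)"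
        unfolding s(2) by (simp add: algebra_simps)
      finally show ?thesis ..
    qed
    ultimately have "((\<lambda>t. poly p t * inverse (1 - t\<^sup>2) ^ k * exp (- inverse (1 - t\<^sup>2))) has_real_derivative
        bump_term (bump_step p k) (k + 2) t) (at t)" by (simp only:)
    then show ?thesis
    proof (rule has_field_derivative_transform_within_open[of _ _ _ "{-1<..<1}"])
      show "poly p x * inverse (1 - x\<^sup>2) ^ k * exp (- inverse (1 - x\<^sup>2)) = bump_term p k x" if "x \<in> {-1<..<1}" for x
        using that by (simp add: bump_term_def abs_less_iff)
    qed (use 1 in auto)
  next
    case 2
    then show ?thesis using bump_term_DERIV_boundary[OF 2, of p k] by (simp add: bump_term_def)
  next
    case 3
    have "((\<lambda>t. 0) has_real_derivative 0) (at t)" by simp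
    then have "(bump_term p k has_real_derivative 0) (at t)"
    proof (rule has_field_derivative_transform_within_open[of _ _ _ "- {-1..1}"])
      show "0 = bump_term p k x" if "x \<in> - {-1..1}" for x
        using that by (auto simp: bump_term_def)
    qed (use 3 in auto)
    then show ?thesis using 3 by (simp add: bump_term_def)
  qed
qed

lemma bump_term_smult: "bump_term (smult r p) k t = r * bump_term p k t"
  by (simp add: bump_term_def)

lemma continuous_bump_term: "continuous_on S (bump_term p k)"
  using DERIV_continuous_on[of S "bump_term p k"] bump_term_DERIV has_field_derivative_at_within by blast

lemma bump_term_bounded: obtains B where "\<And>t. \<bar>bump_term p k t\<bar> \<le> B"
proof -
  obtain C where C: "\<And>t. \<bar>bump_term p k t\<bar> \<le> C * (1 - t\<^sup>2)\<^sup>2" using bump_term_bound by blast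
  have "C \<ge> 0" using C[of 0] by (simp add: order_trans[OF abs_ge_zero])
  have "\<bar>bump_term p k t\<bar> \<le> C" for t
  proof (cases "\<bar>t\<bar> < 1")
    case True
    then have "\<bar>1 - t\<^sup>2\<bar> \<le> 1" using abs_square_less_1[of t] by (simp add: abs_le_iff) 
    then have "(1 - t\<^sup>2)\<^sup>2 \<le> 1" using abs_square_le_1 by blast
    then have "C * (1 - t\<^sup>2)\<^sup>2 \<le> C * 1" using \<open>C \<ge> 0\<close> by (intro mult_left_mono)
    then show ?thesis using C[of t] by simp
  next
    case False
    then show ?thesis using \<open>C \<ge> 0\<close> by (simp add: bump_term_def)
  qed
  then show ?thesis by (rule that)
qed

text \<open>The scale \<open>e\<close> may be negative and the offsets are free, so the family
  contains the mollifier and also its reflected translates y \<mapsto> moll (x - y).\<close>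

definition bump2 :: "real poly \<Rightarrow> nat \<Rightarrow> real poly \<Rightarrow> nat \<Rightarrow> real \<Rightarrow> real \<Rightarrow> real \<Rightarrow> pt \<Rightarrow> real" where
  "bump2 p k q l e s t y = bump_term p k (s + e * fst y) * bump_term q l (t + e * snd y)"

lemma bump2_has_derivative:
  "(bump2 p k q l e s t has_derivative
     (\<lambda>h. bump2 (smult e (bump_step p k)) (k + 2) q l e s t y * fst h + bump2 p k (smult e (bump_step q l)) (l + 2) e s t y * snd h)) (at y)"
proof -
  have 1: "((\<lambda>y. bump_term p k (s + e * fst y)) has_derivative
      (\<lambda>h. bump_term (bump_step p k) (k + 2) (s + e * fst y) * (e * fst h))) (at y)"
    by (rule has_derivative_compose[OF _ bump_term_DERIV[unfolded has_field_derivative_def]])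
       (auto intro!: derivative_eq_intros)
  have 2: "((\<lambda>y. bump_term q l (t + e * snd y)) has_derivative
      (\<lambda>h. bump_term (bump_step q l) (l + 2) (t + e * snd y) * (e * snd h))) (at y)"
    by (rule has_derivative_compose[OF _ bump_term_DERIV[unfolded has_field_derivative_def]])
       (auto intro!: derivative_eq_intros)
  show ?thesis
    unfolding bump2_def[abs_def]
    by (rule has_derivative_eq_rhs[OF has_derivative_mult[OF 1 2]])
       (auto simp: bump_term_smult algebra_simps)
qed

text \<open>The coinduction invariant is membership in the family: both partial derivatives are
  again \<open>bump2\<close>, with other \<open>p\<close>, \<open>k\<close>, \<open>q\<close>,
  \<open>l\<close> only.\<close>

lemma smooth2_bump2: "smooth2 (bump2 p k q l e s t)"
proof (coinduction arbitrary: p k q l)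
  case smooth2
  let ?f1 = "bump2 (smult e (bump_step p k)) (k + 2) q l e s t"
  let ?f2 = "bump2 p k (smult e (bump_step q l)) (l + 2) e s t"
  have D: "\<forall>y. (bump2 p k q l e s t has_derivative (\<lambda>h. ?f1 y * fst h + ?f2 y * snd h)) (at y)"
    using bump2_has_derivative by blast
  show ?case by (intro exI conjI disjI1) (rule refl, rule D, rule refl, rule refl)
qed

lemma continuous_bump2: "continuous_on UNIV (bump2 p k q l e s t)"
  unfolding bump2_def[abs_def]
  by (intro continuous_intros continuous_on_compose2[OF continuous_bump_term]) auto

lemma bump2_bounded: obtains B where "\<And>s t y. \<bar>bump2 p k q l e s t y\<bar> \<le> B"
proof -
  obtain B1 where B1: "\<And>t. \<bar>bump_term p k t\<bar> \<le> B1" using bump_term_bounded by blast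
  obtain B2 where B2: "\<And>t. \<bar>bump_term q l t\<bar> \<le> B2" using bump_term_bounded by blast
  have "\<bar>bump2 p k q l e s t y\<bar> \<le> B1 * B2" for s t y
    unfolding bump2_def abs_mult
    using B1 B2 order_trans[OF abs_ge_zero B1] by (intro mult_mono) auto
  then show ?thesis by (rule that)
qed

lemma bump2_eq_0: "1 \<le> \<bar>s + e * fst y\<bar> \<or> 1 \<le> \<bar>t + e * snd y\<bar> \<Longrightarrow> bump2 p k q l e s t y = 0"
  by (auto simp: bump2_def bump_term_def)

text \<open>Supported in the square of half side \<epsilon> for positive \<epsilon>, and not
  normalised: its integral \<open>I\<close> is carried through the estimates and cancelled at the
  end of \<open>BV_diffq_shr\<close>.\<close>

definition moll :: "real \<Rightarrow> pt \<Rightarrow> real" where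
  "moll \<epsilon> = bump2 1 0 1 0 (1 / \<epsilon>) 0 0"

definition moll1 :: "real \<Rightarrow> pt \<Rightarrow> real" where
  "moll1 \<epsilon> = bump2 (smult (1 / \<epsilon>) (bump_step 1 0)) (0 + 2) 1 0 (1 / \<epsilon>) 0 0"

definition moll2 :: "real \<Rightarrow> pt \<Rightarrow> real" where
  "moll2 \<epsilon> = bump2 1 0 (smult (1 / \<epsilon>) (bump_step 1 0)) (0 + 2) (1 / \<epsilon>) 0 0"

lemma moll_has_derivative:
  "(moll \<epsilon> has_derivative (\<lambda>h. moll1 \<epsilon> y * fst h + moll2 \<epsilon> y * snd h)) (at y)"
  using bump2_has_derivative[of 1 0 1 0 "1 / \<epsilon>" 0 0 y] by (simp only: moll_def moll1_def moll2_def)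

lemma moll_nonneg: "moll \<epsilon> y \<ge> 0"
  by (simp add: moll_def bump2_def bump_term_def)

lemma moll_support:
  assumes "\<epsilon> > 0" "moll \<epsilon> y \<noteq> 0"
  shows "\<bar>fst y\<bar> \<le> \<epsilon>" "\<bar>snd y\<bar> \<le> \<epsilon>"
proof -
  have "\<not> 1 \<le> \<bar>fst y\<bar> / \<epsilon>" "\<not> 1 \<le> \<bar>snd y\<bar> / \<epsilon>"
    using bump2_eq_0[of 0 "1 / \<epsilon>" y 0 1 0 1 0] assms by (auto simp: moll_def abs_mult)
  then show "\<bar>fst y\<bar> \<le> \<epsilon>" "\<bar>snd y\<bar> \<le> \<epsilon>" using assms(1) by (simp_all add: divide_less_eq not_le)
qed

lemma moll_continuous: "continuous_on UNIV (moll \<epsilon>)" "continuous_on UNIV (moll1 \<epsilon>)" "continuous_on UNIV (moll2 \<epsilon>)"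
  unfolding moll_def moll1_def moll2_def by (rule continuous_bump2)+

lemma moll_measurable [measurable]:
  "moll \<epsilon> \<in> borel_measurable borel" "moll1 \<epsilon> \<in> borel_measurable borel" "moll2 \<epsilon> \<in> borel_measurable borel"
  using moll_continuous by (auto intro: borel_measurable_continuous_onI)

lemma moll_bounded:
  obtains B where "\<And>y. \<bar>moll \<epsilon> y\<bar> \<le> B" "\<And>y. \<bar>moll1 \<epsilon> y\<bar> \<le> B" "\<And>y. \<bar>moll2 \<epsilon> y\<bar> \<le> B"
proof -
  obtain B0 where B0: "\<And>y. \<bar>moll \<epsilon> y\<bar> \<le> B0" unfolding moll_def using bump2_bounded by metis
  obtain B1 where B1: "\<And>y. \<bar>moll1 \<epsilon> y\<bar> \<le> B1" unfolding moll1_def using bump2_bounded by metis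
  obtain B2 where B2: "\<And>y. \<bar>moll2 \<epsilon> y\<bar> \<le> B2" unfolding moll2_def using bump2_bounded by metis
  show ?thesis
    by (rule that[of "max B0 (max B1 B2)"]) (use B0 B1 B2 in \<open>auto simp: le_max_iff_disj\<close>)
qed

lemma moll_integral_pos:
  assumes "\<epsilon> > 0"
  obtains I where "I > 0" "(\<integral>\<^sup>+y. ennreal (moll \<epsilon> y) \<partial>lborel) = ennreal I"
proof -
  let ?N = "\<integral>\<^sup>+y. ennreal (moll \<epsilon> y) \<partial>lborel"
  obtain B where B: "\<And>y. \<bar>moll \<epsilon> y\<bar> \<le> B" by (rule moll_bounded[of \<epsilon>]) blast
  have [measurable]: "{-\<epsilon>..\<epsilon>} \<times> {-\<epsilon>..\<epsilon>} \<in> sets (borel :: pt measure)" by (intro borel_Times) auto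
  have "?N \<le> (\<integral>\<^sup>+y. ennreal B * indicator ({-\<epsilon>..\<epsilon>} \<times> {-\<epsilon>..\<epsilon>}) y \<partial>lborel)"
  proof (rule nn_integral_mono)
    fix y
    show "ennreal (moll \<epsilon> y) \<le> ennreal B * indicator ({-\<epsilon>..\<epsilon>} \<times> {-\<epsilon>..\<epsilon>}) y"
    proof (cases "moll \<epsilon> y = 0")
      case False
      then have "y \<in> {-\<epsilon>..\<epsilon>} \<times> {-\<epsilon>..\<epsilon>}"
        using moll_support[OF assms False] by (auto simp: mem_Times_iff abs_le_iff)
      then show ?thesis using B[of y] by (simp add: ennreal_leI)
    qed simp
  qed
  also have "\<dots> = ennreal B * ennreal ((\<epsilon> - - \<epsilon>) * (\<epsilon> - - \<epsilon>))"
    using assms by (subst nn_integral_cmult_indicator) (simp, subst emeasure_lborel_rect, auto)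
  also have "\<dots> < \<infinity>" by (simp add: ennreal_mult_less_top)
  finally have fin: "?N < \<infinity>" .
  have "?N \<noteq> 0"
  proof
    assume "?N = 0"
    then have "AE y in lborel. ennreal (moll \<epsilon> y) = 0"
      by (subst (asm) nn_integral_0_iff_AE) simp_all
    then have ae: "AE y in lborel. moll \<epsilon> y = 0"
    proof eventually_elim
      case (elim y)
      then show ?case using moll_nonneg[of \<epsilon> y] by (simp add: ennreal_eq_0_iff)
    qed
    \<comment> \<open>A quarter of the support suffices: it has positive area and the mollifier is
      strictly positive on it.\<close>
    let ?S = "{0<..<\<epsilon>} \<times> {0<..<\<epsilon>} :: pt set"
    have "AE y in lborel. y \<notin> ?S"
      using ae
    proof eventually_elim
      case (elim y)
      have "moll \<epsilon> y > 0" if "y \<in> ?S"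
      proof -
        have "0 < fst y / \<epsilon>" "fst y / \<epsilon> < 1" "0 < snd y / \<epsilon>" "snd y / \<epsilon> < 1"
          using that assms by (auto simp: mem_Times_iff)
        then show ?thesis by (simp add: moll_def bump2_def bump_term_def)
      qed
      then show ?case using elim by auto
    qed
    then have "emeasure lborel ?S = 0"
      using AE_iff_measurable[of ?S lborel "\<lambda>y. y \<notin> ?S"] by (simp add: borel_Times)
    moreover have "emeasure lborel ?S = ennreal (\<epsilon> * \<epsilon>)"
      using assms by (subst emeasure_lborel_rect) auto
    ultimately show False using assms by (simp add: ennreal_eq_0_iff mult_le_0_iff)
  qed
  with fin show ?thesis
    by (intro that[of "enn2real ?N"]) (auto simp: enn2real_positive_iff less_top zero_less_iff_neq_zero)
qed

subsection \<open>Difference quotients of BV functions\<close>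

text \<open>For non-integrable \<open>f\<close> the left-hand side is 0 by convention; the later
  estimates can thus be made before integrability is settled.\<close>

lemma abs_integral_le_nn_integral:
  fixes f :: "'a \<Rightarrow> real"
  shows "ennreal \<bar>integral\<^sup>L M f\<bar> \<le> (\<integral>\<^sup>+x. ennreal \<bar>f x\<bar> \<partial>M)"
proof (cases "integrable M f")
  case True
  then show ?thesis using integral_norm_bound_ennreal[OF True] by simp
next
  case False
  then show ?thesis by (simp add: not_integrable_integral_eq)
qed

lemma measurable_conv_measure:
  fixes k :: "pt \<Rightarrow> ennreal"
  assumes s: "sets \<mu> = sets (borel :: pt measure)" "finite_measure \<mu>" and [measurable]: "k \<in> borel_measurable borel"
  shows "(\<lambda>z. \<integral>\<^sup>+y. k (z - y) \<partial>\<mu>) \<in> borel_measurable borel"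
proof -
  interpret finite_measure \<mu> by (rule s)
  note [measurable_cong] = s(1)
  show ?thesis by measurable
qed

text \<open>Tonelli and translation invariance. For the mollifier this computes the L1 norm of a
  mollified measure: the integral of the mollifier times the total mass.\<close>

lemma nn_integral_conv_measure:
  fixes k :: "pt \<Rightarrow> ennreal"
  assumes s: "sets \<mu> = sets (borel :: pt measure)" "finite_measure \<mu>" and [measurable]: "k \<in> borel_measurable borel"
  shows "(\<integral>\<^sup>+z. \<integral>\<^sup>+y. k (z - y) \<partial>\<mu> \<partial>lborel) = (\<integral>\<^sup>+z. k z \<partial>lborel) * emeasure \<mu> UNIV"
proof -
  interpret mu: finite_measure \<mu> by (rule s)
  interpret P: pair_sigma_finite "lborel :: pt measure" \<mu> ..
  note [measurable_cong] = s(1)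
  have sp: "space \<mu> = UNIV" using sets_eq_imp_space_eq[OF s(1)] by simp
  have "(\<integral>\<^sup>+z. \<integral>\<^sup>+y. k (z - y) \<partial>\<mu> \<partial>lborel) = (\<integral>\<^sup>+y. \<integral>\<^sup>+z. k (z - y) \<partial>lborel \<partial>\<mu>)"
    by (rule P.Fubini'[symmetric]) measurable
  also have "\<dots> = (\<integral>\<^sup>+y. (\<integral>\<^sup>+z. k z \<partial>lborel) \<partial>\<mu>)"
    using nn_integral_lborel_shift[of k "- y" for y] by simp
  finally show ?thesis by (simp add: sp)
qed

context rectangle
begin

text \<open>Around its points the square of half side \<open>e\<close> stays inside the rectangle;
  this is where the translated mollifier qualifies as a test function.\<close>

definition shr :: "real \<Rightarrow> pt set" where
  "shr e = {a + e<..<b - e} \<times> {c + e<..<d - e}"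

lemma shr_measurable [measurable]: "shr e \<in> sets borel"
  unfolding shr_def by (intro borel_Times) auto

lemma rect_measurable [measurable]: "\<theta> \<in> sets borel"
  by (intro borel_Times) auto

lemma test_fun_moll:
  assumes "\<epsilon> > 0" "x \<in> shr \<epsilon>"
  shows "test_fun \<theta> (\<lambda>y. moll \<epsilon> (x - y)) (\<lambda>y. - moll1 \<epsilon> (x - y)) (\<lambda>y. - moll2 \<epsilon> (x - y))"
proof -
  \<comment> \<open>The reflection y \<mapsto> x - y is absorbed by the negative scale and the
    offsets, so smoothness is inherited from the family \<open>bump2\<close>.\<close>
  have eq: "(\<lambda>y. moll \<epsilon> (x - y)) = bump2 1 0 1 0 (- (1 / \<epsilon>)) (fst x / \<epsilon>) (snd x / \<epsilon>)"
    by (auto simp: moll_def bump2_def fun_eq_iff diff_divide_distrib)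
  let ?K = "{fst x - \<epsilon>..fst x + \<epsilon>} \<times> {snd x - \<epsilon>..snd x + \<epsilon>}"
  have "{y. moll \<epsilon> (x - y) \<noteq> 0} \<subseteq> ?K"
  proof
    fix y assume "y \<in> {y. moll \<epsilon> (x - y) \<noteq> 0}"
    then have "moll \<epsilon> (x - y) \<noteq> 0" by simp
    from moll_support[OF assms(1) this] show "y \<in> ?K" by (auto simp: mem_Times_iff abs_le_iff)
  qed
  then have cl: "closure {y. moll \<epsilon> (x - y) \<noteq> 0} \<subseteq> ?K"
    by (rule closure_minimal) (intro closed_Times closed_atLeastAtMost)
  have K: "compact ?K" by (intro compact_Times compact_Icc)
  have "?K \<subseteq> \<theta>" using assms by (auto simp: shr_def)
  show ?thesis
    unfolding test_fun_def
  proof (intro conjI allI)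
    show "smooth2 (\<lambda>y. moll \<epsilon> (x - y))" unfolding eq by (rule smooth2_bump2)
    show "compact (closure {y. moll \<epsilon> (x - y) \<noteq> 0})"
      using compact_Int_closed[OF K closed_closure] cl by (metis Int_absorb1)
    show "closure {y. moll \<epsilon> (x - y) \<noteq> 0} \<subseteq> \<theta>" using cl \<open>?K \<subseteq> \<theta>\<close> by blast
    fix y
    have "((\<lambda>y. x - y) has_derivative (\<lambda>h. - h)) (at y)" by (auto intro!: derivative_eq_intros)
    from has_derivative_compose[OF this moll_has_derivative]
    show "((\<lambda>y. moll \<epsilon> (x - y)) has_derivative (\<lambda>h. - moll1 \<epsilon> (x - y) * fst h + - moll2 \<epsilon> (x - y) * snd h)) (at y)"
      by simp
  qed
qed

text \<open>Two minus signs cancel, one from differentiating moll (x - y) in \<open>y\<close> and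
  one from the distributional derivative: the derivative of the mollified \<open>u\<close> is the
  mollified derivative of \<open>u\<close>.\<close>

lemma BV_moll:
  assumes "BV \<theta> u"
  obtains p1 n1 p2 n2 where
    "fin_meas_on \<theta> p1" "fin_meas_on \<theta> n1" "fin_meas_on \<theta> p2" "fin_meas_on \<theta> n2"
    "\<And>\<epsilon> x. \<epsilon> > 0 \<Longrightarrow> x \<in> shr \<epsilon> \<Longrightarrow>
       (\<integral>y. (indicator \<theta> y * u y) * moll1 \<epsilon> (x - y) \<partial>lborel) = (\<integral>y. moll \<epsilon> (x - y) \<partial>p1) - (\<integral>y. moll \<epsilon> (x - y) \<partial>n1)"
    "\<And>\<epsilon> x. \<epsilon> > 0 \<Longrightarrow> x \<in> shr \<epsilon> \<Longrightarrow>
       (\<integral>y. (indicator \<theta> y * u y) * moll2 \<epsilon> (x - y) \<partial>lborel) = (\<integral>y. moll \<epsilon> (x - y) \<partial>p2) - (\<integral>y. moll \<epsilon> (x - y) \<partial>n2)"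
proof -
  obtain p1 n1 p2 n2 where fin: "fin_meas_on \<theta> p1" "fin_meas_on \<theta> n1" "fin_meas_on \<theta> p2" "fin_meas_on \<theta> n2"
    and ibp: "\<And>\<phi> \<phi>1 \<phi>2. test_fun \<theta> \<phi> \<phi>1 \<phi>2 \<Longrightarrow>
       (\<integral>x\<in>\<theta>. u x * \<phi>1 x \<partial>lborel) = - ((\<integral>x. \<phi> x \<partial>p1) - (\<integral>x. \<phi> x \<partial>n1)) \<and>
       (\<integral>x\<in>\<theta>. u x * \<phi>2 x \<partial>lborel) = - ((\<integral>x. \<phi> x \<partial>p2) - (\<integral>x. \<phi> x \<partial>n2))"
    using assms unfolding BV_def by blast
  have neg: "(\<integral>x\<in>\<theta>. u x * - f x \<partial>lborel) = - (\<integral>y. (indicator \<theta> y * u y) * f y \<partial>lborel)" for f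
    by (simp add: set_lebesgue_integral_def mult.assoc)
  show ?thesis
  proof (rule that[OF fin])
    fix \<epsilon> :: real and x assume "\<epsilon> > 0" "x \<in> shr \<epsilon>"
    from ibp[OF test_fun_moll[OF this]]
    show "(\<integral>y. (indicator \<theta> y * u y) * moll1 \<epsilon> (x - y) \<partial>lborel) = (\<integral>y. moll \<epsilon> (x - y) \<partial>p1) - (\<integral>y. moll \<epsilon> (x - y) \<partial>n1)"
      and "(\<integral>y. (indicator \<theta> y * u y) * moll2 \<epsilon> (x - y) \<partial>lborel) = (\<integral>y. moll \<epsilon> (x - y) \<partial>p2) - (\<integral>y. moll \<epsilon> (x - y) \<partial>n2)"
      unfolding neg by simp_all
  qed
qed

lemma shr_convex:
  assumes "x \<in> shr \<epsilon>" "x + h \<in> shr \<epsilon>" "s \<in> {0..1}"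
  shows "x + s *\<^sub>R h \<in> shr \<epsilon>"
proof -
  have "convex (shr \<epsilon>)" unfolding shr_def by (intro convex_Times convex_real_interval)
  from convexD_alt[OF this assms(1,2), of s] assms(3) show ?thesis by (simp add: algebra_simps)
qed

end

lemma moll_difference_FTC:
  "(\<integral>s. (moll1 \<epsilon> (z + s *\<^sub>R h) * fst h + moll2 \<epsilon> (z + s *\<^sub>R h) * snd h) * indicator {0..1} s \<partial>lborel)
    = moll \<epsilon> (z + h) - moll \<epsilon> z"
proof -
  have "((\<lambda>s. moll \<epsilon> (z + s *\<^sub>R h)) has_real_derivative (moll1 \<epsilon> (z + s *\<^sub>R h) * fst h + moll2 \<epsilon> (z + s *\<^sub>R h) * snd h)) (at s)" for s
    unfolding has_field_derivative_def
    by (rule has_derivative_eq_rhs[OF has_derivative_compose[OF _ moll_has_derivative]])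
       (auto intro!: derivative_eq_intros simp: algebra_simps)
  moreover have "isCont (\<lambda>s. moll1 \<epsilon> (z + s *\<^sub>R h) * fst h + moll2 \<epsilon> (z + s *\<^sub>R h) * snd h) s" for s
  proof -
    have "continuous_on UNIV (\<lambda>s. moll1 \<epsilon> (z + s *\<^sub>R h) * fst h + moll2 \<epsilon> (z + s *\<^sub>R h) * snd h)"
      by (intro continuous_intros continuous_on_compose2[OF moll_continuous(2)] continuous_on_compose2[OF moll_continuous(3)]) auto
    then show ?thesis by (simp add: continuous_on_eq_continuous_at)
  qed
  ultimately show ?thesis
    using integral_FTC_Icc_real[of 0 1 "\<lambda>s. moll \<epsilon> (z + s *\<^sub>R h)"] by simp
qed

text \<open>Integrate the derivative of the mollifier along the segment from x - y to x + h - y and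
  exchange the integrals. Fubini applies since the derivatives of the mollifier are bounded and
  \<open>v\<close> is integrable.\<close>

lemma mollified_difference:
  fixes v :: "pt \<Rightarrow> real"
  assumes v: "integrable lborel v"
  shows "(\<integral>y. v y * moll \<epsilon> (x + h - y) \<partial>lborel) - (\<integral>y. v y * moll \<epsilon> (x - y) \<partial>lborel)
    = (\<integral>s. indicator {0..1} s * (fst h * (\<integral>y. v y * moll1 \<epsilon> (x + s *\<^sub>R h - y) \<partial>lborel)
        + snd h * (\<integral>y. v y * moll2 \<epsilon> (x + s *\<^sub>R h - y) \<partial>lborel)) \<partial>lborel)"
proof -
  have [measurable]: "v \<in> borel_measurable borel" using borel_measurable_integrable[OF v] by simp
  obtain B where B: "\<And>y. \<bar>moll \<epsilon> y\<bar> \<le> B" "\<And>y. \<bar>moll1 \<epsilon> y\<bar> \<le> B" "\<And>y. \<bar>moll2 \<epsilon> y\<bar> \<le> B"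
    by (rule moll_bounded[of \<epsilon>]) blast
  have int: "integrable lborel (\<lambda>y. v y * f y)" if [measurable]: "f \<in> borel_measurable borel" and "\<And>y. \<bar>f y\<bar> \<le> B" for f
  proof (rule Bochner_Integration.integrable_bound)
    show "integrable lborel (\<lambda>y. v y * B)" using v by simp
    show "AE y in lborel. norm (v y * f y) \<le> norm (v y * B)"
      using that(2) by (auto simp: abs_mult intro!: mult_left_mono order_trans[OF that(2) abs_ge_self])
  qed measurable
  let ?D = "\<lambda>s y. moll1 \<epsilon> (x + s *\<^sub>R h - y) * fst h + moll2 \<epsilon> (x + s *\<^sub>R h - y) * snd h"
  let ?f = "\<lambda>s y. v y * (?D s y * indicator {0..1} s)"
  let ?B = "B * (\<bar>fst h\<bar> + \<bar>snd h\<bar>)"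
  have DB: "\<bar>?D s y\<bar> \<le> ?B" for s y
  proof -
    have "\<bar>?D s y\<bar> \<le> \<bar>moll1 \<epsilon> (x + s *\<^sub>R h - y)\<bar> * \<bar>fst h\<bar> + \<bar>moll2 \<epsilon> (x + s *\<^sub>R h - y)\<bar> * \<bar>snd h\<bar>"
      by (simp only: abs_mult[symmetric] abs_triangle_ineq)
    also have "\<dots> \<le> B * \<bar>fst h\<bar> + B * \<bar>snd h\<bar>" by (intro add_mono mult_right_mono B) auto
    finally show ?thesis by (simp add: distrib_left)
  qed
  have f_int: "integrable (lborel \<Otimes>\<^sub>M lborel) (case_prod ?f)"
  proof (subst integrable_iff_bounded, intro conjI)
    show m: "case_prod ?f \<in> borel_measurable (lborel \<Otimes>\<^sub>M lborel)" by measurable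
    have "(\<integral>\<^sup>+q. ennreal (norm (case_prod ?f q)) \<partial>(lborel \<Otimes>\<^sub>M lborel))
      = (\<integral>\<^sup>+s. \<integral>\<^sup>+y. ennreal (norm (?f s y)) \<partial>lborel \<partial>lborel)"
      using lborel.nn_integral_fst[of "\<lambda>q. ennreal (norm (case_prod ?f q))" lborel] m by simp
    also have "\<dots> \<le> (\<integral>\<^sup>+s. \<integral>\<^sup>+y. (ennreal \<bar>v y\<bar> * ennreal ?B) * indicator {0..1::real} s \<partial>lborel \<partial>lborel)"
    proof (intro nn_integral_mono)
      fix s :: real and y
      have "\<bar>v y\<bar> * \<bar>?D s y\<bar> \<le> \<bar>v y\<bar> * ?B" by (intro mult_left_mono DB) simp
      then have "ennreal (norm (v y * ?D s y)) \<le> ennreal (\<bar>v y\<bar> * ?B)" by (intro ennreal_leI) (simp add: abs_mult)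
      then show "ennreal (norm (?f s y)) \<le> (ennreal \<bar>v y\<bar> * ennreal ?B) * indicator {0..1} s"
        by (cases "s \<in> {0..1}") (simp_all add: ennreal_mult')
    qed
    also have "\<dots> = (\<integral>\<^sup>+y. ennreal \<bar>v y\<bar> \<partial>lborel) * ennreal ?B"
      by (simp add: nn_integral_multc nn_integral_cmult)
    also have "\<dots> < \<infinity>" using v by (simp add: integrable_iff_bounded ennreal_mult_less_top)
    finally show "(\<integral>\<^sup>+q. ennreal (norm (case_prod ?f q)) \<partial>(lborel \<Otimes>\<^sub>M lborel)) < \<infinity>" .
  qed
  have "(\<integral>y. v y * moll \<epsilon> (x + h - y) \<partial>lborel) - (\<integral>y. v y * moll \<epsilon> (x - y) \<partial>lborel)
    = (\<integral>y. v y * moll \<epsilon> (x + h - y) - v y * moll \<epsilon> (x - y) \<partial>lborel)"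
    by (intro Bochner_Integration.integral_diff[symmetric] int B) measurable
  also have "\<dots> = (\<integral>y. \<integral>s. ?f s y \<partial>lborel \<partial>lborel)"
  proof (rule Bochner_Integration.integral_cong)
    fix y
    have e: "x + s *\<^sub>R h - y = (x - y) + s *\<^sub>R h" for s by simp
    have "moll \<epsilon> (x + h - y) - moll \<epsilon> (x - y) = (\<integral>s. ?D s y * indicator {0..1} s \<partial>lborel)"
      unfolding e using moll_difference_FTC[of \<epsilon> "x - y" h] by (simp add: algebra_simps)
    then show "v y * moll \<epsilon> (x + h - y) - v y * moll \<epsilon> (x - y) = (\<integral>s. ?f s y \<partial>lborel)"
      by (simp add: right_diff_distrib[symmetric])
  qed simp
  also have "\<dots> = (\<integral>s. \<integral>y. ?f s y \<partial>lborel \<partial>lborel)"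
    by (rule lborel_pair.Fubini_integral[OF f_int])
  also have "\<dots> = (\<integral>s. indicator {0..1} s * (fst h * (\<integral>y. v y * moll1 \<epsilon> (x + s *\<^sub>R h - y) \<partial>lborel)
        + snd h * (\<integral>y. v y * moll2 \<epsilon> (x + s *\<^sub>R h - y) \<partial>lborel)) \<partial>lborel)"
  proof (rule Bochner_Integration.integral_cong)
    fix s :: real
    have "(\<integral>y. ?f s y \<partial>lborel) = (\<integral>y. indicator {0..1} s * (fst h * (v y * moll1 \<epsilon> (x + s *\<^sub>R h - y)) + snd h * (v y * moll2 \<epsilon> (x + s *\<^sub>R h - y))) \<partial>lborel)"
      by (intro Bochner_Integration.integral_cong) (auto simp: algebra_simps)
    also have "\<dots> = indicator {0..1} s * (fst h * (\<integral>y. v y * moll1 \<epsilon> (x + s *\<^sub>R h - y) \<partial>lborel)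
        + snd h * (\<integral>y. v y * moll2 \<epsilon> (x + s *\<^sub>R h - y) \<partial>lborel))"
    proof -
      have "integrable lborel (\<lambda>y. v y * moll1 \<epsilon> (x + s *\<^sub>R h - y))" "integrable lborel (\<lambda>y. v y * moll2 \<epsilon> (x + s *\<^sub>R h - y))"
        by (intro int B; measurable)+
      then show ?thesis by simp
    qed
    finally show "(\<integral>y. ?f s y \<partial>lborel) = \<dots>" .
  qed simp
  finally show ?thesis .
qed

text \<open>The difference is the integral of v(x) - v(x - y) with weight moll(y), so Tonelli leaves
  L1 norms of translation differences. The supporting square of half side \<epsilon> lies in the
  ball of radius 2 \<epsilon>, whence the form of \<open>close\<close>.\<close>

lemma mollify_L1_approx:
  fixes v :: "pt \<Rightarrow> real"
  assumes v: "integrable lborel v" and I: "(\<integral>\<^sup>+y. ennreal (moll \<epsilon> y) \<partial>lborel) = ennreal I" "I > 0" and "\<epsilon> > 0"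
    and close: "\<And>z. norm z \<le> 2 * \<epsilon> \<Longrightarrow> (\<integral>\<^sup>+x. ennreal \<bar>v (x + z) - v x\<bar> \<partial>lborel) \<le> ennreal \<eta>"
  shows "(\<integral>\<^sup>+x. ennreal \<bar>I * v x - (\<integral>y. v y * moll \<epsilon> (x - y) \<partial>lborel)\<bar> \<partial>lborel) \<le> ennreal I * ennreal \<eta>"
proof -
  have [measurable]: "v \<in> borel_measurable borel" using borel_measurable_integrable[OF v] by simp
  obtain B where B: "\<And>y. \<bar>moll \<epsilon> y\<bar> \<le> B" by (rule moll_bounded[of \<epsilon>]) blast
  have mi: "integrable lborel (moll \<epsilon>)" using I moll_nonneg by (simp add: integrable_iff_bounded)
  have mI: "(\<integral>y. moll \<epsilon> y \<partial>lborel) = I"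
    using I moll_nonneg by (simp add: integral_eq_nn_integral)
  have vm: "integrable lborel (\<lambda>y. moll \<epsilon> y * v (x - y))" for x
  proof (rule Bochner_Integration.integrable_bound)
    have "integrable lborel (\<lambda>y. v (x - y))"
      using v nn_integral_lborel_reflect[of "\<lambda>y. ennreal \<bar>v y\<bar>" x] by (simp add: integrable_iff_bounded)
    then show "integrable lborel (\<lambda>y. B * v (x - y))" by simp
    show "AE y in lborel. norm (moll \<epsilon> y * v (x - y)) \<le> norm (B * v (x - y))"
      using order_trans[OF B abs_ge_self] by (auto simp: abs_mult intro!: mult_right_mono)
  qed measurable
  have eq: "I * v x - (\<integral>y. v y * moll \<epsilon> (x - y) \<partial>lborel) = (\<integral>y. moll \<epsilon> y * (v x - v (x - y)) \<partial>lborel)" for x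
  proof -
    have "(\<integral>y. v y * moll \<epsilon> (x - y) \<partial>lborel) = (\<integral>y. moll \<epsilon> y * v (x - y) \<partial>lborel)"
      using integral_lborel_reflect[of "\<lambda>y. v y * moll \<epsilon> (x - y)" x] by (simp add: mult.commute)
    then show ?thesis using vm mi by (simp add: right_diff_distrib mI)
  qed
  have "(\<integral>\<^sup>+x. ennreal \<bar>I * v x - (\<integral>y. v y * moll \<epsilon> (x - y) \<partial>lborel)\<bar> \<partial>lborel)
    \<le> (\<integral>\<^sup>+x. \<integral>\<^sup>+y. ennreal (moll \<epsilon> y) * ennreal \<bar>v (x - y) - v x\<bar> \<partial>lborel \<partial>lborel)"
  proof (rule nn_integral_mono)
    fix x
    have "ennreal \<bar>\<integral>y. moll \<epsilon> y * (v x - v (x - y)) \<partial>lborel\<bar> \<le> (\<integral>\<^sup>+y. ennreal \<bar>moll \<epsilon> y * (v x - v (x - y))\<bar> \<partial>lborel)"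
      by (rule abs_integral_le_nn_integral)
    also have "\<dots> = (\<integral>\<^sup>+y. ennreal (moll \<epsilon> y) * ennreal \<bar>v (x - y) - v x\<bar> \<partial>lborel)"
      using moll_nonneg by (intro nn_integral_cong) (simp add: abs_mult ennreal_mult' abs_minus_commute)
    finally show "ennreal \<bar>I * v x - (\<integral>y. v y * moll \<epsilon> (x - y) \<partial>lborel)\<bar> \<le> (\<integral>\<^sup>+y. ennreal (moll \<epsilon> y) * ennreal \<bar>v (x - y) - v x\<bar> \<partial>lborel)"
      by (simp only: eq)
  qed
  also have "\<dots> = (\<integral>\<^sup>+y. \<integral>\<^sup>+x. ennreal (moll \<epsilon> y) * ennreal \<bar>v (x - y) - v x\<bar> \<partial>lborel \<partial>lborel)"
    by (rule lborel_pair.Fubini'[symmetric]) measurable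
  also have "\<dots> \<le> (\<integral>\<^sup>+y. ennreal (moll \<epsilon> y) * ennreal \<eta> \<partial>lborel)"
  proof (rule nn_integral_mono)
    fix y
    have "(\<integral>\<^sup>+x. ennreal (moll \<epsilon> y) * ennreal \<bar>v (x - y) - v x\<bar> \<partial>lborel) = ennreal (moll \<epsilon> y) * (\<integral>\<^sup>+x. ennreal \<bar>v (x + - y) - v x\<bar> \<partial>lborel)"
      by (simp add: nn_integral_cmult)
    also have "\<dots> \<le> ennreal (moll \<epsilon> y) * ennreal \<eta>"
    proof (cases "moll \<epsilon> y = 0")
      case False
      have "norm (- y) \<le> 2 * \<epsilon>"
        using moll_support[OF \<open>\<epsilon> > 0\<close> False] norm_pair_le[of y] by simp
      then show ?thesis by (intro mult_left_mono close) auto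
    qed simp
    finally show "(\<integral>\<^sup>+x. ennreal (moll \<epsilon> y) * ennreal \<bar>v (x - y) - v x\<bar> \<partial>lborel) \<le> ennreal (moll \<epsilon> y) * ennreal \<eta>" .
  qed
  also have "\<dots> = ennreal I * ennreal \<eta>" by (simp add: nn_integral_multc I)
  finally show ?thesis .
qed

context rectangle
begin

text \<open>On \<open>shr \<epsilon>\<close> the gradient of the mollified function is a mollified
  measure, whose L1 norm is at most I times the mass. Convexity of \<open>shr \<epsilon>\<close>
  keeps the segment from x to x + h where this holds.\<close>

lemma mollified_BV_difference:
  fixes v :: "pt \<Rightarrow> real"
  assumes v: "integrable lborel v" and "\<epsilon> > 0"
    and I: "(\<integral>\<^sup>+y. ennreal (moll \<epsilon> y) \<partial>lborel) = ennreal I" "I > 0"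
    and fin: "fin_meas_on \<theta> p1" "fin_meas_on \<theta> n1" "fin_meas_on \<theta> p2" "fin_meas_on \<theta> n2"
    and D1: "\<And>x. x \<in> shr \<epsilon> \<Longrightarrow> (\<integral>y. v y * moll1 \<epsilon> (x - y) \<partial>lborel) = (\<integral>y. moll \<epsilon> (x - y) \<partial>p1) - (\<integral>y. moll \<epsilon> (x - y) \<partial>n1)"
    and D2: "\<And>x. x \<in> shr \<epsilon> \<Longrightarrow> (\<integral>y. v y * moll2 \<epsilon> (x - y) \<partial>lborel) = (\<integral>y. moll \<epsilon> (x - y) \<partial>p2) - (\<integral>y. moll \<epsilon> (x - y) \<partial>n2)"
  defines "V \<equiv> \<lambda>x. \<integral>y. v y * moll \<epsilon> (x - y) \<partial>lborel"
  shows "(\<integral>\<^sup>+x. ennreal \<bar>V (x + h) - V x\<bar> * indicator (shr \<epsilon>) (x + h) * indicator (shr \<epsilon>) x \<partial>lborel)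
    \<le> ennreal (norm h) * (ennreal I * (emeasure p1 UNIV + emeasure n1 UNIV + emeasure p2 UNIV + emeasure n2 UNIV))"
proof -
  have [measurable]: "v \<in> borel_measurable borel" using borel_measurable_integrable[OF v] by simp
  let ?g = "\<lambda>\<mu> z. \<integral>\<^sup>+y. ennreal (moll \<epsilon> (z - y)) \<partial>\<mu>"
  define G where "G = (\<lambda>z. ?g p1 z + ?g n1 z + ?g p2 z + ?g n2 z)"
  have meas: "?g \<mu> \<in> borel_measurable borel" if "fin_meas_on \<theta> \<mu>" for \<mu>
    using that unfolding fin_meas_on_def by (intro measurable_conv_measure) auto
  have int: "(\<integral>\<^sup>+z. ?g \<mu> z \<partial>lborel) = ennreal I * emeasure \<mu> UNIV" if "fin_meas_on \<theta> \<mu>" for \<mu>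
    using that nn_integral_conv_measure[of \<mu> "\<lambda>y. ennreal (moll \<epsilon> y)"] unfolding fin_meas_on_def I by simp
  have [measurable]: "?g p1 \<in> borel_measurable borel" "?g n1 \<in> borel_measurable borel"
    "?g p2 \<in> borel_measurable borel" "?g n2 \<in> borel_measurable borel"
    by (intro meas fin)+
  have G_meas[measurable]: "G \<in> borel_measurable borel" unfolding G_def by measurable
  have G_int: "(\<integral>\<^sup>+z. G z \<partial>lborel) = ennreal I * (emeasure p1 UNIV + emeasure n1 UNIV + emeasure p2 UNIV + emeasure n2 UNIV)"
    unfolding G_def by (simp add: nn_integral_add int fin distrib_left)
  have bound: "ennreal \<bar>V (x + h) - V x\<bar> \<le> (\<integral>\<^sup>+s. indicator {0..1} s * (ennreal (norm h) * G (x + s *\<^sub>R h)) \<partial>lborel)"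
    if "x \<in> shr \<epsilon>" "x + h \<in> shr \<epsilon>" for x
  proof -
    let ?J = "\<lambda>s. fst h * (\<integral>y. v y * moll1 \<epsilon> (x + s *\<^sub>R h - y) \<partial>lborel) + snd h * (\<integral>y. v y * moll2 \<epsilon> (x + s *\<^sub>R h - y) \<partial>lborel)"
    have "ennreal \<bar>V (x + h) - V x\<bar> \<le> (\<integral>\<^sup>+s. ennreal \<bar>indicator {0..1} s * ?J s\<bar> \<partial>lborel)"
      unfolding V_def mollified_difference[OF v] by (rule abs_integral_le_nn_integral)
    also have "\<dots> \<le> (\<integral>\<^sup>+s. indicator {0..1} s * (ennreal (norm h) * G (x + s *\<^sub>R h)) \<partial>lborel)"
    proof (rule nn_integral_mono)
      fix s :: real
      show "ennreal \<bar>indicator {0..1} s * ?J s\<bar> \<le> indicator {0..1} s * (ennreal (norm h) * G (x + s *\<^sub>R h))"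
      proof (cases "s \<in> {0..1}")
        case True
        define z where "z = x + s *\<^sub>R h"
        have z: "z \<in> shr \<epsilon>" unfolding z_def by (rule shr_convex[OF that True])
        define A where "A = (\<lambda>\<mu>. \<integral>y. moll \<epsilon> (z - y) \<partial>\<mu>)"
        have A: "ennreal \<bar>A \<mu>\<bar> \<le> ?g \<mu> z" for \<mu>
          unfolding A_def using abs_integral_le_nn_integral[of \<mu> "\<lambda>y. moll \<epsilon> (z - y)"] moll_nonneg by simp
        have "\<bar>?J s\<bar> = \<bar>fst h * (A p1 - A n1) + snd h * (A p2 - A n2)\<bar>"
          unfolding z_def[symmetric] D1[OF z] D2[OF z] A_def ..
        also have "\<dots> \<le> \<bar>fst h\<bar> * \<bar>A p1 - A n1\<bar> + \<bar>snd h\<bar> * \<bar>A p2 - A n2\<bar>"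
          by (simp only: abs_mult[symmetric] abs_triangle_ineq)
        also have "\<dots> \<le> norm h * (\<bar>A p1\<bar> + \<bar>A n1\<bar>) + norm h * (\<bar>A p2\<bar> + \<bar>A n2\<bar>)"
          by (intro add_mono mult_mono abs_fst_snd_le_norm abs_triangle_ineq4) auto
        also have "\<dots> = norm h * (\<bar>A p1\<bar> + \<bar>A n1\<bar> + \<bar>A p2\<bar> + \<bar>A n2\<bar>)" by (simp add: algebra_simps)
        finally have "ennreal \<bar>?J s\<bar> \<le> ennreal (norm h * (\<bar>A p1\<bar> + \<bar>A n1\<bar> + \<bar>A p2\<bar> + \<bar>A n2\<bar>))" by (rule ennreal_leI)
        also have "\<dots> = ennreal (norm h) * (ennreal \<bar>A p1\<bar> + ennreal \<bar>A n1\<bar> + ennreal \<bar>A p2\<bar> + ennreal \<bar>A n2\<bar>)"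
          by (simp add: ennreal_mult)
        also have "\<dots> \<le> ennreal (norm h) * G z" unfolding G_def by (intro mult_left_mono add_mono A) simp
        finally show ?thesis using True by (simp add: z_def)
      qed simp
    qed
    finally show ?thesis .
  qed
  have "(\<integral>\<^sup>+x. ennreal \<bar>V (x + h) - V x\<bar> * indicator (shr \<epsilon>) (x + h) * indicator (shr \<epsilon>) x \<partial>lborel)
    \<le> (\<integral>\<^sup>+x. \<integral>\<^sup>+s. indicator {0..1} s * (ennreal (norm h) * G (x + s *\<^sub>R h)) \<partial>lborel \<partial>lborel)"
  proof (rule nn_integral_mono)
    fix x
    show "ennreal \<bar>V (x + h) - V x\<bar> * indicator (shr \<epsilon>) (x + h) * indicator (shr \<epsilon>) x
      \<le> (\<integral>\<^sup>+s. indicator {0..1} s * (ennreal (norm h) * G (x + s *\<^sub>R h)) \<partial>lborel)"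
      using bound[of x] by (cases "x \<in> shr \<epsilon>"; cases "x + h \<in> shr \<epsilon>") simp_all
  qed
  also have "\<dots> = (\<integral>\<^sup>+s. \<integral>\<^sup>+x. indicator {0..1} s * (ennreal (norm h) * G (x + s *\<^sub>R h)) \<partial>lborel \<partial>lborel)"
    by (rule lborel_pair.Fubini'[symmetric]) measurable
  also have "\<dots> = (\<integral>\<^sup>+s. (ennreal (norm h) * (\<integral>\<^sup>+z. G z \<partial>lborel)) * indicator {0..1::real} s \<partial>lborel)"
    by (intro nn_integral_cong) (simp add: nn_integral_cmult nn_integral_lborel_shift mult.commute)
  also have "\<dots> = ennreal (norm h) * (\<integral>\<^sup>+z. G z \<partial>lborel)"
    by (subst nn_integral_cmult_indicator) simp_all
  finally show ?thesis by (simp only: G_int)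
qed

lemma shr_mono: "e \<le> e' \<Longrightarrow> shr e' \<subseteq> shr e"
  unfolding shr_def by (intro Sigma_mono) auto

lemma shr_eventually_indicator:
  "(\<lambda>n. indicator (shr (1 / Suc n)) x) \<longlonglongrightarrow> (indicator \<theta> x :: ennreal)"
proof (cases "x \<in> \<theta>")
  case True
  define m where "m = min (min (fst x - a) (b - fst x)) (min (snd x - c) (d - snd x))"
  have "m > 0" using True by (auto simp: m_def)
  then have "\<forall>\<^sub>F n in sequentially. 1 / Suc n < m"
    using order_tendstoD(2)[OF LIMSEQ_inverse_real_of_nat] by (simp add: inverse_eq_divide)
  then have "\<forall>\<^sub>F n in sequentially. indicator (shr (1 / Suc n)) x = (indicator \<theta> x :: ennreal)"
  proof eventually_elim
    case (elim n)
    then have "x \<in> shr (1 / Suc n)" by (auto simp: shr_def m_def mem_Times_iff)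
    then show ?case using True by simp
  qed
  then show ?thesis by (rule tendsto_eventually)
next
  case False
  have "x \<notin> shr (1 / Suc n)" for n
  proof
    assume "x \<in> shr (1 / Suc n)"
    moreover have "shr (1 / Suc n) \<subseteq> shr 0" by (rule shr_mono) simp
    ultimately show False using False by (auto simp: shr_def)
  qed
  then show ?thesis using False by simp
qed

text \<open>Once 2 \<epsilon> < d, replacing \<open>v\<close> by its mollification costs \<eta> at
  \<open>x\<close> and \<eta> at x + h, relative to the factor \<open>I\<close>. The mollified
  increment contributes |h| M with the same factor, which then cancels.\<close>

lemma BV_diffq_shr:
  assumes v: "integrable lborel v" and "\<eta> > 0" and M: "M \<ge> 0"
    and diff: "\<And>\<epsilon> I. \<epsilon> > 0 \<Longrightarrow> I > 0 \<Longrightarrow> (\<integral>\<^sup>+y. ennreal (moll \<epsilon> y) \<partial>lborel) = ennreal I \<Longrightarrow>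
      (\<integral>\<^sup>+x. ennreal \<bar>(\<integral>y. v y * moll \<epsilon> (x + h - y) \<partial>lborel) - (\<integral>y. v y * moll \<epsilon> (x - y) \<partial>lborel)\<bar>
         * indicator (shr \<epsilon>) (x + h) * indicator (shr \<epsilon>) x \<partial>lborel) \<le> ennreal (norm h) * (ennreal I * ennreal M)"
  shows "\<exists>e>0. \<forall>\<epsilon>. 0 < \<epsilon> \<longrightarrow> \<epsilon> < e \<longrightarrow>
    (\<integral>\<^sup>+x. ennreal \<bar>v (x + h) - v x\<bar> * indicator (shr \<epsilon>) (x + h) * indicator (shr \<epsilon>) x \<partial>lborel) \<le> ennreal (2 * \<eta> + norm h * M)"
proof -
  have [measurable]: "v \<in> borel_measurable borel" using borel_measurable_integrable[OF v] by simp
  obtain d where "d > 0" and d: "\<And>z. norm z < d \<Longrightarrow> (\<integral>\<^sup>+x. ennreal \<bar>v (x + z) - v x\<bar> \<partial>lborel) \<le> ennreal \<eta>"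
    using L1_translation_continuous[OF v \<open>\<eta> > 0\<close>] by blast
  have "(\<integral>\<^sup>+x. ennreal \<bar>v (x + h) - v x\<bar> * indicator (shr \<epsilon>) (x + h) * indicator (shr \<epsilon>) x \<partial>lborel) \<le> ennreal (2 * \<eta> + norm h * M)"
    (is "?L \<le> _") if \<epsilon>: "0 < \<epsilon>" "\<epsilon> < d / 2" for \<epsilon>
  proof -
    obtain I where I: "I > 0" "(\<integral>\<^sup>+y. ennreal (moll \<epsilon> y) \<partial>lborel) = ennreal I"
      by (rule moll_integral_pos[OF \<epsilon>(1)])
    define V where "V = (\<lambda>x. \<integral>y. v y * moll \<epsilon> (x - y) \<partial>lborel)"
    have [measurable]: "V \<in> borel_measurable borel" unfolding V_def by measurable
    let ?i = "\<lambda>x. indicator (shr \<epsilon>) (x + h) * indicator (shr \<epsilon>) x :: ennreal"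
    have i1: "?i x \<le> 1" for x by (simp add: indicator_def)
    have app: "(\<integral>\<^sup>+x. ennreal \<bar>I * v x - V x\<bar> \<partial>lborel) \<le> ennreal I * ennreal \<eta>"
      unfolding V_def using \<epsilon> by (intro mollify_L1_approx[OF v I(2,1)] d) auto
    have apph: "(\<integral>\<^sup>+x. ennreal \<bar>I * v (x + h) - V (x + h)\<bar> \<partial>lborel) \<le> ennreal I * ennreal \<eta>"
      using app nn_integral_lborel_shift[of "\<lambda>x. ennreal \<bar>I * v x - V x\<bar>" h] by simp
    have "ennreal I * ?L = (\<integral>\<^sup>+x. ennreal I * (ennreal \<bar>v (x + h) - v x\<bar> * indicator (shr \<epsilon>) (x + h) * indicator (shr \<epsilon>) x) \<partial>lborel)"
      by (rule nn_integral_cmult[symmetric]) measurable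
    also have "\<dots> \<le> (\<integral>\<^sup>+x. ennreal \<bar>I * v (x + h) - V (x + h)\<bar> + ennreal \<bar>I * v x - V x\<bar>
        + ennreal \<bar>V (x + h) - V x\<bar> * indicator (shr \<epsilon>) (x + h) * indicator (shr \<epsilon>) x \<partial>lborel)"
    proof (rule nn_integral_mono)
      fix x
      have "I * \<bar>v (x + h) - v x\<bar> = \<bar>I * v (x + h) - I * v x\<bar>"
        using I by (simp add: abs_mult right_diff_distrib[symmetric])
      also have "\<dots> \<le> \<bar>I * v (x + h) - V (x + h)\<bar> + \<bar>I * v x - V x\<bar> + \<bar>V (x + h) - V x\<bar>" by linarith
      finally have "ennreal (I * \<bar>v (x + h) - v x\<bar>) \<le> ennreal (\<bar>I * v (x + h) - V (x + h)\<bar> + \<bar>I * v x - V x\<bar> + \<bar>V (x + h) - V x\<bar>)"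
        by (rule ennreal_leI)
      then have "ennreal I * ennreal \<bar>v (x + h) - v x\<bar> \<le> ennreal \<bar>I * v (x + h) - V (x + h)\<bar> + ennreal \<bar>I * v x - V x\<bar> + ennreal \<bar>V (x + h) - V x\<bar>"
        using I(1) by (simp add: ennreal_mult)
      then show "ennreal I * (ennreal \<bar>v (x + h) - v x\<bar> * indicator (shr \<epsilon>) (x + h) * indicator (shr \<epsilon>) x)
        \<le> ennreal \<bar>I * v (x + h) - V (x + h)\<bar> + ennreal \<bar>I * v x - V x\<bar>
          + ennreal \<bar>V (x + h) - V x\<bar> * indicator (shr \<epsilon>) (x + h) * indicator (shr \<epsilon>) x"
        by (cases "x \<in> shr \<epsilon>"; cases "x + h \<in> shr \<epsilon>") simp_all
    qed
    also have "\<dots> = (\<integral>\<^sup>+x. ennreal \<bar>I * v (x + h) - V (x + h)\<bar> \<partial>lborel) + (\<integral>\<^sup>+x. ennreal \<bar>I * v x - V x\<bar> \<partial>lborel)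
        + (\<integral>\<^sup>+x. ennreal \<bar>V (x + h) - V x\<bar> * indicator (shr \<epsilon>) (x + h) * indicator (shr \<epsilon>) x \<partial>lborel)"
      by (subst nn_integral_add; (subst nn_integral_add)?; measurable)
    also have "\<dots> \<le> ennreal I * ennreal \<eta> + ennreal I * ennreal \<eta> + ennreal (norm h) * (ennreal I * ennreal M)"
      unfolding V_def by (intro add_mono app[unfolded V_def] apph[unfolded V_def] diff \<epsilon> I)
    also have "\<dots> = ennreal I * (ennreal \<eta> + ennreal \<eta> + ennreal (norm h) * ennreal M)"
      by (simp add: distrib_left mult_ac)
    also have "\<dots> = ennreal I * ennreal (2 * \<eta> + norm h * M)"
      using M \<open>\<eta> > 0\<close>
      by (simp only: mult_2 ennreal_plus[OF add_nonneg_nonneg[OF less_imp_le less_imp_le] mult_nonneg_nonneg]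
          ennreal_plus[OF less_imp_le less_imp_le] ennreal_mult[OF norm_ge_zero] norm_ge_zero)
    finally have "ennreal I * ?L \<le> ennreal I * ennreal (2 * \<eta> + norm h * M)" .
    moreover have "ennreal I \<noteq> 0" using I by (simp add: ennreal_eq_0_iff)
    ultimately show ?thesis using ennreal_mult_le_mult_iff[OF _ ennreal_neq_top] by blast
  qed
  then show ?thesis using \<open>d > 0\<close> by (intro exI[of _ "d / 2"]) auto
qed

text \<open>For small \<epsilon> the bound holds on \<open>shr \<epsilon>\<close> up to an error e.
  Monotone convergence along \<epsilon> = 1 / (n + 1) exhausts the rectangle, and then e tends to 0.
  Cutting \<open>u\<close> off to the rectangle makes it integrable on the plane.\<close>

proposition BV_diffq_on:
  assumes u: "BV \<theta> u"
  defines "v \<equiv> \<lambda>x. indicator \<theta> x * u x"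
  shows "integrable lborel v" "diffq_on 1 \<theta> v"
proof -
  show v: "integrable lborel v" using u by (simp add: BV_def set_integrable_def v_def)
  have [measurable]: "v \<in> borel_measurable borel" using borel_measurable_integrable[OF v] by simp
  obtain p1 n1 p2 n2 where fin: "fin_meas_on \<theta> p1" "fin_meas_on \<theta> n1" "fin_meas_on \<theta> p2" "fin_meas_on \<theta> n2"
    and D1: "\<And>\<epsilon> x. \<epsilon> > 0 \<Longrightarrow> x \<in> shr \<epsilon> \<Longrightarrow>
       (\<integral>y. v y * moll1 \<epsilon> (x - y) \<partial>lborel) = (\<integral>y. moll \<epsilon> (x - y) \<partial>p1) - (\<integral>y. moll \<epsilon> (x - y) \<partial>n1)"
    and D2: "\<And>\<epsilon> x. \<epsilon> > 0 \<Longrightarrow> x \<in> shr \<epsilon> \<Longrightarrow>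
       (\<integral>y. v y * moll2 \<epsilon> (x - y) \<partial>lborel) = (\<integral>y. moll \<epsilon> (x - y) \<partial>p2) - (\<integral>y. moll \<epsilon> (x - y) \<partial>n2)"
    unfolding v_def by (rule BV_moll[OF u]) blast
  have mu: "emeasure \<mu> UNIV = ennreal (measure \<mu> UNIV)" if "fin_meas_on \<theta> \<mu>" for \<mu>
    using that unfolding fin_meas_on_def by (simp add: finite_measure.emeasure_eq_measure)
  define M where "M = measure p1 UNIV + measure n1 UNIV + measure p2 UNIV + measure n2 UNIV"
  have M0: "M \<ge> 0" by (simp add: M_def)
  have M: "emeasure p1 UNIV + emeasure n1 UNIV + emeasure p2 UNIV + emeasure n2 UNIV = ennreal M"
    using fin by (simp add: mu M_def)
  have diff: "(\<integral>\<^sup>+x. ennreal \<bar>(\<integral>y. v y * moll \<epsilon> (x + h - y) \<partial>lborel) - (\<integral>y. v y * moll \<epsilon> (x - y) \<partial>lborel)\<bar>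
         * indicator (shr \<epsilon>) (x + h) * indicator (shr \<epsilon>) x \<partial>lborel) \<le> ennreal (norm h) * (ennreal I * ennreal M)"
    if "\<epsilon> > 0" "I > 0" "(\<integral>\<^sup>+y. ennreal (moll \<epsilon> y) \<partial>lborel) = ennreal I" for \<epsilon> I h
    unfolding M[symmetric]
    by (rule mollified_BV_difference[OF v that(1,3,2) fin D1[OF that(1)] D2[OF that(1)]])
  have "(\<integral>\<^sup>+x. ennreal \<bar>v (x + h) - v x\<bar> * indicator \<theta> (x + h) * indicator \<theta> x \<partial>lborel) \<le> ennreal (M * norm h)" (is "?L \<le> _") for h
  proof (rule ennreal_le_epsilon)
    fix e :: real assume "e > 0"
    let ?f = "\<lambda>n x. ennreal \<bar>v (x + h) - v x\<bar> * indicator (shr (1 / Suc n)) (x + h) * indicator (shr (1 / Suc n)) x"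
    obtain e' where "e' > 0" and e': "\<And>\<epsilon>. 0 < \<epsilon> \<Longrightarrow> \<epsilon> < e' \<Longrightarrow>
      (\<integral>\<^sup>+x. ennreal \<bar>v (x + h) - v x\<bar> * indicator (shr \<epsilon>) (x + h) * indicator (shr \<epsilon>) x \<partial>lborel) \<le> ennreal (2 * (e / 2) + norm h * M)"
      using BV_diffq_shr[OF v half_gt_zero[OF \<open>e > 0\<close>] M0 diff] by blast
    have "(\<lambda>n. integral\<^sup>N lborel (?f n)) \<longlonglongrightarrow> ?L"
    proof (rule nn_integral_LIMSEQ)
      show "incseq ?f"
      proof (intro incseq_SucI le_funI mult_mono)
        fix n x
        have "shr (1 / Suc n) \<subseteq> shr (1 / Suc (Suc n))" by (intro shr_mono divide_left_mono) auto
        then show "indicator (shr (1 / Suc n)) (x + h) \<le> (indicator (shr (1 / Suc (Suc n))) (x + h) :: ennreal)"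
          "indicator (shr (1 / Suc n)) x \<le> (indicator (shr (1 / Suc (Suc n))) x :: ennreal)"
          by (auto simp: indicator_def)
      qed auto
      show "(\<lambda>n. ?f n x) \<longlonglongrightarrow> ennreal \<bar>v (x + h) - v x\<bar> * indicator \<theta> (x + h) * indicator \<theta> x" for x
        by (intro tendsto_mult_ennreal tendsto_const shr_eventually_indicator) (auto simp: indicator_def)
    qed measurable
    moreover have "\<forall>\<^sub>F n in sequentially. 1 / Suc n < e'"
      using order_tendstoD(2)[OF LIMSEQ_inverse_real_of_nat \<open>e' > 0\<close>] by (simp add: inverse_eq_divide)
    then have "\<forall>\<^sub>F n in sequentially. integral\<^sup>N lborel (?f n) \<le> ennreal (2 * (e / 2) + norm h * M)"
      by (rule eventually_mono) (rule e', auto)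
    ultimately have "?L \<le> ennreal (2 * (e / 2) + norm h * M)"
      by (rule tendsto_upperbound) simp
    also have "\<dots> = ennreal (M * norm h) + ennreal e" using M0 \<open>e > 0\<close> by (simp add: mult.commute add.commute)
    finally show "?L \<le> ennreal (M * norm h) + ennreal e" .
  qed
  \<comment> \<open>The estimate holds for every \<open>h\<close>; the radius 1 is
    arbitrary.\<close>
  then show "diffq_on 1 \<theta> v"
    unfolding diffq_on_def using M0 by (intro exI[of _ M] exI[of _ 1]) simp
qed

end

subsection \<open>The layers\<close>

lemma borel_measurable_conv_measure:
  fixes \<nu> :: "pt measure" and W :: "pt \<Rightarrow> real"
  assumes \<nu>: "sets \<nu> = sets borel" "finite_measure \<nu>" and W[measurable]: "W \<in> borel_measurable borel"
  shows "(\<lambda>x. \<integral>z. W (x - z) \<partial>\<nu>) \<in> borel_measurable borel"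
proof -
  interpret finite_measure \<nu> by (rule \<nu>)
  note [measurable_cong] = \<nu>(1)
  show ?thesis by measurable
qed

text \<open>Jensen's inequality for the measure \<open>\<nu>\<close> (in the form of Cauchy-Schwarz) and Tonelli.\<close>

lemma nn_integral_conv_measure_square_le:
  fixes \<nu> :: "pt measure" and W :: "pt \<Rightarrow> real"
  assumes \<nu>: "sets \<nu> = sets borel" "finite_measure \<nu>" and W[measurable]: "W \<in> borel_measurable borel"
  shows "(\<integral>\<^sup>+x. (\<integral>\<^sup>+z. ennreal \<bar>W (x - z)\<bar> \<partial>\<nu>)\<^sup>2 \<partial>lborel) \<le> (\<integral>\<^sup>+x. ennreal ((W x)\<^sup>2) \<partial>lborel) * (emeasure \<nu> UNIV)\<^sup>2"
proof -
  interpret finite_measure \<nu> by (rule \<nu>)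
  note [measurable_cong] = \<nu>(1)
  have sp: "space \<nu> = UNIV" using sets_eq_imp_space_eq[OF \<nu>(1)] by simp
  have "(\<integral>\<^sup>+x. (\<integral>\<^sup>+z. ennreal \<bar>W (x - z)\<bar> \<partial>\<nu>)\<^sup>2 \<partial>lborel)
    \<le> (\<integral>\<^sup>+x. (\<integral>\<^sup>+z. ennreal ((W (x - z))\<^sup>2) \<partial>\<nu>) * emeasure \<nu> UNIV \<partial>lborel)"
  proof (rule nn_integral_mono)
    fix x
    have "(\<integral>\<^sup>+z. ennreal \<bar>W (x - z) * 1\<bar> \<partial>\<nu>)\<^sup>2 \<le> (\<integral>\<^sup>+z. ennreal ((W (x - z))\<^sup>2) \<partial>\<nu>) * (\<integral>\<^sup>+z. ennreal (1\<^sup>2) \<partial>\<nu>)"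
      by (rule Cauchy_Schwarz_nn_integral_real) measurable
    then show "(\<integral>\<^sup>+z. ennreal \<bar>W (x - z)\<bar> \<partial>\<nu>)\<^sup>2 \<le> (\<integral>\<^sup>+z. ennreal ((W (x - z))\<^sup>2) \<partial>\<nu>) * emeasure \<nu> UNIV"
      by (simp add: sp)
  qed
  also have "\<dots> = (\<integral>\<^sup>+x. \<integral>\<^sup>+z. ennreal ((W (x - z))\<^sup>2) \<partial>\<nu> \<partial>lborel) * emeasure \<nu> UNIV"
    by (rule nn_integral_multc) measurable
  also have "(\<integral>\<^sup>+x. \<integral>\<^sup>+z. ennreal ((W (x - z))\<^sup>2) \<partial>\<nu> \<partial>lborel) = (\<integral>\<^sup>+x. ennreal ((W x)\<^sup>2) \<partial>lborel) * emeasure \<nu> UNIV"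
    by (rule nn_integral_conv_measure[OF \<nu>]) measurable
  finally show ?thesis by (simp add: power2_eq_square mult.assoc)
qed

lemma ennreal_square_le: "ennreal \<bar>t\<bar> \<le> y \<Longrightarrow> ennreal (t\<^sup>2) \<le> y\<^sup>2"
  using power_mono[of "ennreal \<bar>t\<bar>" y 2] by (simp add: ennreal_power)

lemma conv_measure_L2:
  fixes \<nu> :: "pt measure" and W :: "pt \<Rightarrow> real"
  assumes \<nu>: "sets \<nu> = sets borel" "finite_measure \<nu>" and W[measurable]: "W \<in> borel_measurable borel"
  shows "(\<integral>\<^sup>+x. ennreal ((\<integral>z. W (x - z) \<partial>\<nu>)\<^sup>2) \<partial>lborel) \<le> (\<integral>\<^sup>+x. ennreal ((W x)\<^sup>2) \<partial>lborel) * (emeasure \<nu> UNIV)\<^sup>2"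
  by (rule order_trans[OF nn_integral_mono nn_integral_conv_measure_square_le[OF \<nu> W]])
     (rule ennreal_square_le[OF abs_integral_le_nn_integral])

text \<open>The squared integral of |W (x - z)| over \<nu> has a finite Lebesgue integral in
  \<open>x\<close>, hence is finite for almost every \<open>x\<close>.\<close>

lemma AE_integrable_conv_measure:
  fixes \<nu> :: "pt measure" and W :: "pt \<Rightarrow> real"
  assumes \<nu>: "sets \<nu> = sets borel" "finite_measure \<nu>" and W[measurable]: "W \<in> borel_measurable borel"
    and W2: "(\<integral>\<^sup>+x. ennreal ((W x)\<^sup>2) \<partial>lborel) < \<infinity>"
  shows "AE x in lborel. integrable \<nu> (\<lambda>z. W (x - z))"
proof -
  interpret finite_measure \<nu> by (rule \<nu>)
  note [measurable_cong] = \<nu>(1)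
  have fin: "(\<integral>\<^sup>+x. (\<integral>\<^sup>+z. ennreal \<bar>W (x - z)\<bar> \<partial>\<nu>)\<^sup>2 \<partial>lborel) \<noteq> \<infinity>"
  proof -
    have "emeasure \<nu> UNIV < top" using emeasure_finite[of UNIV] by (simp add: less_top[symmetric])
    then have "(\<integral>\<^sup>+x. ennreal ((W x)\<^sup>2) \<partial>lborel) * (emeasure \<nu> UNIV)\<^sup>2 < \<infinity>"
      using W2 by (simp add: ennreal_mult_less_top power2_eq_square)
    with nn_integral_conv_measure_square_le[OF \<nu> W] show ?thesis by (metis infinity_ennreal_def leD)
  qed
  have "AE x in lborel. (\<integral>\<^sup>+z. ennreal \<bar>W (x - z)\<bar> \<partial>\<nu>)\<^sup>2 \<noteq> \<infinity>"
    by (rule nn_integral_PInf_AE[OF _ fin]) measurable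
  then show ?thesis
  proof eventually_elim
    case (elim x)
    then have "(\<integral>\<^sup>+z. ennreal \<bar>W (x - z)\<bar> \<partial>\<nu>) < \<infinity>" by (cases "(\<integral>\<^sup>+z. ennreal \<bar>W (x - z)\<bar> \<partial>\<nu>) = top") (auto simp: power2_eq_square less_top)
    then show ?case by (simp add: integrable_iff_bounded)
  qed
qed

section \<open>Signed measures as balanced sums of nonnegative measures\<close>

lemma add_pairs_eq:
  fixes a1 a2 a3 a4 b1 b2 b3 b4 :: ennreal
  assumes "a1 + a2 = a3 + a4" "b1 + b2 = b3 + b4"
  shows "b1 + a1 + (b2 + a2) = b3 + a3 + (b4 + a4)"
proof -
  have "b1 + a1 + (b2 + a2) = (b1 + b2) + (a1 + a2)" by (simp add: ac_simps)
  also have "\<dots> = (b3 + b4) + (a3 + a4)" using assms by simp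
  also have "\<dots> = b3 + a3 + (b4 + a4)" by (simp add: ac_simps)
  finally show ?thesis .
qed

text \<open>An identity between differences of measures is written as one between sums, which avoids
  subtracting extended values. The standard induction carries it from sets to nonnegative
  functions.\<close>

lemma nn_integral_measure_sum_eq:
  assumes s: "sets M1 = sets N" "sets M2 = sets N" "sets M3 = sets N" "sets M4 = sets N"
    and eq: "\<And>A. A \<in> sets N \<Longrightarrow> emeasure M1 A + emeasure M2 A = emeasure M3 A + emeasure M4 A"
    and f: "f \<in> borel_measurable N"
  shows "(\<integral>\<^sup>+x. f x \<partial>M1) + (\<integral>\<^sup>+x. f x \<partial>M2) = (\<integral>\<^sup>+x. f x \<partial>M3) + (\<integral>\<^sup>+x. f x \<partial>M4)"
proof -
  note bm = measurable_cong_sets[OF s(1) refl] measurable_cong_sets[OF s(2) refl]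
    measurable_cong_sets[OF s(3) refl] measurable_cong_sets[OF s(4) refl]
  show ?thesis
    using f
  proof (induction rule: borel_measurable_induct)
    case (cong f g)
    have sp: "space M1 = space N" "space M2 = space N" "space M3 = space N" "space M4 = space N"
      by (rule sets_eq_imp_space_eq[OF s(1)] sets_eq_imp_space_eq[OF s(2)] sets_eq_imp_space_eq[OF s(3)] sets_eq_imp_space_eq[OF s(4)])+
    have "(\<integral>\<^sup>+x. f x \<partial>M) = (\<integral>\<^sup>+x. g x \<partial>M)" if "space M = space N" for M
      using cong(3) that by (intro nn_integral_cong) auto
    then show ?case using cong(4) sp by simp
  next
    case (set A)
    then show ?case using eq s by simp
  next
    case (mult u c)
    have "u \<in> borel_measurable M1" "u \<in> borel_measurable M2" "u \<in> borel_measurable M3" "u \<in> borel_measurable M4"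
      using mult(2) by (simp_all only: bm)
    then show ?case using mult(4) by (simp add: nn_integral_cmult distrib_left[symmetric])
  next
    case (add u v)
    have "u \<in> borel_measurable M1" "u \<in> borel_measurable M2" "u \<in> borel_measurable M3" "u \<in> borel_measurable M4"
      "v \<in> borel_measurable M1" "v \<in> borel_measurable M2" "v \<in> borel_measurable M3" "v \<in> borel_measurable M4"
      using add(1,3) by (simp_all only: bm)
    note m = this
    have sum: "(\<integral>\<^sup>+x. v x + u x \<partial>M) = (\<integral>\<^sup>+x. v x \<partial>M) + (\<integral>\<^sup>+x. u x \<partial>M)"
      if "u \<in> borel_measurable M" "v \<in> borel_measurable M" for M
      using that by (intro nn_integral_add)
    show ?case
      unfolding sum[OF m(1,5)] sum[OF m(2,6)] sum[OF m(3,7)] sum[OF m(4,8)]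
      by (rule add_pairs_eq[OF add.IH])
  next
    case (seq U)
    have m: "U i \<in> borel_measurable M1" "U i \<in> borel_measurable M2" "U i \<in> borel_measurable M3" "U i \<in> borel_measurable M4" for i
      using seq(1) by (simp_all only: bm)
    have SUP: "(\<integral>\<^sup>+x. Sup (range U) x \<partial>M) = (SUP i. \<integral>\<^sup>+x. U i x \<partial>M)" if "\<And>i. U i \<in> borel_measurable M" for M
      using nn_integral_monotone_convergence_SUP[OF seq(3) that] by (simp add: image_comp)
    have inc: "incseq (\<lambda>i. \<integral>\<^sup>+x. U i x \<partial>M)" for M
      using seq(3) by (auto simp: incseq_def le_fun_def intro!: nn_integral_mono)
    show ?case
      unfolding SUP[OF m(1)] SUP[OF m(2)] SUP[OF m(3)] SUP[OF m(4)]
        ennreal_SUP_add[OF inc inc, symmetric] seq.IH ..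
  qed
qed

text \<open>The nonnegative version applies to the positive and to the negative part of
  \<open>g\<close>; integrability makes all values finite, so the identities pass to the
  reals.\<close>

lemma integral_measure_sum_eq:
  fixes g :: "'a \<Rightarrow> real"
  assumes nn: "\<And>f. f \<in> borel_measurable N \<Longrightarrow> (\<integral>\<^sup>+x. f x \<partial>M1) + (\<integral>\<^sup>+x. f x \<partial>M2) = (\<integral>\<^sup>+x. f x \<partial>M3) + (\<integral>\<^sup>+x. f x \<partial>M4)"
    and g: "g \<in> borel_measurable N"
    and int: "integrable M1 g" "integrable M2 g" "integrable M3 g" "integrable M4 g"
  shows "(\<integral>x. g x \<partial>M1) + (\<integral>x. g x \<partial>M2) = (\<integral>x. g x \<partial>M3) + (\<integral>x. g x \<partial>M4)"
proof -
  have part: "enn2real (\<integral>\<^sup>+x. ennreal (k x) \<partial>M1) + enn2real (\<integral>\<^sup>+x. ennreal (k x) \<partial>M2)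
      = enn2real (\<integral>\<^sup>+x. ennreal (k x) \<partial>M3) + enn2real (\<integral>\<^sup>+x. ennreal (k x) \<partial>M4)"
    if k: "k \<in> borel_measurable N" "integrable M1 k" "integrable M2 k" "integrable M3 k" "integrable M4 k" for k :: "'a \<Rightarrow> real"
  proof -
    have fin: "(\<integral>\<^sup>+x. ennreal (k x) \<partial>M) < top" if "integrable M k" for M
    proof -
      have "(\<integral>\<^sup>+x. ennreal (k x) \<partial>M) \<le> (\<integral>\<^sup>+x. ennreal (norm (k x)) \<partial>M)" by (intro nn_integral_mono ennreal_leI) auto
      also have "\<dots> < top" using that by (simp add: integrable_iff_bounded)
      finally show ?thesis .
    qed
    have "(\<lambda>x. ennreal (k x)) \<in> borel_measurable N" using k(1) by measurable
    from nn[OF this] show ?thesis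
      using fin[OF k(2)] fin[OF k(3)] fin[OF k(4)] fin[OF k(5)]
      by (simp flip: enn2real_plus)
  qed
  have mg: "(\<lambda>x. - g x) \<in> borel_measurable N" using g by measurable
  show ?thesis
    using part[OF g int] part[OF mg] int by (simp add: real_lebesgue_integral_def)
qed

section \<open>Kernels and regularity of layers on bounded sets\<close>

lemma kernel_of_set:
  assumes \<Sigma>: "rect \<Sigma>" and m: "set_borel_measurable lborel \<Sigma> w" and i: "set_integrable lborel \<Sigma> (\<lambda>y. (w y)\<^sup>2)"
  shows "\<exists>r. L2_kernel r (\<lambda>y. indicator \<Sigma> y * w y)"
proof -
  have "bounded \<Sigma>" using \<Sigma> unfolding rect_def by (auto intro!: bounded_Times)
  then obtain r where r: "\<And>y. y \<in> \<Sigma> \<Longrightarrow> norm y < r" by (meson bounded_pos_less)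
  have eq: "(indicator \<Sigma> y * w y)\<^sup>2 = indicator \<Sigma> y * (w y)\<^sup>2" for y by (simp add: indicator_def)
  have "integrable lborel (\<lambda>y. indicator \<Sigma> y * (w y)\<^sup>2)" using i by (simp add: set_integrable_def)
  then have "(\<integral>\<^sup>+y. ennreal (norm (indicator \<Sigma> y * (w y)\<^sup>2)) \<partial>lborel) < \<infinity>" unfolding integrable_iff_bounded by blast
  then have "(\<integral>\<^sup>+y. ennreal ((indicator \<Sigma> y * w y)\<^sup>2) \<partial>lborel) < \<infinity>" unfolding eq by simp
  moreover have "(\<lambda>y. indicator \<Sigma> y * w y) \<in> borel_measurable borel"
    using m unfolding set_borel_measurable_def real_scaleR_def by (simp only: measurable_lborel2)
  moreover have "indicator \<Sigma> y * w y = 0" if "norm y \<ge> r" for y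
    using r[of y] that by (auto simp: indicator_def)
  ultimately show ?thesis unfolding L2_kernel_def by blast
qed

lemma conv_fun_eq_conv: "conv_fun \<Sigma> w v = conv (\<lambda>y. indicator \<Sigma> y * w y) v"
  by (simp add: fun_eq_iff conv_fun_def conv_def set_lebesgue_integral_def mult.assoc)

text \<open>Measurability is global although the norm is local, because layers are defined on the
  whole plane and are composed with the folding.\<close>

definition L2_on :: "pt set \<Rightarrow> (pt \<Rightarrow> real) \<Rightarrow> bool" where
  "L2_on S f \<longleftrightarrow> f \<in> borel_measurable borel \<and> (\<integral>\<^sup>+x. ennreal ((f x)\<^sup>2) * indicator S x \<partial>lborel) < \<infinity>"

lemma continuous_imp_L2_on:
  assumes F: "continuous_on UNIV F" and S: "bounded S" "S \<in> sets borel"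
  shows "L2_on S F"
proof -
  have "compact (closure S)" using S by simp
  then have "bounded (F ` closure S)"
    by (intro compact_imp_bounded compact_continuous_image continuous_on_subset[OF F]) auto
  then obtain B where "\<forall>x\<in>closure S. \<bar>F x\<bar> \<le> B" by (auto simp: bounded_iff)
  then have B: "\<bar>F x\<bar> \<le> B" if "x \<in> S" for x using that closure_subset by blast
  have "(\<integral>\<^sup>+x. ennreal ((F x)\<^sup>2) * indicator S x \<partial>lborel) \<le> (\<integral>\<^sup>+x. ennreal (B\<^sup>2) * indicator S x \<partial>lborel)"
  proof (rule nn_integral_mono)
    fix x show "ennreal ((F x)\<^sup>2) * indicator S x \<le> ennreal (B\<^sup>2) * indicator S x"
    proof (cases "x \<in> S")
      case True
      have "\<bar>F x\<bar>\<^sup>2 \<le> B\<^sup>2" using B[OF True] by (intro power_mono) auto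
      then show ?thesis using True by (simp add: ennreal_leI)
    qed simp
  qed
  also have "\<dots> = ennreal (B\<^sup>2) * emeasure lborel S" using S by (intro nn_integral_cmult_indicator) simp
  also have "\<dots> < \<infinity>" using emeasure_bounded_finite[OF S(1)] by (simp add: ennreal_mult_less_top)
  finally show ?thesis using borel_measurable_continuous_onI[OF F] by (simp add: L2_on_def)
qed

text \<open>\<sigma> need not vanish at 0, so the Lipschitz bound leaves the constant \<sigma>(b);
  it is square integrable because \<open>S\<close> is bounded.\<close>

lemma Lipschitz_comp_L2_on:
  assumes \<sigma>: "K-lipschitz_on UNIV \<sigma>" and f: "L2_on S f" and S: "bounded S" "S \<in> sets borel"
  shows "L2_on S (\<lambda>x. \<sigma> (f x + b))"
proof -
  have [measurable]: "f \<in> borel_measurable borel" "S \<in> sets borel" using f S by (auto simp: L2_on_def)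
  have [measurable]: "\<sigma> \<in> borel_measurable borel"
    using lipschitz_on_continuous_on[OF \<sigma>] by (rule borel_measurable_continuous_onI)
  have K: "\<bar>\<sigma> s - \<sigma> t\<bar> \<le> K * \<bar>s - t\<bar>" for s t
    using lipschitz_onD[OF \<sigma>, of s t] by (simp add: dist_real_def)
  have le: "(\<sigma> (f x + b))\<^sup>2 \<le> 2 * (\<sigma> b)\<^sup>2 + 2 * K\<^sup>2 * (f x)\<^sup>2" for x
  proof -
    have "\<bar>\<sigma> (f x + b) - \<sigma> b\<bar>\<^sup>2 \<le> (K * \<bar>f x\<bar>)\<^sup>2"
      using K[of "f x + b" b] by (intro power_mono) auto
    then have "(\<sigma> (f x + b) - \<sigma> b)\<^sup>2 \<le> K\<^sup>2 * (f x)\<^sup>2" by (simp add: power_mult_distrib)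
    moreover have "(\<sigma> (f x + b))\<^sup>2 \<le> 2 * (\<sigma> b)\<^sup>2 + 2 * (\<sigma> (f x + b) - \<sigma> b)\<^sup>2"
      using zero_le_power2[of "\<sigma> (f x + b) - 2 * \<sigma> b"] by (simp add: power2_eq_square algebra_simps)
    ultimately show ?thesis by linarith
  qed
  have "(\<integral>\<^sup>+x. ennreal ((\<sigma> (f x + b))\<^sup>2) * indicator S x \<partial>lborel)
    \<le> (\<integral>\<^sup>+x. ennreal (2 * (\<sigma> b)\<^sup>2) * indicator S x + ennreal (2 * K\<^sup>2) * (ennreal ((f x)\<^sup>2) * indicator S x) \<partial>lborel)"
  proof (rule nn_integral_mono)
    fix x
    have "ennreal ((\<sigma> (f x + b))\<^sup>2) \<le> ennreal (2 * (\<sigma> b)\<^sup>2 + 2 * K\<^sup>2 * (f x)\<^sup>2)" by (rule ennreal_leI[OF le])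
    also have "\<dots> = ennreal (2 * (\<sigma> b)\<^sup>2) + ennreal (2 * K\<^sup>2) * ennreal ((f x)\<^sup>2)"
      by (subst ennreal_plus) (auto simp only: ennreal_mult'[symmetric] zero_le_power2 mult_nonneg_nonneg zero_le_numeral)
    finally show "ennreal ((\<sigma> (f x + b))\<^sup>2) * indicator S x
      \<le> ennreal (2 * (\<sigma> b)\<^sup>2) * indicator S x + ennreal (2 * K\<^sup>2) * (ennreal ((f x)\<^sup>2) * indicator S x)"
      by (cases "x \<in> S") simp_all
  qed
  also have "\<dots> = ennreal (2 * (\<sigma> b)\<^sup>2) * emeasure lborel S + ennreal (2 * K\<^sup>2) * (\<integral>\<^sup>+x. ennreal ((f x)\<^sup>2) * indicator S x \<partial>lborel)"
    by (subst nn_integral_add) (auto simp: nn_integral_cmult nn_integral_cmult_indicator)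
  also have "\<dots> < \<infinity>"
    using f emeasure_bounded_finite[OF S(1)] by (simp add: L2_on_def ennreal_mult_less_top)
  finally show ?thesis by (simp add: L2_on_def)
qed

lemma Lipschitz_comp_diffq_on:
  assumes \<sigma>: "K-lipschitz_on UNIV \<sigma>" and f: "f \<in> borel_measurable borel" "diffq_on 2 S f" "S \<in> sets borel"
  shows "diffq_on 2 S (\<lambda>x. \<sigma> (f x + b))"
proof -
  have [measurable]: "f \<in> borel_measurable borel" "S \<in> sets borel" by fact+
  have K: "\<bar>\<sigma> s - \<sigma> t\<bar> \<le> K * \<bar>s - t\<bar>" for s t
    using lipschitz_onD[OF \<sigma>, of s t] by (simp add: dist_real_def)
  obtain C \<delta> where C: "C \<ge> 0" "\<delta> > 0" "\<And>h. norm h < \<delta> \<Longrightarrow>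
     (\<integral>\<^sup>+x. ennreal (\<bar>f (x + h) - f x\<bar>\<^sup>2) * indicator S (x + h) * indicator S x \<partial>lborel) \<le> ennreal (C * norm h ^ 2)"
    using f(2) unfolding diffq_on_def by blast
  have "(\<integral>\<^sup>+x. ennreal (\<bar>\<sigma> (f (x + h) + b) - \<sigma> (f x + b)\<bar>\<^sup>2) * indicator S (x + h) * indicator S x \<partial>lborel)
      \<le> ennreal ((K\<^sup>2 * C) * norm h ^ 2)" if "norm h < \<delta>" for h
  proof -
    have "(\<integral>\<^sup>+x. ennreal (\<bar>\<sigma> (f (x + h) + b) - \<sigma> (f x + b)\<bar>\<^sup>2) * indicator S (x + h) * indicator S x \<partial>lborel)
      \<le> (\<integral>\<^sup>+x. ennreal (K\<^sup>2) * (ennreal (\<bar>f (x + h) - f x\<bar>\<^sup>2) * indicator S (x + h) * indicator S x) \<partial>lborel)"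
    proof (rule nn_integral_mono)
      fix x
      have "\<bar>\<sigma> (f (x + h) + b) - \<sigma> (f x + b)\<bar>\<^sup>2 \<le> (K * \<bar>f (x + h) - f x\<bar>)\<^sup>2"
        using K[of "f (x + h) + b" "f x + b"] by (intro power_mono) auto
      then have "\<bar>\<sigma> (f (x + h) + b) - \<sigma> (f x + b)\<bar>\<^sup>2 \<le> K\<^sup>2 * \<bar>f (x + h) - f x\<bar>\<^sup>2"
        by (simp only: power_mult_distrib)
      then have "ennreal (\<bar>\<sigma> (f (x + h) + b) - \<sigma> (f x + b)\<bar>\<^sup>2) \<le> ennreal (K\<^sup>2) * ennreal (\<bar>f (x + h) - f x\<bar>\<^sup>2)"
        using ennreal_leI by (metis ennreal_mult' zero_le_power2)
      then show "ennreal (\<bar>\<sigma> (f (x + h) + b) - \<sigma> (f x + b)\<bar>\<^sup>2) * indicator S (x + h) * indicator S x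
        \<le> ennreal (K\<^sup>2) * (ennreal (\<bar>f (x + h) - f x\<bar>\<^sup>2) * indicator S (x + h) * indicator S x)"
        by (cases "x \<in> S"; cases "x + h \<in> S") simp_all
    qed
    also have "\<dots> = ennreal (K\<^sup>2) * (\<integral>\<^sup>+x. ennreal (\<bar>f (x + h) - f x\<bar>\<^sup>2) * indicator S (x + h) * indicator S x \<partial>lborel)"
      by (rule nn_integral_cmult) measurable
    also have "\<dots> \<le> ennreal (K\<^sup>2) * ennreal (C * norm h ^ 2)" by (intro mult_left_mono C that) simp
    also have "\<dots> = ennreal ((K\<^sup>2 * C) * norm h ^ 2)" using C(1) by (simp add: ennreal_mult mult.assoc)
    finally show ?thesis .
  qed
  then show ?thesis unfolding diffq_on_def using C by (intro exI[of _ "K\<^sup>2 * C"] exI[of _ \<delta>]) simp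
qed

text \<open>A bounded \<open>S\<close> lies in one ball, where a single Lipschitz constant is
  available; squaring and integrating adds the area of \<open>S\<close> as a factor.\<close>

lemma locally_Lipschitz_imp_diffq_on:
  assumes S: "bounded S" "S \<in> sets borel"
    and F: "\<And>R. \<exists>C d. C \<ge> 0 \<and> d > 0 \<and> (\<forall>x h. norm x < R \<longrightarrow> norm h < d \<longrightarrow> \<bar>F (x + h) - F x\<bar> \<le> C * norm h)"
  shows "diffq_on 2 S F"
proof -
  obtain R where R: "\<And>y. y \<in> S \<Longrightarrow> norm y < R" using S(1) by (meson bounded_pos_less)
  obtain C d where C: "C \<ge> 0" "d > 0" "\<And>x h. norm x < R \<Longrightarrow> norm h < d \<Longrightarrow> \<bar>F (x + h) - F x\<bar> \<le> C * norm h"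
    using F[of R] by blast
  have fin: "emeasure lborel S = ennreal (measure lborel S)"
    using emeasure_bounded_finite[OF S(1)] by (simp add: emeasure_eq_ennreal_measure)
  have "(\<integral>\<^sup>+x. ennreal (\<bar>F (x + h) - F x\<bar>\<^sup>2) * indicator S (x + h) * indicator S x \<partial>lborel)
      \<le> ennreal ((C\<^sup>2 * measure lborel S) * norm h ^ 2)" if h: "norm h < d" for h
  proof -
    have "(\<integral>\<^sup>+x. ennreal (\<bar>F (x + h) - F x\<bar>\<^sup>2) * indicator S (x + h) * indicator S x \<partial>lborel)
      \<le> (\<integral>\<^sup>+x. ennreal ((C * norm h)\<^sup>2) * indicator S x \<partial>lborel)"
    proof (rule nn_integral_mono)
      fix x
      show "ennreal (\<bar>F (x + h) - F x\<bar>\<^sup>2) * indicator S (x + h) * indicator S x \<le> ennreal ((C * norm h)\<^sup>2) * indicator S x"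
      proof (cases "x \<in> S")
        case True
        have "\<bar>F (x + h) - F x\<bar>\<^sup>2 \<le> (C * norm h)\<^sup>2" using C(3)[OF R[OF True] h] by (intro power_mono) auto
        then show ?thesis using True by (simp add: indicator_def ennreal_leI)
      qed simp
    qed
    also have "\<dots> = ennreal ((C * norm h)\<^sup>2) * emeasure lborel S" using S by (intro nn_integral_cmult_indicator) simp
    also have "\<dots> = ennreal ((C * norm h)\<^sup>2 * measure lborel S)"
      unfolding fin by (rule ennreal_mult[symmetric]) auto
    finally show ?thesis by (simp add: power_mult_distrib mult_ac)
  qed
  then show ?thesis unfolding diffq_on_def using C by (intro exI[of _ "C\<^sup>2 * measure lborel S"] exI[of _ d]) simp
qed

lemma rectE:
  assumes "rect S"
  obtains a b c d where "rectangle a b c d" "S = {a<..<b} \<times> {c<..<d}"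
  using assms unfolding rect_def rectangle_def by blast

lemma rect_bounded_borel:
  assumes "rect S"
  shows "bounded S" "S \<in> sets borel"
  using assms unfolding rect_def by (auto intro!: bounded_Times borel_Times)

lemma refl_fun_L2loc:
  assumes "rect S" "L2_on S f"
  shows "L2loc (refl_fun S f)"
  using assms(1)
proof (rule rectE)
  fix a b c d assume r: "rectangle a b c d" and S: "S = {a<..<b} \<times> {c<..<d}"
  interpret rectangle a b c d by (rule r)
  show ?thesis using L2loc_refl_fun[of f] assms(2) unfolding L2_on_def S by blast
qed

lemma refl_fun_diffq_loc:
  assumes "rect S" "f \<in> borel_measurable borel" "diffq_on p S f" "p > 0"
  shows "diffq_loc p (refl_fun S f)"
  using assms(1)
proof (rule rectE)
  fix a b c d assume r: "rectangle a b c d" and S: "S = {a<..<b} \<times> {c<..<d}"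
  interpret rectangle a b c d by (rule r)
  show ?thesis using diffq_reflect[OF assms(2) _ assms(4)] assms(3) unfolding S by blast
qed

lemma L2_on_diff:
  assumes f: "L2_on S f" and g: "L2_on S g" and [measurable]: "S \<in> sets borel"
  shows "L2_on S (\<lambda>x. f x - g x)"
proof -
  have [measurable]: "f \<in> borel_measurable borel" "g \<in> borel_measurable borel"
    using f g by (auto simp: L2_on_def)
  have "(\<integral>\<^sup>+x. ennreal ((f x - g x)\<^sup>2) * indicator S x \<partial>lborel)
    \<le> (\<integral>\<^sup>+x. ennreal 2 * (ennreal ((f x)\<^sup>2) * indicator S x) + ennreal 2 * (ennreal ((g x)\<^sup>2) * indicator S x) \<partial>lborel)"
  proof (rule nn_integral_mono)
    fix x
    have "(f x - g x)\<^sup>2 \<le> 2 * (f x)\<^sup>2 + 2 * (g x)\<^sup>2"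
      using zero_le_power2[of "f x + g x"] by (simp add: power2_eq_square algebra_simps)
    then have "ennreal ((f x - g x)\<^sup>2) \<le> ennreal (2 * (f x)\<^sup>2 + 2 * (g x)\<^sup>2)" by (rule ennreal_leI)
    also have "\<dots> = ennreal 2 * ennreal ((f x)\<^sup>2) + ennreal 2 * ennreal ((g x)\<^sup>2)"
      by (simp only: ennreal_plus ennreal_mult' zero_le_power2 mult_nonneg_nonneg zero_le_numeral)
    finally show "ennreal ((f x - g x)\<^sup>2) * indicator S x
      \<le> ennreal 2 * (ennreal ((f x)\<^sup>2) * indicator S x) + ennreal 2 * (ennreal ((g x)\<^sup>2) * indicator S x)"
      by (cases "x \<in> S") simp_all
  qed
  also have "\<dots> = ennreal 2 * (\<integral>\<^sup>+x. ennreal ((f x)\<^sup>2) * indicator S x \<partial>lborel) + ennreal 2 * (\<integral>\<^sup>+x. ennreal ((g x)\<^sup>2) * indicator S x \<partial>lborel)"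
    by (subst nn_integral_add) (auto simp: nn_integral_cmult)
  also have "\<dots> < \<infinity>" using f g by (simp add: L2_on_def ennreal_mult_less_top)
  finally show ?thesis by (simp add: L2_on_def)
qed

lemma L2_on_conv_measure:
  assumes \<nu>: "sets \<nu> = sets (borel :: pt measure)" "finite_measure \<nu>" and W: "L2_kernel r W"
  shows "L2_on S (\<lambda>x. \<integral>z. W (x - z) \<partial>\<nu>)"
proof -
  have [measurable]: "W \<in> borel_measurable borel" by (rule L2_kernelD(1)[OF W])
  have "(\<integral>\<^sup>+x. ennreal ((\<integral>z. W (x - z) \<partial>\<nu>)\<^sup>2) * indicator S x \<partial>lborel) \<le> (\<integral>\<^sup>+x. ennreal ((\<integral>z. W (x - z) \<partial>\<nu>)\<^sup>2) \<partial>lborel)"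
    by (intro nn_integral_mono) (simp add: indicator_def)
  also have "\<dots> \<le> (\<integral>\<^sup>+x. ennreal ((W x)\<^sup>2) \<partial>lborel) * (emeasure \<nu> UNIV)\<^sup>2"
    by (rule conv_measure_L2[OF \<nu>]) measurable
  also have "\<dots> < \<infinity>"
  proof -
    have "emeasure \<nu> UNIV < top" using finite_measure.emeasure_finite[OF \<nu>(2), of UNIV] by (simp add: less_top[symmetric])
    moreover have "(\<integral>\<^sup>+x. ennreal ((W x)\<^sup>2) \<partial>lborel) < \<infinity>" using W by (simp add: L2_kernel_def)
    ultimately show ?thesis by (simp add: ennreal_mult_less_top power2_eq_square)
  qed
  finally show ?thesis
    using borel_measurable_conv_measure[OF \<nu>] L2_kernelD(1)[OF W] by (simp add: L2_on_def)
qed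

section \<open>The first layer for an input with a density\<close>

context rectangle
begin

text \<open>\<open>E 1\<close> and \<open>E (-1)\<close> are the reflections of the positive and the
  negative part of \<open>v\<close>. By the area formula, integrating \<open>f\<close> over them
  means integrating the unfolded \<open>f\<close> against the parts themselves, exactly as for
  \<open>refl_meas\<close>; so the balance before reflection carries over.\<close>

lemma refl_meas_density_balance:
  assumes m1: "fin_meas_on S m1" and m2: "fin_meas_on S m2" and \<Omega>: "bounded \<Omega>"
    and v: "integrable lborel v"
    and diff: "\<And>A. A \<in> sets borel \<Longrightarrow> measure m1 A - measure m2 A = (\<integral>x. indicator A x * v x \<partial>lborel)"
    and f[measurable]: "f \<in> borel_measurable borel"
  defines "E \<equiv> \<lambda>s::real. density lborel (\<lambda>x. ennreal (max 0 (s * v (foldmap \<theta> x)) * indicator (closure \<Omega>) x))"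
  shows "(\<integral>\<^sup>+x. f x \<partial>refl_meas \<theta> \<Omega> m1) + (\<integral>\<^sup>+x. f x \<partial>E (-1))
    = (\<integral>\<^sup>+x. f x \<partial>refl_meas \<theta> \<Omega> m2) + (\<integral>\<^sup>+x. f x \<partial>E 1)"
proof -
  have [measurable]: "v \<in> borel_measurable borel" using borel_measurable_integrable[OF v] by simp
  have [measurable]: "closure \<Omega> \<in> sets borel" by simp
  obtain J where J: "finite J" "closure \<Omega> \<subseteq> (\<Union>p\<in>J. cell p)"
    using finite_cells_cover[OF bounded_closure[OF \<Omega>]] by blast
  \<comment> \<open>\<open>s\<close> selects the sign: \<open>D 1\<close> and \<open>D (-1)\<close>
    have the positive and the negative part of \<open>v\<close> as densities.\<close>
  define D where "D = (\<lambda>s::real. density lborel (\<lambda>x. ennreal (max 0 (s * v x))))"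
  have sD: "sets (D s) = sets borel" for s by (simp add: D_def)
  have sm: "sets m1 = sets borel" "sets m2 = sets borel" "finite_measure m1" "finite_measure m2"
    using m1 m2 by (auto simp: fin_meas_on_def)
  have iv: "integrable lborel (\<lambda>x. max 0 (s * v x) * indicator A x)" if [measurable]: "A \<in> sets borel" for s A
  proof (rule Bochner_Integration.integrable_bound)
    show "integrable lborel (\<lambda>x. s * v x)" using v by simp
    show "AE x in lborel. norm (max 0 (s * v x) * indicator A x) \<le> norm (s * v x)" by (auto simp: indicator_def)
  qed measurable
  have eD: "emeasure (D s) A = ennreal (\<integral>x. max 0 (s * v x) * indicator A x \<partial>lborel)" if [measurable]: "A \<in> sets borel" for s A
  proof -
    have "emeasure (D s) A = (\<integral>\<^sup>+x. ennreal (max 0 (s * v x) * indicator A x) \<partial>lborel)"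
      unfolding D_def by (subst emeasure_density) (auto intro!: nn_integral_cong simp: indicator_def)
    also have "\<dots> = ennreal (\<integral>x. max 0 (s * v x) * indicator A x \<partial>lborel)"
      by (intro nn_integral_eq_integral iv that) simp
    finally show ?thesis .
  qed
  have "emeasure m1 A + emeasure (D (-1)) A = emeasure m2 A + emeasure (D 1) A" if A[measurable]: "A \<in> sets borel" for A
  proof -
    have "(\<integral>x. max 0 (1 * v x) * indicator A x \<partial>lborel) - (\<integral>x. max 0 (-1 * v x) * indicator A x \<partial>lborel)
      = (\<integral>x. max 0 (1 * v x) * indicator A x - max 0 (-1 * v x) * indicator A x \<partial>lborel)"
      by (intro Bochner_Integration.integral_diff[symmetric] iv A)
    also have "\<dots> = (\<integral>x. indicator A x * v x \<partial>lborel)"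
      by (intro Bochner_Integration.integral_cong) (auto simp: indicator_def max_def)
    finally have "measure m1 A + (\<integral>x. max 0 (-1 * v x) * indicator A x \<partial>lborel) = measure m2 A + (\<integral>x. max 0 (1 * v x) * indicator A x \<partial>lborel)"
      using diff[OF A] by linarith
    moreover have "emeasure m1 A = ennreal (measure m1 A)" "emeasure m2 A = ennreal (measure m2 A)"
      using sm by (auto simp: finite_measure.emeasure_eq_measure)
    moreover have "(\<integral>x. max 0 (s * v x) * indicator A x \<partial>lborel) \<ge> 0" for s by (intro integral_nonneg_AE) simp
    ultimately show ?thesis unfolding eD[OF A] by (simp only: ennreal_plus[symmetric] measure_nonneg)
  qed
  note balance = nn_integral_measure_sum_eq[OF sm(1) sD sm(2) sD this]
  define h where "h = unfold_sum J (\<lambda>x. f x * indicator (closure \<Omega>) x)"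
  have [measurable]: "h \<in> borel_measurable borel" unfolding h_def by measurable
  have E: "(\<integral>\<^sup>+x. f x \<partial>E s) = (\<integral>\<^sup>+y. h y \<partial>D s)" for s
  proof -
    have "(\<integral>\<^sup>+x. f x \<partial>E s) = (\<integral>\<^sup>+x. (f x * indicator (closure \<Omega>) x) * ennreal (max 0 (s * v (foldmap \<theta> x))) \<partial>lborel)"
      unfolding E_def by (subst nn_integral_density) (auto intro!: nn_integral_cong simp: indicator_def mult.commute)
    also have "\<dots> = (\<integral>\<^sup>+y. h y * ennreal (max 0 (s * v y)) \<partial>lborel)"
      unfolding h_def
    proof (rule area_formula[OF J(1)])
      fix x assume "f x * indicator (closure \<Omega>) x \<noteq> 0"
      then show "x \<in> (\<Union>p\<in>J. cell p)" using J(2) by (auto simp: indicator_def split: if_splits)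
    qed measurable
    also have "\<dots> = (\<integral>\<^sup>+y. h y \<partial>D s)"
      unfolding D_def by (subst nn_integral_density) (auto simp: mult.commute)
    finally show ?thesis .
  qed
  show ?thesis
    unfolding E refl_meas_nn_integral(2)[OF m1 J f] refl_meas_nn_integral(2)[OF m2 J f] h_def[symmetric]
    by (rule balance, assumption, measurable)
qed

lemma finite_density_foldmap:
  assumes \<Omega>: "bounded \<Omega>" and v: "integrable lborel v"
  shows "finite_measure (density lborel (\<lambda>x. ennreal (max 0 (s * v (foldmap \<theta> x)) * indicator (closure \<Omega>) x)))"
proof (rule finite_measureI)
  have [measurable]: "v \<in> borel_measurable borel" using borel_measurable_integrable[OF v] by simp
  have [measurable]: "closure \<Omega> \<in> sets borel" by simp
  have "bounded (closure \<Omega>)" using \<Omega> by (rule bounded_closure)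
  then obtain R where R: "\<And>x. x \<in> closure \<Omega> \<Longrightarrow> norm x < R" by (meson bounded_pos_less)
  obtain M :: nat where M: "\<And>g. g \<in> borel_measurable borel \<Longrightarrow>
    (\<integral>\<^sup>+x. g (foldmap \<theta> x) * indicator (ball 0 R) x \<partial>lborel) \<le> of_nat M * (\<integral>\<^sup>+y. g y * indicator \<theta> y \<partial>lborel)"
    using nn_integral_foldmap_le by blast
  let ?g = "\<lambda>y. ennreal (\<bar>s\<bar> * \<bar>v y\<bar>)"
  have "emeasure (density lborel (\<lambda>x. ennreal (max 0 (s * v (foldmap \<theta> x)) * indicator (closure \<Omega>) x))) UNIV
    = (\<integral>\<^sup>+x. ennreal (max 0 (s * v (foldmap \<theta> x)) * indicator (closure \<Omega>) x) \<partial>lborel)"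
    by (subst emeasure_density) auto
  also have "\<dots> \<le> (\<integral>\<^sup>+x. ?g (foldmap \<theta> x) * indicator (ball 0 R) x \<partial>lborel)"
  proof (rule nn_integral_mono)
    fix x
    show "ennreal (max 0 (s * v (foldmap \<theta> x)) * indicator (closure \<Omega>) x) \<le> ?g (foldmap \<theta> x) * indicator (ball 0 R) x"
    proof (cases "x \<in> closure \<Omega>")
      case True
      have "max 0 (s * v (foldmap \<theta> x)) \<le> \<bar>s\<bar> * \<bar>v (foldmap \<theta> x)\<bar>" by (simp add: abs_mult[symmetric])
      then show ?thesis using R[OF True] True by (simp add: ennreal_leI)
    qed simp
  qed
  also have "\<dots> \<le> of_nat M * (\<integral>\<^sup>+y. ?g y * indicator \<theta> y \<partial>lborel)" by (rule M) measurable
  also have "\<dots> \<le> of_nat M * (\<integral>\<^sup>+y. ennreal (norm (s * v y)) \<partial>lborel)"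
    by (intro mult_left_mono nn_integral_mono) (auto simp: indicator_def abs_mult)
  also have "\<dots> < \<infinity>"
  proof -
    have "integrable lborel (\<lambda>y. s * v y)" using v by simp
    then show ?thesis unfolding integrable_iff_bounded by (simp add: ennreal_mult_less_top of_nat_less_top)
  qed
  finally show "emeasure (density lborel (\<lambda>x. ennreal (max 0 (s * v (foldmap \<theta> x)) * indicator (closure \<Omega>) x)))
      (space (density lborel (\<lambda>x. ennreal (max 0 (s * v (foldmap \<theta> x)) * indicator (closure \<Omega>) x)))) \<noteq> \<infinity>"
    by simp
qed

text \<open>For \<open>x\<close> in \<open>T\<close> the function z \<mapsto> W (x - z) vanishes off
  closure \<Omega>, so the truncation in \<open>refl_meas\<close> is invisible and the two parts of
  \<open>v\<close> recombine. The null set excluded is where one of four integrals over finite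
  measures fails to exist.\<close>

lemma first_layer_eq:
  assumes m1: "fin_meas_on S m1" and m2: "fin_meas_on S m2" and \<Omega>: "bounded \<Omega>"
    and v: "integrable lborel v"
    and diff: "\<And>A. A \<in> sets borel \<Longrightarrow> measure m1 A - measure m2 A = (\<integral>x. indicator A x * v x \<partial>lborel)"
    and W: "L2_kernel r W" and T: "\<And>x z. x \<in> T \<Longrightarrow> W (x - z) \<noteq> 0 \<Longrightarrow> z \<in> closure \<Omega>"
  shows "AE x in lborel. x \<in> T \<longrightarrow> integrable lborel (\<lambda>z. W (x - z) * refl_fun \<theta> v z) \<and>
    (\<integral>z. W (x - z) \<partial>refl_meas \<theta> \<Omega> m1) - (\<integral>z. W (x - z) \<partial>refl_meas \<theta> \<Omega> m2) = (\<integral>z. W (x - z) * refl_fun \<theta> v z \<partial>lborel)"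
proof -
  have [measurable]: "v \<in> borel_measurable borel" using borel_measurable_integrable[OF v] by simp
  have [measurable]: "closure \<Omega> \<in> sets borel" by simp
  have [measurable]: "W \<in> borel_measurable borel" by (rule L2_kernelD(1)[OF W])
  have W2: "(\<integral>\<^sup>+x. ennreal ((W x)\<^sup>2) \<partial>lborel) < \<infinity>" using W by (simp add: L2_kernel_def)
  let ?e = "\<lambda>s x. max 0 (s * v (foldmap \<theta> x)) * indicator (closure \<Omega>) x"
  define E where "E = (\<lambda>s::real. density lborel (\<lambda>x. ennreal (?e s x)))"
  have E: "finite_measure (E s)" "sets (E s) = sets borel" for s
    unfolding E_def using finite_density_foldmap[OF \<Omega> v] by simp_all
  note \<nu>1 = finite_measure_refl_meas[OF m1 \<Omega>] and \<nu>2 = finite_measure_refl_meas[OF m2 \<Omega>]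
  have AE: "AE x in lborel. integrable \<nu> (\<lambda>z. W (x - z))" if "finite_measure \<nu>" "sets \<nu> = sets borel" for \<nu>
    using that W2 by (intro AE_integrable_conv_measure) auto
  show ?thesis
    using AE[OF \<nu>1] AE[OF \<nu>2] AE[OF E[of 1]] AE[OF E[of "-1"]]
  proof eventually_elim
    case (elim x)
    have int: "integrable lborel (\<lambda>z. ?e s z *\<^sub>R W (x - z))" if "integrable (E s) (\<lambda>z. W (x - z))" for s
      using that unfolding E_def by (subst (asm) integrable_density) auto
    have eqE: "(\<integral>z. W (x - z) \<partial>E s) = (\<integral>z. ?e s z *\<^sub>R W (x - z) \<partial>lborel)" for s
      unfolding E_def by (subst integral_density) auto
    have "(\<integral>z. W (x - z) \<partial>refl_meas \<theta> \<Omega> m1) + (\<integral>z. W (x - z) \<partial>E (-1))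
      = (\<integral>z. W (x - z) \<partial>refl_meas \<theta> \<Omega> m2) + (\<integral>z. W (x - z) \<partial>E 1)"
    proof (rule integral_measure_sum_eq[of borel])
      fix f :: "pt \<Rightarrow> ennreal" assume "f \<in> borel_measurable borel"
      then show "(\<integral>\<^sup>+x. f x \<partial>refl_meas \<theta> \<Omega> m1) + (\<integral>\<^sup>+x. f x \<partial>E (-1)) = (\<integral>\<^sup>+x. f x \<partial>refl_meas \<theta> \<Omega> m2) + (\<integral>\<^sup>+x. f x \<partial>E 1)"
        unfolding E_def by (intro refl_meas_density_balance[OF m1 m2 \<Omega> v] diff)
    qed (use elim in auto)
    then have "(\<integral>z. W (x - z) \<partial>refl_meas \<theta> \<Omega> m1) - (\<integral>z. W (x - z) \<partial>refl_meas \<theta> \<Omega> m2)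
      = (\<integral>z. ?e 1 z *\<^sub>R W (x - z) \<partial>lborel) - (\<integral>z. ?e (-1) z *\<^sub>R W (x - z) \<partial>lborel)"
      unfolding eqE by linarith
    also have "\<dots> = (\<integral>z. ?e 1 z *\<^sub>R W (x - z) - ?e (-1) z *\<^sub>R W (x - z) \<partial>lborel)"
      by (intro Bochner_Integration.integral_diff[symmetric] int elim)
    finally have diff_eq: "(\<integral>z. W (x - z) \<partial>refl_meas \<theta> \<Omega> m1) - (\<integral>z. W (x - z) \<partial>refl_meas \<theta> \<Omega> m2)
      = (\<integral>z. ?e 1 z *\<^sub>R W (x - z) - ?e (-1) z *\<^sub>R W (x - z) \<partial>lborel)" .
    have diff_int: "integrable lborel (\<lambda>z. ?e 1 z *\<^sub>R W (x - z) - ?e (-1) z *\<^sub>R W (x - z))"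
      by (intro Bochner_Integration.integrable_diff int elim)
    show ?case
    proof
      assume "x \<in> T"
      have "?e 1 z *\<^sub>R W (x - z) - ?e (-1) z *\<^sub>R W (x - z) = W (x - z) * refl_fun \<theta> v z" for z
        using T[OF \<open>x \<in> T\<close>, of z] by (cases "W (x - z) = 0") (auto simp: refl_fun_def max_def)
      then show "integrable lborel (\<lambda>z. W (x - z) * refl_fun \<theta> v z) \<and>
        (\<integral>z. W (x - z) \<partial>refl_meas \<theta> \<Omega> m1) - (\<integral>z. W (x - z) \<partial>refl_meas \<theta> \<Omega> m2) = (\<integral>z. W (x - z) * refl_fun \<theta> v z \<partial>lborel)"
        using diff_eq diff_int by simp
    qed
  qed
qed

end

text \<open>Young's inequality for the kernel \<open>W\<close> and the measure \<open>|g(z + h) - g(z)| dz\<close>.\<close>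

lemma diffq_on_conv_L1:
  assumes W: "L2_kernel r W" and [measurable]: "g \<in> borel_measurable borel" "T \<in> sets borel" and T: "bounded T"
    and g: "diffq_loc 1 g"
    and F: "AE x in lborel. x \<in> T \<longrightarrow> integrable lborel (\<lambda>z. W (x - z) * g z) \<and> F x = (\<integral>z. W (x - z) * g z \<partial>lborel)"
  shows "diffq_on 2 T F"
proof -
  have Wm[measurable]: "W \<in> borel_measurable borel" by (rule L2_kernelD(1)[OF W])
  obtain a where a: "a \<ge> 0" "(\<integral>\<^sup>+x. ennreal ((W x)\<^sup>2) \<partial>lborel) \<le> ennreal a" using L2_kernelD(3)[OF W] by blast
  obtain R0 where R0: "\<And>x. x \<in> T \<Longrightarrow> norm x < R0" using T by (meson bounded_pos_less)
  define R where "R = R0 + r"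
  obtain C \<delta> where C: "C \<ge> 0" "\<delta> > 0" "\<And>h. norm h < \<delta> \<Longrightarrow>
     (\<integral>\<^sup>+x. ennreal (\<bar>g (x + h) - g x\<bar> ^ 1) * indicator (ball 0 R) x \<partial>lborel) \<le> ennreal (C * norm h ^ 1)"
    using g unfolding diffq_loc_def by blast
  have "(\<integral>\<^sup>+x. ennreal (\<bar>F (x + h) - F x\<bar>\<^sup>2) * indicator T (x + h) * indicator T x \<partial>lborel) \<le> ennreal ((a * C\<^sup>2) * norm h ^ 2)"
    if h: "norm h < \<delta>" for h
  proof -
    \<comment> \<open>Truncated to a ball because the L1 bound on increments is local; for
      \<open>x\<close> in \<open>T\<close> the factor W (x - z) is zero beyond that ball.\<close>
    define k where "k = (\<lambda>z. ennreal \<bar>g (z + h) - g z\<bar> * indicator (ball 0 R) z)"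
    have [measurable]: "k \<in> borel_measurable borel" unfolding k_def by measurable
    define \<mu> where "\<mu> = density lborel k"
    have \<mu>U: "emeasure \<mu> UNIV \<le> ennreal (C * norm h)"
      unfolding \<mu>_def using C(3)[OF h] by (subst emeasure_density) (auto simp: k_def)
    have \<mu>: "sets \<mu> = sets borel" "finite_measure \<mu>"
    proof -
      show "sets \<mu> = sets borel" by (simp add: \<mu>_def)
      have "emeasure \<mu> (space \<mu>) \<noteq> \<infinity>" using \<mu>U by (auto simp: \<mu>_def top_unique)
      then show "finite_measure \<mu>" by (rule finite_measureI)
    qed
    \<comment> \<open>The integral representation of \<open>F\<close> is used at \<open>x\<close>
      and at x + h, so its null set has to be shifted along.\<close>
    have le: "AE x in lborel. ennreal (\<bar>F (x + h) - F x\<bar>\<^sup>2) * indicator T (x + h) * indicator T x \<le> (\<integral>\<^sup>+z. ennreal \<bar>W (x - z)\<bar> \<partial>\<mu>)\<^sup>2"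
      using F AE_lborel_shift[OF F, of h]
    proof eventually_elim
      case (elim x)
      show ?case
      proof (cases "x \<in> T \<and> x + h \<in> T")
        case True
        have i0: "integrable lborel (\<lambda>z. W (x - z) * g z)" "F x = (\<integral>z. W (x - z) * g z \<partial>lborel)"
          and i1: "integrable lborel (\<lambda>z. W (x + h - z) * g z)" "F (x + h) = (\<integral>z. W (x + h - z) * g z \<partial>lborel)"
          using elim True by auto
        have i1': "integrable lborel (\<lambda>z. W (x - z) * g (z + h))" "F (x + h) = (\<integral>z. W (x - z) * g (z + h) \<partial>lborel)"
          using integrable_lborel_shift[OF i1(1), of h] integral_lborel_shift[of "\<lambda>z. W (x + h - z) * g z" h] i1(2) by simp_all
        have "F (x + h) - F x = (\<integral>z. W (x - z) * (g (z + h) - g z) \<partial>lborel)"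
          using i0 i1' by (simp add: right_diff_distrib)
        then have "ennreal \<bar>F (x + h) - F x\<bar> \<le> (\<integral>\<^sup>+z. ennreal \<bar>W (x - z) * (g (z + h) - g z)\<bar> \<partial>lborel)"
          by (simp only: abs_integral_le_nn_integral)
        also have "\<dots> = (\<integral>\<^sup>+z. k z * ennreal \<bar>W (x - z)\<bar> \<partial>lborel)"
        proof (rule nn_integral_cong)
          fix z
          show "ennreal \<bar>W (x - z) * (g (z + h) - g z)\<bar> = k z * ennreal \<bar>W (x - z)\<bar>"
          proof (cases "norm z < R")
            case True
            then show ?thesis by (simp add: k_def abs_mult ennreal_mult mult.commute)
          next
            case False
            have "norm (x - z) \<ge> r"
              using False R0[of x] \<open>x \<in> T \<and> x + h \<in> T\<close> norm_triangle_ineq2[of z x] by (simp add: R_def norm_minus_commute)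
            then have "W (x - z) = 0" by (rule L2_kernelD(2)[OF W])
            then show ?thesis by simp
          qed
        qed
        also have "\<dots> = (\<integral>\<^sup>+z. ennreal \<bar>W (x - z)\<bar> \<partial>\<mu>)" unfolding \<mu>_def by (subst nn_integral_density) auto
        finally have "ennreal ((F (x + h) - F x)\<^sup>2) \<le> (\<integral>\<^sup>+z. ennreal \<bar>W (x - z)\<bar> \<partial>\<mu>)\<^sup>2" by (rule ennreal_square_le)
        then show ?thesis using True by simp
      next
        case False
        then show ?thesis by (auto simp: indicator_def)
      qed
    qed
    have "(\<integral>\<^sup>+x. ennreal (\<bar>F (x + h) - F x\<bar>\<^sup>2) * indicator T (x + h) * indicator T x \<partial>lborel)
      \<le> (\<integral>\<^sup>+x. (\<integral>\<^sup>+z. ennreal \<bar>W (x - z)\<bar> \<partial>\<mu>)\<^sup>2 \<partial>lborel)" by (rule nn_integral_mono_AE[OF le])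
    also have "\<dots> \<le> (\<integral>\<^sup>+x. ennreal ((W x)\<^sup>2) \<partial>lborel) * (emeasure \<mu> UNIV)\<^sup>2"
      by (rule nn_integral_conv_measure_square_le[OF \<mu> Wm])
    also have "\<dots> \<le> ennreal a * (ennreal (C * norm h))\<^sup>2"
      by (intro mult_mono a power_mono \<mu>U) auto
    also have "\<dots> = ennreal (a * (C * norm h)\<^sup>2)"
      by (simp only: ennreal_power[OF mult_nonneg_nonneg[OF C(1) norm_ge_zero]] ennreal_mult[OF a(1) zero_le_power2])
    also have "\<dots> = ennreal ((a * C\<^sup>2) * norm h ^ 2)" by (simp add: power_mult_distrib mult.assoc)
    finally show ?thesis .
  qed
  then show ?thesis unfolding diffq_on_def using a(1) C by (intro exI[of _ "a * C\<^sup>2"] exI[of _ \<delta>]) simp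
qed

lemma bounded_mdiff:
  assumes "bounded A" "bounded B"
  shows "bounded (mdiff A B)"
proof -
  obtain r s where "\<And>x. x \<in> A \<Longrightarrow> norm x \<le> r" "\<And>x. x \<in> B \<Longrightarrow> norm x \<le> s"
    using assms unfolding bounded_iff by blast
  note rs = this
  have "norm x \<le> r + s" if x: "x \<in> mdiff A B" for x
  proof -
    obtain y z where "x = y - z" "y \<in> A" "z \<in> B" using x unfolding mdiff_def by blast
    then show ?thesis using order_trans[OF norm_triangle_ineq4 add_mono[OF rs]] by simp
  qed
  then show ?thesis unfolding bounded_iff by blast
qed

lemma first_layer_L2:
  assumes S: "rect S" and m: "fin_meas_on S' m" and T: "rect T" "rect \<Sigma>"
    and W: "L2_kernel r (\<lambda>y. indicator \<Sigma> y * w y)"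
  shows "L2_on X (conv_meas \<Sigma> w (refl_meas S (mdiff T \<Sigma>) m))"
  using S
proof (rule rectE)
  fix a b c d assume r: "rectangle a b c d" and S_eq: "S = {a<..<b} \<times> {c<..<d}"
  interpret rectangle a b c d by (rule r)
  have "bounded (mdiff T \<Sigma>)" using rect_bounded_borel T by (intro bounded_mdiff)
  from finite_measure_refl_meas[OF m this] show ?thesis
    unfolding conv_meas_def[abs_def] S_eq by (intro L2_on_conv_measure[OF _ _ W])
qed

lemma first_layer_diffq:
  assumes S: "rect S" and m1: "fin_meas_on S' m1" and m2: "fin_meas_on S' m2" and T: "rect T" "rect \<Sigma>"
    and W: "L2_kernel r (\<lambda>y. indicator \<Sigma> y * w y)"
    and u: "BV S u" and diff: "\<forall>A \<in> sets borel. measure m1 A - measure m2 A = (\<integral>x\<in>A \<inter> S. u x \<partial>lborel)"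
  shows "diffq_on 2 T (\<lambda>x. conv_meas \<Sigma> w (refl_meas S (mdiff T \<Sigma>) m1) x - conv_meas \<Sigma> w (refl_meas S (mdiff T \<Sigma>) m2) x)"
  using S
proof (rule rectE)
  fix a b c d assume r: "rectangle a b c d" and S_eq: "S = {a<..<b} \<times> {c<..<d}"
  interpret rectangle a b c d by (rule r)
  let ?v = "\<lambda>x. indicator S x * u x"
  let ?W = "\<lambda>y. indicator \<Sigma> y * w y"
  have v: "integrable lborel ?v" "diffq_on 1 S ?v" using BV_diffq_on[of u] u unfolding S_eq by auto
  have vm: "?v \<in> borel_measurable borel" using borel_measurable_integrable[OF v(1)] by simp
  have bd: "bounded (mdiff T \<Sigma>)" using rect_bounded_borel T by (intro bounded_mdiff)
  have diffv: "measure m1 A - measure m2 A = (\<integral>x. indicator A x * ?v x \<partial>lborel)" if "A \<in> sets borel" for A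
    using diff that by (simp add: set_lebesgue_integral_def indicator_inter_arith mult.assoc)
  note eq = first_layer_eq[OF m1 m2 bd v(1) _ W, of T, folded S_eq]
  show ?thesis
  proof (rule diffq_on_conv_L1[OF W])
    show "diffq_loc 1 (refl_fun S ?v)" by (rule refl_fun_diffq_loc[OF S vm v(2)]) simp
    show "refl_fun S ?v \<in> borel_measurable borel"
      unfolding refl_fun_def using vm foldmap_measurable unfolding S_eq by measurable
    show "AE x in lborel. x \<in> T \<longrightarrow> integrable lborel (\<lambda>z. ?W (x - z) * refl_fun S ?v z) \<and>
      conv_meas \<Sigma> w (refl_meas S (mdiff T \<Sigma>) m1) x - conv_meas \<Sigma> w (refl_meas S (mdiff T \<Sigma>) m2) x
        = (\<integral>z. ?W (x - z) * refl_fun S ?v z \<partial>lborel)"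
      unfolding conv_meas_def
    proof (rule eq)
      show "measure m1 A - measure m2 A = (\<integral>x. indicator A x * ?v x \<partial>lborel)" if "A \<in> sets borel" for A
        using that by (rule diffv)
    next
      \<comment> \<open>This is what makes the convolution valid: if x - z lies in \<Sigma>, then z
        = x - (x - z) lies in T - \<Sigma>.\<close>
      fix x z assume "x \<in> T" "?W (x - z) \<noteq> 0"
      then have "z = x - (x - z) \<and> x \<in> T \<and> x - z \<in> \<Sigma>" by (auto simp: indicator_def split: if_splits)
      then have "z \<in> mdiff T \<Sigma>" unfolding mdiff_def by blast
      then show "z \<in> closure (mdiff T \<Sigma>)" using closure_subset by blast
    qed
  qed (use rect_bounded_borel[OF T(1)] in auto)
qed

section \<open>Continuity and differentiability of the network output\<close>

text \<open>Membership in C or C1 concerns a class of almost everywhere equal functions, hence the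
  representative \<open>g\<close>. The network function itself serves as \<open>g\<close>, since its
  last layer is a convolution on the whole plane plus a constant; the partial derivatives found are
  continuous on the plane and so up to the boundary.\<close>

theorem theorem2p1:
  fixes L :: nat and \<sigma> :: "real \<Rightarrow> real"
    and Om Sg :: "nat \<Rightarrow> (real \<times> real) set"
    and m1 m2 :: "(real \<times> real) measure"
    and w :: "nat \<Rightarrow> (real \<times> real) \<Rightarrow> real" and b :: "nat \<Rightarrow> real"
  assumes L: "L \<ge> 2"
    and lip: "\<exists>K. K-lipschitz_on UNIV \<sigma>"
    and rOm: "\<And>l. l \<le> L \<Longrightarrow> rect (Om l)"
    and rSg: "\<And>l. l < L \<Longrightarrow> rect (Sg l) \<and> 0 \<in> Sg l"
    and incl: "\<And>l. l < L \<Longrightarrow> Om l \<subseteq> mdiff (Om (Suc l)) (Sg l)"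
    and wmeas: "\<And>l. l < L \<Longrightarrow> set_borel_measurable lborel (Sg l) (w l)"
    and wL2: "\<And>l. l < L \<Longrightarrow> set_integrable lborel (Sg l) (\<lambda>y. (w l y)\<^sup>2)"
    and m1: "fin_meas_on (closure (Om 0)) m1"
    and m2: "fin_meas_on (closure (Om 0)) m2"
  shows "(\<exists>g. continuous_on (closure (Om L)) g \<and>
            (AE x in lborel. x \<in> Om L \<longrightarrow> cnn L \<sigma> Om Sg m1 m2 w b x = g x))
       \<and> (\<forall>u. BV (Om 0) u \<and>
             (\<forall>A \<in> sets borel. measure m1 A - measure m2 A = (\<integral>x\<in>A \<inter> Om 0. u x \<partial>lborel))
           \<longrightarrow> (\<exists>g g1 g2. continuous_on (closure (Om L)) g \<and>
                 continuous_on (closure (Om L)) g1 \<and> continuous_on (closure (Om L)) g2 \<and>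
                 (\<forall>x \<in> Om L. (g has_derivative (\<lambda>h. g1 x * fst h + g2 x * snd h)) (at x)) \<and>
                 (AE x in lborel. x \<in> Om L \<longrightarrow> cnn L \<sigma> Om Sg m1 m2 w b x = g x)))"
proof -
  obtain K where K: "K-lipschitz_on UNIV \<sigma>" using lip by blast
  define W where "W = (\<lambda>l y. indicator (Sg l) y * w l y)"
  have W: "\<exists>r. L2_kernel r (W l)" if "l < L" for l
    unfolding W_def using kernel_of_set rSg wmeas wL2 that by blast
  let ?layer = "cnn_layer \<sigma> Om Sg m1 m2 w b"
  let ?F = "\<lambda>l. conv (W l) (refl_fun (Om l) (?layer l))"
  let ?pre = "\<lambda>x. conv_meas (Sg 0) (w 0) (refl_meas (Om 0) (mdiff (Om 1) (Sg 0)) m1) x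
     - conv_meas (Sg 0) (w 0) (refl_meas (Om 0) (mdiff (Om 1) (Sg 0)) m2) x"
  note OmD = rect_bounded_borel[OF rOm]
  have L0: "0 < L" "1 \<le> L" using L by auto
  have layer1: "?layer (Suc 0) = (\<lambda>x. \<sigma> (?pre x + b 0))" by simp
  have layerS: "?layer (Suc (Suc l)) = (\<lambda>x. \<sigma> (?F (Suc l) x + b (Suc l)))" for l
    by (simp add: conv_fun_eq_conv W_def)
  obtain r0 where W0: "L2_kernel r0 (\<lambda>y. indicator (Sg 0) y * w 0 y)" using W[OF L0(1)] unfolding W_def by blast
  have F0: "L2_on (Om 1) ?pre"
    using first_layer_L2[OF rOm m1 rOm _ W0] first_layer_L2[OF rOm m2 rOm _ W0] rSg L0
    by (intro L2_on_diff OmD(2)) auto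
  \<comment> \<open>Only the first hidden layer is merely L2; every later one is continuous before
    the activation and therefore bounded on its domain.\<close>
  have layer_L2: "L2_on (Om (Suc l)) (?layer (Suc l))" if "Suc l \<le> L" for l
    using that
  proof (induction l)
    case 0
    show ?case unfolding layer1 using F0 OmD(1,2)[OF L0(2)] by (intro Lipschitz_comp_L2_on[OF K]) auto
  next
    case (Suc l)
    obtain r where r: "L2_kernel r (W (Suc l))" using W[of "Suc l"] Suc.prems by auto
    have "L2loc (refl_fun (Om (Suc l)) (?layer (Suc l)))"
      using Suc by (intro refl_fun_L2loc rOm) auto
    from continuous_conv[OF r this] show ?case
      unfolding layerS using OmD(1,2)[OF Suc.prems]
      by (intro Lipschitz_comp_L2_on[OF K] continuous_imp_L2_on)
  qed
  \<comment> \<open>L = n + 2 exposes the two successors on which \<open>cnn_layer\<close> recurses;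
    the last hidden layer has index n + 1.\<close>
  obtain n where "L = 2 + n" using le_Suc_ex[OF L] by blast
  then have n: "L = Suc (Suc n)" by simp
  have cnn: "cnn L \<sigma> Om Sg m1 m2 w b = (\<lambda>x. ?F (Suc n) x + b (Suc n))"
  proof -
    have "L - 1 = Suc n" "L \<noteq> 1" using n by simp_all
    then show ?thesis unfolding cnn_def by (simp only: if_False conv_fun_eq_conv W_def)
  qed
  obtain r where r: "L2_kernel r (W (Suc n))" using W[of "Suc n"] n by auto
  have loc: "L2loc (refl_fun (Om l) (?layer l))" if "0 < l" "l \<le> L" for l
    using layer_L2[of "l - 1"] that by (intro refl_fun_L2loc rOm) auto
  have cont: "continuous_on S (cnn L \<sigma> Om Sg m1 m2 w b)" for S
    unfolding cnn using continuous_on_subset[OF continuous_conv[OF r loc]] n by (intro continuous_intros) auto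
  show ?thesis
  proof (intro conjI allI impI)
    show "\<exists>g. continuous_on (closure (Om L)) g \<and> (AE x in lborel. x \<in> Om L \<longrightarrow> cnn L \<sigma> Om Sg m1 m2 w b x = g x)"
      using cont by (intro exI[of _ "cnn L \<sigma> Om Sg m1 m2 w b"]) auto
  next
    fix u assume u: "BV (Om 0) u \<and> (\<forall>A \<in> sets borel. measure m1 A - measure m2 A = (\<integral>x\<in>A \<inter> Om 0. u x \<partial>lborel))"
    have layer_meas: "?layer (Suc l) \<in> borel_measurable borel" if "Suc l \<le> L" for l
      using layer_L2[OF that] by (simp add: L2_on_def)
    \<comment> \<open>The first layer trades BV for H1. From then on H1 is kept: reflection
      preserves it, convolution gives a locally Lipschitz function, and the activation preserves it
      again.\<close>
    have diffq: "diffq_on 2 (Om (Suc l)) (?layer (Suc l))" if "Suc l \<le> L" for l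
      using that
    proof (induction l)
      case 0
      have "diffq_on 2 (Om 1) ?pre"
        using u L0 rSg by (intro first_layer_diffq[OF rOm m1 m2 rOm _ W0]) auto
      then show ?case
        unfolding layer1 using F0 OmD(2)[OF L0(2)] by (intro Lipschitz_comp_diffq_on[OF K]) (auto simp: L2_on_def)
    next
      case (Suc l)
      have l: "Suc l \<le> L" using Suc.prems by simp
      obtain r where r: "L2_kernel r (W (Suc l))" using W[of "Suc l"] Suc.prems by auto
      have dl: "diffq_loc 2 (refl_fun (Om (Suc l)) (?layer (Suc l)))"
        using Suc.IH[OF l] layer_meas[OF l] by (intro refl_fun_diffq_loc rOm l) auto
      have "diffq_on 2 (Om (Suc (Suc l))) (?F (Suc l))"
        using conv_Lipschitz_locally[OF r loc[OF _ l] dl] OmD(1,2)[OF Suc.prems]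
        by (intro locally_Lipschitz_imp_diffq_on) auto
      moreover have "?F (Suc l) \<in> borel_measurable borel"
        using continuous_conv[OF r loc[OF _ l]] by (intro borel_measurable_continuous_onI) auto
      ultimately show ?case
        unfolding layerS using OmD(2)[OF Suc.prems] by (intro Lipschitz_comp_diffq_on[OF K])
    qed
    have nL: "Suc n \<le> L" using n by simp
    have "diffq_loc 2 (refl_fun (Om (Suc n)) (?layer (Suc n)))"
      using diffq[OF nL] layer_meas[OF nL] by (intro refl_fun_diffq_loc rOm nL) auto
    from conv_C1[OF r loc[OF _ nL] this] obtain G1 G2 where G: "continuous_on UNIV G1" "continuous_on UNIV G2"
      "\<And>x. (?F (Suc n) has_derivative (\<lambda>h. G1 x * fst h + G2 x * snd h)) (at x)" by auto
    have "(cnn L \<sigma> Om Sg m1 m2 w b has_derivative (\<lambda>h. G1 x * fst h + G2 x * snd h)) (at x)" for x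
      unfolding cnn by (rule has_derivative_eq_rhs[OF has_derivative_add[OF G(3) has_derivative_const]]) simp
    then show "\<exists>g g1 g2. continuous_on (closure (Om L)) g \<and>
        continuous_on (closure (Om L)) g1 \<and> continuous_on (closure (Om L)) g2 \<and>
        (\<forall>x \<in> Om L. (g has_derivative (\<lambda>h. g1 x * fst h + g2 x * snd h)) (at x)) \<and>
        (AE x in lborel. x \<in> Om L \<longrightarrow> cnn L \<sigma> Om Sg m1 m2 w b x = g x)"
      using cont continuous_on_subset[OF G(1) subset_UNIV] continuous_on_subset[OF G(2) subset_UNIV]
      by (intro exI[of _ "cnn L \<sigma> Om Sg m1 m2 w b"] exI[of _ G1] exI[of _ G2]) auto
  qed
qed

end
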